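(* Let $L$ be a logical system of dimension $d_L$ and $A=A_1\otimes\cdots\otimes A_n$ with $\dim A_i=d_i<\infty$. Let $V:L\to A$ be an isometry with $\mathcal{E}(\cdot)=V(\cdot)V^\dagger$ that is covariant with respect to the full group $SU(d_L)$ acting transversally: there are continuous unitary representations $U_i$ of $SU(d_L)$ on $A_i$ with $\mathcal{E}(U(\cdot)U^\dagger)=U_A(U)\mathcal{E}(\cdot)U_A(U)^\dagger$, $U_A(U)=U_1(U)\otimes\cdots\otimes U_n(U)$, for all $U\in SU(d_L)$. Let $\mathcal{N}(\cdot)=\sum_{i=1}^n\frac1n|i\rangle\langle i|_C\otimes|\phi_i\rangle\langle\phi_i|_{A_i}\otimes\operatorname{tr}_{A_i}(\cdot)$. Then $$\max_id_i\geq\binom{d_L-1+\left\lceil(2n\,\epsilon_{\mathrm{worst}}(\mathcal{N}\circ\mathcal{E}))^{-1}\right\rceil}{d_L-1}$$ and $$\max_id_i\geq\binom{d_L-1+\left\lceil(n\,d_L\,\epsilon_{\mathrm e}(\mathcal{N}\circ\mathcal{E}))^{-1}\right\rceil}{d_L-1}.$$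
   Context: Fidelity $F(\rho,\sigma)=\|\sqrt\rho\sqrt\sigma\|_1$; for channels $\mathcal{K},\mathcal{K}'$ with input $L$ and pure $|\phi\rangle_{LR}$, $F_{|\phi\rangle}(\mathcal{K},\mathcal{K}')=F((\mathcal{K}\otimes\mathrm{id}_R)(\phi),(\mathcal{K}'\otimes\mathrm{id}_R)(\phi))$; $|\hat\phi\rangle=\sum_k|k\rangle|k\rangle/\sqrt{d_L}$. For a channel $\mathcal{M}$ from $L$ to $B$: $f_{\mathrm e}(\mathcal{M})=\max_{\mathcal{R}}F_{|\hat\phi\rangle}(\mathcal{R}\circ\mathcal{M},\mathrm{id}_L)$, $f_{\mathrm{worst}}(\mathcal{M})=\max_{\mathcal{R}}\min_{|\phi\rangle}F_{|\phi\rangle}(\mathcal{R}\circ\mathcal{M},\mathrm{id}_L)$ over channels $\mathcal{R}:B\to L$; $\epsilon_{\mathrm e}=\sqrt{1-f_{\mathrm e}^2}$, $\epsilon_{\mathrm{worst}}=\sqrt{1-f_{\mathrm{worst}}^2}$. *)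

theory Defs
  imports "HOL-Analysis.Analysis" "Jordan_Normal_Form.Schur_Decomposition"
          "Jordan_Normal_Form.Determinant"
begin

definition mtrace :: "complex mat \<Rightarrow> complex" where
  "mtrace A = (\<Sum>i<dim_row A. A $$ (i,i))"

definition psd :: "complex mat \<Rightarrow> bool" where
  "psd A \<longleftrightarrow> dim_row A = dim_col A \<and> mat_adjoint A = A \<and>
     (\<forall>v \<in> carrier_vec (dim_row A). 0 \<le> Re ((A *\<^sub>v v) \<bullet>c v))"

definition msqrt :: "complex mat \<Rightarrow> complex mat" where
  "msqrt A = (THE B. B \<in> carrier_mat (dim_row A) (dim_row A) \<and> psd B \<and> B * B = A)"

definition trace_norm :: "complex mat \<Rightarrow> real" where
  "trace_norm M = Re (mtrace (msqrt (mat_adjoint M * M)))"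

definition fidelity :: "complex mat \<Rightarrow> complex mat \<Rightarrow> real" where
  "fidelity \<rho> \<sigma> = trace_norm (msqrt \<rho> * msqrt \<sigma>)"

definition ket_bra :: "complex vec \<Rightarrow> complex mat" where
  "ket_bra v = mat (dim_vec v) (dim_vec v) (\<lambda>(i,j). v $ i * cnj (v $ j))"

definition unit_vec_c :: "nat \<Rightarrow> complex vec \<Rightarrow> bool" where
  "unit_vec_c k v \<longleftrightarrow> v \<in> carrier_vec k \<and> v \<bullet>c v = 1"

definition unitary_mat :: "nat \<Rightarrow> complex mat \<Rightarrow> bool" where
  "unitary_mat k U \<longleftrightarrow> U \<in> carrier_mat k k \<and> mat_adjoint U * U = 1\<^sub>m k"

text \<open>Kronecker (tensor) product; first factor is the most significant index.\<close>
definition kron :: "complex mat \<Rightarrow> complex mat \<Rightarrow> complex mat" where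
  "kron A B = mat (dim_row A * dim_row B) (dim_col A * dim_col B)
     (\<lambda>(i,j). A $$ (i div dim_row B, j div dim_col B) * B $$ (i mod dim_row B, j mod dim_col B))"

definition kron_list :: "complex mat list \<Rightarrow> complex mat" where
  "kron_list As = foldr kron As (1\<^sub>m 1)"

text \<open>A channel from a din-dimensional to a dout-dimensional system, i.e. a CPTP map,
  given (on din x din matrices) by a Kraus representation.\<close>
definition is_channel :: "nat \<Rightarrow> nat \<Rightarrow> (complex mat \<Rightarrow> complex mat) \<Rightarrow> bool" where
  "is_channel din dout \<Phi> \<longleftrightarrow> (\<exists>Ks :: complex mat list.
      set Ks \<subseteq> carrier_mat dout din \<and>
      mat din din (\<lambda>(a,b). \<Sum>k<length Ks. (mat_adjoint (Ks!k) * (Ks!k)) $$ (a,b)) = 1\<^sub>m din \<and>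
      (\<forall>\<rho> \<in> carrier_mat din din.
          \<Phi> \<rho> = mat dout dout (\<lambda>(a,b). \<Sum>k<length Ks. ((Ks!k) * \<rho> * mat_adjoint (Ks!k)) $$ (a,b))))"

text \<open>(K \<otimes> id_R) applied to an operator X on L \<otimes> R (L first), for a linear map K
  from din x din to dout x dout matrices.\<close>
definition tensor_id :: "(complex mat \<Rightarrow> complex mat) \<Rightarrow> nat \<Rightarrow> nat \<Rightarrow> nat \<Rightarrow> complex mat \<Rightarrow> complex mat" where
  "tensor_id K din dout dR X = mat (dout * dR) (dout * dR) (\<lambda>(p,q).
      K (mat din din (\<lambda>(l,l'). X $$ (l * dR + p mod dR, l' * dR + q mod dR)))
        $$ (p div dR, q div dR))"

definition fid_state :: "nat \<Rightarrow> nat \<Rightarrow> nat \<Rightarrow> complex vec \<Rightarrow>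
    (complex mat \<Rightarrow> complex mat) \<Rightarrow> (complex mat \<Rightarrow> complex mat) \<Rightarrow> real" where
  "fid_state din dout dR \<phi> K K' =
     fidelity (tensor_id K din dout dR (ket_bra \<phi>)) (tensor_id K' din dout dR (ket_bra \<phi>))"

definition max_ent :: "nat \<Rightarrow> complex vec" where
  "max_ent dL = vec (dL * dL) (\<lambda>p. if p div dL = p mod dL then 1 / complex_of_real (sqrt (real dL)) else 0)"

definition f_e :: "nat \<Rightarrow> nat \<Rightarrow> (complex mat \<Rightarrow> complex mat) \<Rightarrow> real" where
  "f_e dL dB M = Sup {fid_state dL dL dL (max_ent dL) (R \<circ> M) id | R. is_channel dB dL R}"

definition f_worst :: "nat \<Rightarrow> nat \<Rightarrow> (complex mat \<Rightarrow> complex mat) \<Rightarrow> real" where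
  "f_worst dL dB M = Sup {Inf {fid_state dL dL dR \<phi> (R \<circ> M) id | dR \<phi>.
         1 \<le> dR \<and> unit_vec_c (dL * dR) \<phi>} | R. is_channel dB dL R}"

definition eps_e :: "nat \<Rightarrow> nat \<Rightarrow> (complex mat \<Rightarrow> complex mat) \<Rightarrow> real" where
  "eps_e dL dB M = sqrt (1 - (f_e dL dB M)\<^sup>2)"

definition eps_worst :: "nat \<Rightarrow> nat \<Rightarrow> (complex mat \<Rightarrow> complex mat) \<Rightarrow> real" where
  "eps_worst dL dB M = sqrt (1 - (f_worst dL dB M)\<^sup>2)"

definition total_dim :: "nat \<Rightarrow> (nat \<Rightarrow> nat) \<Rightarrow> nat" where
  "total_dim n d = (\<Prod>i<n. d i)"

text \<open>Place value of the i-th tensor factor (A_0 most significant).\<close>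
definition wgt :: "nat \<Rightarrow> (nat \<Rightarrow> nat) \<Rightarrow> nat \<Rightarrow> nat" where
  "wgt n d i = (\<Prod>k\<in>{i<..<n}. d k)"

definition digit :: "nat \<Rightarrow> (nat \<Rightarrow> nat) \<Rightarrow> nat \<Rightarrow> nat \<Rightarrow> nat" where
  "digit n d i x = x div wgt n d i mod d i"

definition set_digit :: "nat \<Rightarrow> (nat \<Rightarrow> nat) \<Rightarrow> nat \<Rightarrow> nat \<Rightarrow> nat \<Rightarrow> nat" where
  "set_digit n d i x k = x - digit n d i x * wgt n d i + k * wgt n d i"

text \<open>|phi_i><phi_i|_{A_i} \<otimes> tr_{A_i}(rho), with A_i kept in its position.\<close>
definition replace_factor :: "nat \<Rightarrow> (nat \<Rightarrow> nat) \<Rightarrow> nat \<Rightarrow> complex vec \<Rightarrow> complex mat \<Rightarrow> complex mat" where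
  "replace_factor n d i \<phi> \<rho> = mat (total_dim n d) (total_dim n d) (\<lambda>(a,b).
      \<phi> $ digit n d i a * cnj (\<phi> $ digit n d i b) *
      (\<Sum>k<d i. \<rho> $$ (set_digit n d i a k, set_digit n d i b k)))"

text \<open>N(rho) = sum_i (1/n) |i><i|_C \<otimes> |phi_i><phi_i|_{A_i} \<otimes> tr_{A_i}(rho), output on C \<otimes> A
  (C of dimension n, first factor), indices i = 0..n-1.\<close>
definition noiseN :: "nat \<Rightarrow> (nat \<Rightarrow> nat) \<Rightarrow> (nat \<Rightarrow> complex vec) \<Rightarrow> complex mat \<Rightarrow> complex mat" where
  "noiseN n d \<phi>s \<rho> = mat (n * total_dim n d) (n * total_dim n d) (\<lambda>(p,q).
      if p div total_dim n d = q div total_dim n d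
      then replace_factor n d (p div total_dim n d) (\<phi>s (p div total_dim n d)) \<rho>
             $$ (p mod total_dim n d, q mod total_dim n d) / of_nat n
      else 0)"

definition SU :: "nat \<Rightarrow> complex mat set" where
  "SU k = {U. unitary_mat k U \<and> det U = 1}"

definition cont_unitary_rep :: "nat \<Rightarrow> nat \<Rightarrow> (complex mat \<Rightarrow> complex mat) \<Rightarrow> bool" where
  "cont_unitary_rep dL k \<rho> \<longleftrightarrow>
     (\<forall>U \<in> SU dL. unitary_mat k (\<rho> U)) \<and>
     (\<forall>U \<in> SU dL. \<forall>W \<in> SU dL. \<rho> (U * W) = \<rho> U * \<rho> W) \<and>
     (\<forall>U \<in> SU dL. \<forall>e>0. \<exists>\<delta>>0. \<forall>W \<in> SU dL.
        (\<forall>a<dL. \<forall>b<dL. cmod (W $$ (a,b) - U $$ (a,b)) < \<delta>) \<longrightarrow>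
        (\<forall>a<k. \<forall>b<k. cmod (\<rho> W $$ (a,b) - \<rho> U $$ (a,b)) < e))"

end

theory Submission
  imports Defs "Jordan_Normal_Form.Spectral_Radius"
begin

text \<open>Let T_i be the generator of the one-parameter group diag(cis t, cis (- t), 1, ..., 1) in the
  representation on the i-th factor, and J the largest absolute value of an eigenvalue of any T_i.
  By covariance the expectations of T_1 + ... + T_n in the encoded basis states 0 and 1 differ
  by 2. The lost factor ends up in the environment, so n T_i on it, at a random i, has the same
  difference of expectations: the environment is correlated with a reference that is entangled with
  the logical system, unless the recovery is imperfect. For a Schmidt state with equal coefficients s
  on 0 and 1 and entanglement fidelity F a perturbation estimate gives s^2 \<le> n J sqrt (1 - F^2).
  The maximally entangled state (s^2 = 1/d_L) yields n d_L eps_e \<ge> 1/J and the state supported on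
  0 and 1 (s^2 = 1/2) yields 2 n eps_worst \<ge> 1/J.

  On the other hand J is the value of a root functional on a weight of some T_i. The weights of a
  representation of SU(d) are closed under root strings and under exchange of coordinates, so from
  this one weight one reaches at least as many as there are ways to distribute J units over d
  coordinates, namely (d - 1 + J) choose (d - 1).\<close>

unbundle no vec_syntax

section \<open>Isometries and simultaneous diagonalisation\<close>

text \<open>The representations are only given as continuous, so no action of the Lie algebra is at
  hand. Continuity is spent on the torus, where it makes the characters integral and hence
  differentiable. The rest of an embedded SU(2) is reached by conjugating torus elements, which
  yields a Lipschitz bound at the identity. Hence a curve with zero tangent has zero derivative in
  the representation, and derivatives combine linearly as tangents do. Ladder operators and their
  commutators rest on this. Covariance concerns the channel and fixes the action on code words only
  up to a phase. The phase cancels when two logical basis states are compared through the matrix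
  unit between them; the charge difference 2 is the root of the chosen one-parameter group on that
  unit. In the perturbation estimate the purified output is compared with the initial state times
  the environment vector obtained by projecting the output onto it. The difference of the two
  expectations is one form between the difference and the sum of these vectors, which is where 2
  sqrt (1 - F^2) comes from.\<close>

lemma mat_adjoint_dim [simp]:
  "dim_row (mat_adjoint A) = dim_col A" "dim_col (mat_adjoint A) = dim_row A"
  by (simp_all add: mat_adjoint_def)

lemma mat_adjoint_index [simp]:
  fixes A :: "complex mat"
  assumes "i < dim_col A" "j < dim_row A"
  shows "mat_adjoint A $$ (i,j) = cnj (A $$ (j,i))"
  using assms by (simp add: mat_adjoint_def mat_of_rows_def)

lemma mat_adjoint_carrier [simp, intro]:
  "A \<in> carrier_mat n m \<Longrightarrow> mat_adjoint A \<in> carrier_mat m n"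
  by (intro carrier_matI) auto

lemma mult_mat_index_sum:
  assumes "A \<in> carrier_mat n m" "B \<in> carrier_mat m l" "i < n" "j < l"
  shows "(A * B) $$ (i,j) = (\<Sum>t<m. A $$ (i,t) * B $$ (t,j))"
  using assms by (auto simp: scalar_prod_def atLeast0LessThan intro!: sum.cong)

lemma mult_mat_vec_index_sum:
  assumes "A \<in> carrier_mat n m" "v \<in> carrier_vec m" "i < n"
  shows "(A *\<^sub>v v) $ i = (\<Sum>t<m. A $$ (i,t) * v $ t)"
  using assms by (auto simp: scalar_prod_def atLeast0LessThan intro!: sum.cong)

lemma cscalar_prod_sum:
  fixes v w :: "complex vec"
  assumes "w \<in> carrier_vec k"
  shows "v \<bullet>c w = (\<Sum>t<k. v $ t * cnj (w $ t))"
  using assms by (auto simp: scalar_prod_def atLeast0LessThan intro!: sum.cong)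

lemma mat_adjoint_mult:
  fixes A B :: "complex mat"
  assumes "A \<in> carrier_mat n m" "B \<in> carrier_mat m l"
  shows "mat_adjoint (A * B) = mat_adjoint B * mat_adjoint A"
proof (rule eq_matI)
  fix i j assume "i < dim_row (mat_adjoint B * mat_adjoint A)"
    "j < dim_col (mat_adjoint B * mat_adjoint A)"
  then have ij: "i < l" "j < n" using assms by auto
  have "mat_adjoint (A * B) $$ (i,j) = cnj ((A * B) $$ (j,i))"
    using assms ij by (subst mat_adjoint_index) auto
  also have "\<dots> = (\<Sum>t<m. cnj (B $$ (t,i)) * cnj (A $$ (j,t)))"
    using ij by (simp add: mult_mat_index_sum[OF assms] mult.commute del: index_mult_mat)
  also have "\<dots> = (mat_adjoint B * mat_adjoint A) $$ (i,j)"
    using assms ij by (subst mult_mat_index_sum[of _ l m _ n]) (auto intro!: sum.cong)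
  finally show "mat_adjoint (A * B) $$ (i,j) = (mat_adjoint B * mat_adjoint A) $$ (i,j)" .
qed (use assms in auto)

lemma mat_adjoint_adjoint [simp]: "mat_adjoint (mat_adjoint A) = (A :: complex mat)"
  by (rule eq_matI) auto

lemma mat_adjoint_one [simp]: "mat_adjoint (1\<^sub>m n) = (1\<^sub>m n :: complex mat)"
  by (rule eq_matI) auto

lemma gram_index:
  fixes A B :: "complex mat"
  assumes "A \<in> carrier_mat k r" "B \<in> carrier_mat k s" "i < r" "j < s"
  shows "(mat_adjoint A * B) $$ (i,j) = (\<Sum>t<k. cnj (A $$ (t,i)) * B $$ (t,j))"
  using assms by (subst mult_mat_index_sum[of _ r k _ s]) (auto intro!: sum.cong)

text \<open>Too many columns would allow padding with zero rows to a square isometry. Such a matrix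
  is unitary, so its rows are orthonormal as well, yet one of them is zero.\<close>

lemma isometry_dim_le:
  fixes Q :: "complex mat"
  assumes Q: "Q \<in> carrier_mat k r" and iso: "mat_adjoint Q * Q = 1\<^sub>m r"
  shows "r \<le> k"
proof (rule ccontr)
  assume "\<not> r \<le> k"
  then have kr: "k < r" by simp
  define P :: "complex mat" where "P = mat r r (\<lambda>(i,j). if i < k then Q $$ (i,j) else 0)"
  have P: "P \<in> carrier_mat r r" by (simp add: P_def)
  have "mat_adjoint P * P = 1\<^sub>m r"
  proof (rule eq_matI)
    fix i j assume "i < dim_row (1\<^sub>m r :: complex mat)" "j < dim_col (1\<^sub>m r :: complex mat)"
    then have ij: "i < r" "j < r" by auto
    have "(mat_adjoint P * P) $$ (i,j) = (\<Sum>t<r. cnj (P $$ (t,i)) * P $$ (t,j))"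
      by (rule gram_index[OF P P ij])
    also have "\<dots> = (\<Sum>t<k. cnj (Q $$ (t,i)) * Q $$ (t,j))"
      using kr ij by (intro sum.mono_neutral_cong_right) (auto simp: P_def)
    also have "\<dots> = 1\<^sub>m r $$ (i,j)"
      using gram_index[OF Q Q ij] iso by simp
    finally show "(mat_adjoint P * P) $$ (i,j) = 1\<^sub>m r $$ (i,j)" .
  qed (use P in auto)
  then have one: "P * mat_adjoint P = 1\<^sub>m r"
    using mat_mult_left_right_inverse[OF mat_adjoint_carrier[OF P] P] by simp
  have "(P * mat_adjoint P) $$ (k,k) = 0"
    using kr P by (subst mult_mat_index_sum[of _ r r _ r]) (auto simp: P_def)
  with one kr show False by simp
qed

lemma isometry_square:
  fixes Q :: "complex mat"
  assumes "Q \<in> carrier_mat k k" "mat_adjoint Q * Q = 1\<^sub>m k"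
  shows "Q * mat_adjoint Q = 1\<^sub>m k"
  using mat_mult_left_right_inverse[OF mat_adjoint_carrier[OF assms(1)] assms(1)] assms(2) by simp

text \<open>One Gram-Schmidt step. The normalising factor \<open>c\<close> is left unspecified in
  the conclusion, so users need properties of \<open>w\<close> that survive scaling.\<close>

lemma append_column:
  fixes Q :: "complex mat"
  assumes Q: "Q \<in> carrier_mat k r" and iso: "mat_adjoint Q * Q = 1\<^sub>m r"
    and w: "w \<in> carrier_vec k" "w \<noteq> 0\<^sub>v k" and orth: "mat_adjoint Q *\<^sub>v w = 0\<^sub>v r"
  obtains P c where "P \<in> carrier_mat k (Suc r)" "mat_adjoint P * P = 1\<^sub>m (Suc r)"
    "\<And>j. j < r \<Longrightarrow> col P j = col Q j" "col P r = c \<cdot>\<^sub>v w"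
proof -
  define s where "s = (\<Sum>t<k. (cmod (w $ t))\<^sup>2)"
  have "s \<noteq> 0"
  proof
    assume "s = 0"
    then have "\<forall>t<k. w $ t = 0"
      unfolding s_def by (subst (asm) sum_nonneg_eq_0_iff) auto
    then have "w = 0\<^sub>v k" using w by auto
    with w show False by simp
  qed
  moreover have "s \<ge> 0" unfolding s_def by (simp add: sum_nonneg)
  ultimately have s: "s > 0" by simp
  define c where "c = complex_of_real (1 / sqrt s)"
  define P where "P = mat k (Suc r) (\<lambda>(i,j). if j < r then Q $$ (i,j) else c * w $ i)"
  have P: "P \<in> carrier_mat k (Suc r)" by (simp add: P_def)
  have ww: "(\<Sum>t<k. cnj (w $ t) * w $ t) = of_real s"
    unfolding s_def of_real_sum by (intro sum.cong refl) (simp add: complex_norm_square mult.commute del: of_real_power)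
  have cc: "cnj c * c = of_real (1 / s)"
    using s by (simp add: c_def flip: of_real_mult)
  have qw: "(\<Sum>t<k. cnj (Q $$ (t,i)) * w $ t) = 0" if "i < r" for i
  proof -
    have "(mat_adjoint Q *\<^sub>v w) $ i = (\<Sum>t<k. mat_adjoint Q $$ (i,t) * w $ t)"
      using Q w that by (intro mult_mat_vec_index_sum[of _ r]) auto
    moreover have "(\<Sum>t<k. mat_adjoint Q $$ (i,t) * w $ t) = (\<Sum>t<k. cnj (Q $$ (t,i)) * w $ t)"
      using Q that by (intro sum.cong) auto
    ultimately show ?thesis using orth that by simp
  qed
  have wq: "(\<Sum>t<k. cnj (w $ t) * Q $$ (t,i)) = 0" if "i < r" for i
  proof -
    have "(\<Sum>t<k. cnj (w $ t) * Q $$ (t,i)) = cnj (\<Sum>t<k. cnj (Q $$ (t,i)) * w $ t)"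
      by (simp add: mult.commute)
    then show ?thesis using qw[OF that] by simp
  qed
  have "mat_adjoint P * P = 1\<^sub>m (Suc r)"
  proof (rule eq_matI)
    fix i j assume "i < dim_row (1\<^sub>m (Suc r) :: complex mat)" "j < dim_col (1\<^sub>m (Suc r) :: complex mat)"
    then have ij: "i < Suc r" "j < Suc r" by auto
    have eq: "(mat_adjoint P * P) $$ (i,j) = (\<Sum>t<k. cnj (P $$ (t,i)) * P $$ (t,j))"
      by (rule gram_index[OF P P ij])
    consider "i < r" "j < r" | "i < r" "j = r" | "i = r" "j < r" | "i = r" "j = r"
      using ij by linarith
    then show "(mat_adjoint P * P) $$ (i,j) = 1\<^sub>m (Suc r) $$ (i,j)"
    proof cases
      case 1
      have "(\<Sum>t<k. cnj (P $$ (t,i)) * P $$ (t,j)) = (\<Sum>t<k. cnj (Q $$ (t,i)) * Q $$ (t,j))"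
        using 1 by (intro sum.cong) (auto simp: P_def)
      then show ?thesis using 1 eq iso gram_index[OF Q Q] by simp
    next
      case 2
      have "(\<Sum>t<k. cnj (P $$ (t,i)) * P $$ (t,j)) = c * (\<Sum>t<k. cnj (Q $$ (t,i)) * w $ t)"
        unfolding sum_distrib_left using 2 by (intro sum.cong) (auto simp: P_def)
      then show ?thesis using 2 eq qw by simp
    next
      case 3
      have "(\<Sum>t<k. cnj (P $$ (t,i)) * P $$ (t,j)) = cnj c * (\<Sum>t<k. cnj (w $ t) * Q $$ (t,j))"
        unfolding sum_distrib_left using 3 by (intro sum.cong) (auto simp: P_def)
      then show ?thesis using 3 eq wq by simp
    next
      case 4
      have "(\<Sum>t<k. cnj (P $$ (t,i)) * P $$ (t,j)) = cnj c * c * (\<Sum>t<k. cnj (w $ t) * w $ t)"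
        unfolding sum_distrib_left using 4 by (intro sum.cong) (auto simp: P_def)
      then show ?thesis using 4 eq ww cc s by simp
    qed
  qed (use P in auto)
  moreover have "col P j = col Q j" if "j < r" for j
    using that Q by (intro eq_vecI) (auto simp: P_def)
  moreover have "col P r = c \<cdot>\<^sub>v w" using w by (intro eq_vecI) (auto simp: P_def)
  ultimately show ?thesis using that P by blast
qed

text \<open>Orthonormal families are encoded as isometries whose columns satisfy
  \<open>\<Phi>\<close>. Their length is at most \<open>k\<close>, so a longest one exists and
  cannot be extended. This stands in for bases of subspaces: a vector orthogonal to a longest family
  that satisfies \<open>\<Phi>\<close> together with all its multiples must vanish.\<close>

lemma maximal_isometry:
  fixes \<Phi> :: "complex vec \<Rightarrow> bool"
  obtains Q r where "Q \<in> carrier_mat k r" "mat_adjoint Q * Q = 1\<^sub>m r" "r \<le> k" "\<And>j. j < r \<Longrightarrow> \<Phi> (col Q j)"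
    "\<And>w. w \<in> carrier_vec k \<Longrightarrow> w \<noteq> 0\<^sub>v k \<Longrightarrow> mat_adjoint Q *\<^sub>v w = 0\<^sub>v r \<Longrightarrow> (\<And>c. \<Phi> (c \<cdot>\<^sub>v w)) \<Longrightarrow> False"
proof -
  define good where "good r \<longleftrightarrow> (\<exists>Q \<in> carrier_mat k r. mat_adjoint Q * Q = 1\<^sub>m r \<and> (\<forall>j<r. \<Phi> (col Q j)))" for r
  have "good 0" unfolding good_def by (intro bexI[of _ "0\<^sub>m k 0"]) auto
  moreover have le: "good r \<Longrightarrow> r \<le> k" for r unfolding good_def using isometry_dim_le by blast
  ultimately obtain r where r: "good r" "\<And>r'. good r' \<Longrightarrow> r' \<le> r"
    using Nat.ex_has_greatest_nat[of good 0 k] by auto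
  then obtain Q where Q: "Q \<in> carrier_mat k r" "mat_adjoint Q * Q = 1\<^sub>m r" "\<And>j. j < r \<Longrightarrow> \<Phi> (col Q j)"
    unfolding good_def by auto
  show ?thesis
  proof (rule that[OF Q(1,2) le[OF r(1)] Q(3)])
    fix w assume w: "w \<in> carrier_vec k" "w \<noteq> 0\<^sub>v k" "mat_adjoint Q *\<^sub>v w = 0\<^sub>v r" "\<And>c. \<Phi> (c \<cdot>\<^sub>v w)"
    obtain P c where P: "P \<in> carrier_mat k (Suc r)" "mat_adjoint P * P = 1\<^sub>m (Suc r)"
      "\<And>j. j < r \<Longrightarrow> col P j = col Q j" "col P r = c \<cdot>\<^sub>v w"
      using append_column[OF Q(1,2) w(1-3)] by blast
    then have "good (Suc r)" unfolding good_def using Q(3) w(4)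
      by (intro bexI[of _ P]) (auto simp: less_Suc_eq)
    then show False using r(2) by fastforce
  qed
qed

section \<open>Kernels and joint eigenvectors of commuting families\<close>

lemma mat_eq_of_mult_vec:
  fixes A B :: "complex mat"
  assumes "A \<in> carrier_mat n m" "B \<in> carrier_mat n m"
    "\<And>v. v \<in> carrier_vec m \<Longrightarrow> A *\<^sub>v v = B *\<^sub>v v"
  shows "A = B"
proof (rule eq_matI)
  fix i j assume "i < dim_row B" "j < dim_col B"
  then have ij: "i < n" "j < m" using assms by auto
  have "(A *\<^sub>v unit_vec m j) $ i = (B *\<^sub>v unit_vec m j) $ i" using assms(3) by simp
  then show "A $$ (i,j) = B $$ (i,j)" using assms(1,2) ij by simp
qed (use assms in auto)

lemma minus_vec_eq_zeroD:
  fixes a b :: "complex vec"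
  assumes "a \<in> carrier_vec k" "b \<in> carrier_vec k" "a - b = 0\<^sub>v k"
  shows "a = b"
proof (rule eq_vecI)
  fix i assume "i < dim_vec b"
  then have "(a - b) $ i = 0" "i < dim_vec b" using assms by auto
  then show "a $ i = b $ i" by simp
qed (use assms in auto)

text \<open>For a longest orthonormal family \<open>Q\<close> in the kernel,
  \<open>Q * mat_adjoint Q\<close> is the orthogonal projection onto the kernel: the part of a
  kernel vector orthogonal to \<open>Q\<close> lies in the kernel again and is therefore zero.
  Eigenspaces and orthogonal complements are both obtained this way.\<close>

lemma kernel_isometry:
  fixes A :: "complex mat"
  assumes A: "A \<in> carrier_mat l k"
  obtains Q r where "Q \<in> carrier_mat k r" "mat_adjoint Q * Q = 1\<^sub>m r" "r \<le> k" "A * Q = 0\<^sub>m l r"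
    "\<And>w. w \<in> carrier_vec k \<Longrightarrow> A *\<^sub>v w = 0\<^sub>v l \<Longrightarrow> (Q * mat_adjoint Q) *\<^sub>v w = w"
proof -
  obtain Q r where Q: "Q \<in> carrier_mat k r" and iso: "mat_adjoint Q * Q = 1\<^sub>m r" and rk: "r \<le> k"
    and cols: "\<And>j. j < r \<Longrightarrow> A *\<^sub>v col Q j = 0\<^sub>v l"
    and max: "\<And>w. w \<in> carrier_vec k \<Longrightarrow> w \<noteq> 0\<^sub>v k \<Longrightarrow> mat_adjoint Q *\<^sub>v w = 0\<^sub>v r
        \<Longrightarrow> (\<And>c. A *\<^sub>v (c \<cdot>\<^sub>v w) = 0\<^sub>v l) \<Longrightarrow> False"
    using maximal_isometry[of k "\<lambda>w. A *\<^sub>v w = 0\<^sub>v l"] by blast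
  have AQ: "A * Q = 0\<^sub>m l r"
  proof (rule eq_matI)
    fix i j assume ij: "i < dim_row (0\<^sub>m l r :: complex mat)" "j < dim_col (0\<^sub>m l r :: complex mat)"
    have "(A * Q) $$ (i,j) = (A *\<^sub>v col Q j) $ i" using A Q ij by simp
    then show "(A * Q) $$ (i,j) = 0\<^sub>m l r $$ (i,j)" using cols ij by simp
  qed (use A Q in auto)
  have "(Q * mat_adjoint Q) *\<^sub>v w = w" if w: "w \<in> carrier_vec k" "A *\<^sub>v w = 0\<^sub>v l" for w
  proof -
    let ?q = "(Q * mat_adjoint Q) *\<^sub>v w"
    have q: "?q \<in> carrier_vec k" using mult_carrier_mat[OF Q mat_adjoint_carrier[OF Q]] w by auto
    have q': "?q = Q *\<^sub>v (mat_adjoint Q *\<^sub>v w)" using Q w by (intro assoc_mult_mat_vec) auto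
    have u: "mat_adjoint Q *\<^sub>v w \<in> carrier_vec r"
      using mult_mat_vec_carrier[OF mat_adjoint_carrier[OF Q] w(1)] .
    have Aq: "A *\<^sub>v ?q = 0\<^sub>v l"
      unfolding q' assoc_mult_mat_vec[OF A Q u, symmetric] AQ using u by (intro eq_vecI) auto
    have Qq: "mat_adjoint Q *\<^sub>v ?q = mat_adjoint Q *\<^sub>v w"
      unfolding q' assoc_mult_mat_vec[OF mat_adjoint_carrier[OF Q] Q u, symmetric] iso using u by simp
    define z where "z = w - ?q"
    have z: "z \<in> carrier_vec k" using q w by (simp add: z_def)
    have "A *\<^sub>v z = 0\<^sub>v l" unfolding z_def mult_minus_distrib_mat_vec[OF A w(1) q] Aq w(2)
      by simp
    moreover have "c \<cdot>\<^sub>v 0\<^sub>v l = (0\<^sub>v l :: complex vec)" for c by (intro eq_vecI) auto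
    ultimately have "A *\<^sub>v (c \<cdot>\<^sub>v z) = 0\<^sub>v l" for c using mult_mat_vec[OF A z, of c] by simp
    moreover have "mat_adjoint Q *\<^sub>v z = 0\<^sub>v r"
      unfolding z_def mult_minus_distrib_mat_vec[OF mat_adjoint_carrier[OF Q] w(1) q] Qq using u by simp
    ultimately have z0: "z = 0\<^sub>v k" using max[OF z] by blast
    show ?thesis using minus_vec_eq_zeroD[OF w(1) q] z0 unfolding z_def by simp
  qed
  then show ?thesis using that[OF Q iso rk AQ] by blast
qed

text \<open>A family of matrices that preserves the range of an isometry P descends to the
  compressions to that range, and a joint eigenvector of these lifts back.\<close>

lemma joint_eigenvector_lift:
  fixes F :: "complex mat set"
  assumes F: "F \<subseteq> carrier_mat k k" and comm: "\<And>M N. M \<in> F \<Longrightarrow> N \<in> F \<Longrightarrow> M * N = N * M"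
    and adj: "\<And>M. M \<in> F \<Longrightarrow> mat_adjoint M \<in> F"
    and P: "P \<in> carrier_mat k r" "mat_adjoint P * P = 1\<^sub>m r"
    and inv: "\<And>M. M \<in> F \<Longrightarrow> P * (mat_adjoint P * (M * P)) = M * P"
    and IH: "\<And>G :: complex mat set. G \<subseteq> carrier_mat r r \<Longrightarrow> (\<And>M N. M \<in> G \<Longrightarrow> N \<in> G \<Longrightarrow> M * N = N * M) \<Longrightarrow>
       (\<And>M. M \<in> G \<Longrightarrow> mat_adjoint M \<in> G) \<Longrightarrow>
       \<exists>v \<in> carrier_vec r. v \<noteq> 0\<^sub>v r \<and> (\<forall>M\<in>G. \<exists>c. M *\<^sub>v v = c \<cdot>\<^sub>v v)"
  shows "\<exists>u \<in> carrier_vec r. P *\<^sub>v u \<noteq> 0\<^sub>v k \<and> (\<forall>M\<in>F. \<exists>c. M *\<^sub>v (P *\<^sub>v u) = c \<cdot>\<^sub>v (P *\<^sub>v u))"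
proof -
  define C where "C M = mat_adjoint P * (M * P)" for M
  have P': "mat_adjoint P \<in> carrier_mat r k" using P by auto
  have C: "C M \<in> carrier_mat r r" if "M \<in> F" for M using that P F unfolding C_def by auto
  have CC: "C M * C N = mat_adjoint P * ((M * N) * P)" if MN: "M \<in> F" "N \<in> F" for M N
  proof -
    have M: "M \<in> carrier_mat k k" and N: "N \<in> carrier_mat k k" using MN F by auto
    have "C M * C N = mat_adjoint P * ((M * P) * C N)"
      unfolding C_def[of M] using M P C[OF MN(2)] by (intro assoc_mult_mat[of _ r k _ r _ r]) auto
    also have "(M * P) * C N = M * (P * C N)"
      using M P C[OF MN(2)] by (intro assoc_mult_mat[of _ k k _ r _ r]) auto
    also have "P * C N = N * P" unfolding C_def using inv[OF MN(2)] .
    also have "M * (N * P) = (M * N) * P" using M N P by (intro assoc_mult_mat[symmetric, of _ k k _ k _ r]) auto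
    finally show ?thesis .
  qed
  have "\<exists>v \<in> carrier_vec r. v \<noteq> 0\<^sub>v r \<and> (\<forall>M\<in>C ` F. \<exists>c. M *\<^sub>v v = c \<cdot>\<^sub>v v)"
  proof (rule IH)
    show "C ` F \<subseteq> carrier_mat r r" using C by auto
    show "M * N = N * M" if "M \<in> C ` F" "N \<in> C ` F" for M N
      using that CC comm by auto
    show "mat_adjoint M \<in> C ` F" if MF: "M \<in> C ` F" for M
    proof -
      obtain N where N: "N \<in> F" "M = C N" using MF by auto
      have Nc: "N \<in> carrier_mat k k" using N F by auto
      have "mat_adjoint M = mat_adjoint (N * P) * P"
        unfolding N C_def using mat_adjoint_mult[OF P', of "N * P" r] Nc P by auto
      also have "mat_adjoint (N * P) = mat_adjoint P * mat_adjoint N" by (rule mat_adjoint_mult[OF Nc P(1)])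
      also have "\<dots> * P = C (mat_adjoint N)"
        unfolding C_def using P Nc by (intro assoc_mult_mat[of _ r k _ k _ r]) auto
      finally show ?thesis using adj[OF N(1)] by auto
    qed
  qed
  then obtain u where u: "u \<in> carrier_vec r" "u \<noteq> 0\<^sub>v r" "\<And>M. M \<in> F \<Longrightarrow> \<exists>c. C M *\<^sub>v u = c \<cdot>\<^sub>v u" by auto
  have "P *\<^sub>v u \<noteq> 0\<^sub>v k"
  proof
    assume 0: "P *\<^sub>v u = 0\<^sub>v k"
    have "u = mat_adjoint P *\<^sub>v (P *\<^sub>v u)"
      unfolding assoc_mult_mat_vec[OF P' P(1) u(1), symmetric] P(2) using u by simp
    also have "\<dots> = 0\<^sub>v r" unfolding 0 using P by (intro eq_vecI) auto
    finally show False using u by simp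
  qed
  moreover have "\<exists>c. M *\<^sub>v (P *\<^sub>v u) = c \<cdot>\<^sub>v (P *\<^sub>v u)" if M: "M \<in> F" for M
  proof -
    obtain c where c: "C M *\<^sub>v u = c \<cdot>\<^sub>v u" using u(3)[OF M] by auto
    have Mc: "M \<in> carrier_mat k k" using M F by auto
    have "M *\<^sub>v (P *\<^sub>v u) = (M * P) *\<^sub>v u" by (rule assoc_mult_mat_vec[OF Mc P(1) u(1), symmetric])
    also have "\<dots> = (P * C M) *\<^sub>v u" unfolding C_def inv[OF M] ..
    also have "\<dots> = P *\<^sub>v (C M *\<^sub>v u)" by (rule assoc_mult_mat_vec[OF P(1) C[OF M] u(1)])
    also have "\<dots> = c \<cdot>\<^sub>v (P *\<^sub>v u)" unfolding c by (rule mult_mat_vec[OF P(1) u(1)])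
    finally show ?thesis by blast
  qed
  ultimately show ?thesis using u(1) by blast
qed

text \<open>If every member is a scalar, any basis vector serves. Otherwise some member
  \<open>M\<close> has an eigenspace that is neither zero nor everything; commutation makes it
  invariant under the family, and the compressions to it fall under the induction
  hypothesis.\<close>

lemma joint_eigenvector:
  fixes F :: "complex mat set"
  assumes "F \<subseteq> carrier_mat k k" and "\<And>M N. M \<in> F \<Longrightarrow> N \<in> F \<Longrightarrow> M * N = N * M"
    and "\<And>M. M \<in> F \<Longrightarrow> mat_adjoint M \<in> F" and "0 < k"
  shows "\<exists>v \<in> carrier_vec k. v \<noteq> 0\<^sub>v k \<and> (\<forall>M\<in>F. \<exists>c. M *\<^sub>v v = c \<cdot>\<^sub>v v)"
  using assms
proof (induction k arbitrary: F rule: less_induct)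
  case (less k)
  note F = less.prems(1) and comm = less.prems(2) and adj = less.prems(3) and k = less.prems(4)
  show ?case
  proof (cases "\<forall>M\<in>F. \<exists>c. M = c \<cdot>\<^sub>m 1\<^sub>m k")
    case True
    have "\<exists>c. M *\<^sub>v unit_vec k 0 = c \<cdot>\<^sub>v unit_vec k 0" if M: "M \<in> F" for M
    proof -
      obtain c where c: "M = c \<cdot>\<^sub>m 1\<^sub>m k" using True M by auto
      have "M *\<^sub>v unit_vec k 0 = c \<cdot>\<^sub>v unit_vec k 0"
        unfolding c by (intro eq_vecI) auto
      then show ?thesis by blast
    qed
    moreover have "unit_vec k 0 \<noteq> (0\<^sub>v k :: complex vec)"
    proof
      assume "unit_vec k 0 = (0\<^sub>v k :: complex vec)"
      then have "(unit_vec k 0 :: complex vec) $ 0 = 0\<^sub>v k $ 0" by simp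
      with k show False by simp
    qed
    ultimately show ?thesis by (intro bexI[of _ "unit_vec k 0"]) auto
  next
    case False
    then obtain M where M: "M \<in> F" "\<And>c. M \<noteq> c \<cdot>\<^sub>m 1\<^sub>m k" by auto
    have Mc: "M \<in> carrier_mat k k" using M F by auto
    obtain lam where "eigenvalue M lam"
      using spectrum_non_empty[OF Mc] k unfolding spectrum_def by auto
    then obtain e where e: "e \<in> carrier_vec k" "e \<noteq> 0\<^sub>v k" "M *\<^sub>v e = lam \<cdot>\<^sub>v e"
      unfolding eigenvalue_def eigenvector_def using Mc by auto
    define A where "A = M - lam \<cdot>\<^sub>m 1\<^sub>m k"
    have one: "lam \<cdot>\<^sub>m 1\<^sub>m k \<in> carrier_mat k k" by simp
    have A: "A \<in> carrier_mat k k" unfolding A_def by (rule minus_carrier_mat[OF one])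
    have Av: "A *\<^sub>v v = M *\<^sub>v v - lam \<cdot>\<^sub>v v" if v: "v \<in> carrier_vec k" for v
    proof -
      have "(lam \<cdot>\<^sub>m 1\<^sub>m k) *\<^sub>v v = lam \<cdot>\<^sub>v v"
      proof (rule eq_vecI)
        fix i assume "i < dim_vec (lam \<cdot>\<^sub>v v)"
        then have i: "i < k" using v by simp
        have "((lam \<cdot>\<^sub>m 1\<^sub>m k) *\<^sub>v v) $ i = (\<Sum>t<k. if t = i then lam * v $ t else 0)"
          unfolding mult_mat_vec_index_sum[OF one v i] using i by (intro sum.cong) auto
        then show "((lam \<cdot>\<^sub>m 1\<^sub>m k) *\<^sub>v v) $ i = (lam \<cdot>\<^sub>v v) $ i" using i v by simp
      qed (use v in auto)
      then show ?thesis unfolding A_def minus_mult_distrib_mat_vec[OF Mc one v] by simp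
    qed
    obtain Q r where Q: "Q \<in> carrier_mat k r" "mat_adjoint Q * Q = 1\<^sub>m r" "r \<le> k" "A * Q = 0\<^sub>m k r"
      "\<And>w. w \<in> carrier_vec k \<Longrightarrow> A *\<^sub>v w = 0\<^sub>v k \<Longrightarrow> (Q * mat_adjoint Q) *\<^sub>v w = w"
      using kernel_isometry[OF A] by blast
    have "r \<noteq> 0"
    proof
      assume r: "r = 0"
      have "(Q * mat_adjoint Q) *\<^sub>v e = e" using Q(5)[OF e(1)] Av[OF e(1)] e by simp
      moreover have "(Q * mat_adjoint Q) *\<^sub>v e = 0\<^sub>v k"
        using Q(1) e(1) r by (intro eq_vecI) (auto simp: scalar_prod_def)
      ultimately show False using e by simp
    qed
    moreover have "r \<noteq> k"
    proof
      assume r: "r = k"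
      have QQ: "Q * mat_adjoint Q = 1\<^sub>m k" using isometry_square Q r by auto
      have "A = A * (Q * mat_adjoint Q)" unfolding QQ using A by simp
      also have "\<dots> = (A * Q) * mat_adjoint Q" using A Q r by (intro assoc_mult_mat[symmetric]) auto
      also have "\<dots> = 0\<^sub>m k k" unfolding Q(4) using Q(1) by auto
      finally have A0: "A = 0\<^sub>m k k" .
      have "M = lam \<cdot>\<^sub>m 1\<^sub>m k"
      proof (rule eq_matI)
        fix i j assume ij: "i < dim_row (lam \<cdot>\<^sub>m 1\<^sub>m k)" "j < dim_col (lam \<cdot>\<^sub>m 1\<^sub>m k)"
        have "A $$ (i,j) = 0" using A0 ij by simp
        then show "M $$ (i,j) = (lam \<cdot>\<^sub>m 1\<^sub>m k) $$ (i,j)" using ij Mc by (simp add: A_def)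
      qed (use Mc in auto)
      with M(2) show False by blast
    qed
    ultimately have r: "0 < r" "r < k" using Q(3) by auto
    have inv: "Q * (mat_adjoint Q * (N * Q)) = N * Q" if N: "N \<in> F" for N
    proof (rule mat_eq_of_mult_vec)
      have Nc: "N \<in> carrier_mat k k" using N F by auto
      show "Q * (mat_adjoint Q * (N * Q)) \<in> carrier_mat k r" "N * Q \<in> carrier_mat k r" using Q(1) Nc by auto
      fix v :: "complex vec" assume v: "v \<in> carrier_vec r"
      define x where "x = Q *\<^sub>v v"
      have x: "x \<in> carrier_vec k" using Q(1) v by (simp add: x_def)
      have "A *\<^sub>v x = (A * Q) *\<^sub>v v" unfolding x_def by (rule assoc_mult_mat_vec[OF A Q(1) v, symmetric])
      then have Ax: "A *\<^sub>v x = 0\<^sub>v k" unfolding Q(4) using v by auto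
      have Mx: "M *\<^sub>v x = lam \<cdot>\<^sub>v x"
        by (rule minus_vec_eq_zeroD[OF mult_mat_vec_carrier[OF Mc x] smult_carrier_vec[THEN iffD2, OF x]])
          (use Av[OF x] Ax in simp)
      have Nx: "N *\<^sub>v x \<in> carrier_vec k" using Nc x by auto
      have "M *\<^sub>v (N *\<^sub>v x) = (M * N) *\<^sub>v x" by (rule assoc_mult_mat_vec[OF Mc Nc x, symmetric])
      also have "\<dots> = N *\<^sub>v (M *\<^sub>v x)" unfolding comm[OF M(1) N] by (rule assoc_mult_mat_vec[OF Nc Mc x])
      also have "\<dots> = lam \<cdot>\<^sub>v (N *\<^sub>v x)" unfolding Mx by (rule mult_mat_vec[OF Nc x])
      finally have "A *\<^sub>v (N *\<^sub>v x) = 0\<^sub>v k" using Av[OF Nx] Nx by simp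
      then have key: "(Q * mat_adjoint Q) *\<^sub>v (N *\<^sub>v x) = N *\<^sub>v x" using Q(5)[OF Nx] by simp
      have NQ: "N * Q \<in> carrier_mat k r" using Nc Q by auto
      have Q': "mat_adjoint Q \<in> carrier_mat r k" using Q by auto
      have nx: "N *\<^sub>v x = (N * Q) *\<^sub>v v" unfolding x_def by (rule assoc_mult_mat_vec[OF Nc Q(1) v, symmetric])
      have "(Q * (mat_adjoint Q * (N * Q))) *\<^sub>v v = ((Q * mat_adjoint Q) * (N * Q)) *\<^sub>v v"
        using assoc_mult_mat[OF Q(1) Q' NQ] by simp
      also have "\<dots> = (Q * mat_adjoint Q) *\<^sub>v ((N * Q) *\<^sub>v v)"
        by (rule assoc_mult_mat_vec[OF mult_carrier_mat[OF Q(1) Q'] NQ v])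
      also have "\<dots> = (N * Q) *\<^sub>v v" using key unfolding nx .
      finally show "(Q * (mat_adjoint Q * (N * Q))) *\<^sub>v v = (N * Q) *\<^sub>v v" .
    qed
    have "\<exists>u \<in> carrier_vec r. Q *\<^sub>v u \<noteq> 0\<^sub>v k \<and> (\<forall>M\<in>F. \<exists>c. M *\<^sub>v (Q *\<^sub>v u) = c \<cdot>\<^sub>v (Q *\<^sub>v u))"
      using joint_eigenvector_lift[OF F comm adj Q(1,2) inv] less.IH[OF r(2) _ _ _ r(1)] by blast
    then show ?thesis using Q(1) by auto
  qed
qed

text \<open>The complement of a longest orthonormal family of joint eigenvectors is invariant, since
  the given matrices are closed under adjoints. A nonzero complement would contain another joint
  eigenvector, so the longest family is a basis.\<close>

theorem simultaneous_diagonalisation: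
  fixes F :: "complex mat set"
  assumes F: "F \<subseteq> carrier_mat k k" and comm: "\<And>M N. M \<in> F \<Longrightarrow> N \<in> F \<Longrightarrow> M * N = N * M"
    and adj: "\<And>M. M \<in> F \<Longrightarrow> mat_adjoint M \<in> F"
  obtains U where "U \<in> carrier_mat k k" "mat_adjoint U * U = 1\<^sub>m k"
    "\<And>M j. M \<in> F \<Longrightarrow> j < k \<Longrightarrow> \<exists>c. M *\<^sub>v col U j = c \<cdot>\<^sub>v col U j"
proof -
  let ?E = "\<lambda>w. \<forall>M\<in>F. \<exists>c. M *\<^sub>v w = c \<cdot>\<^sub>v w"
  obtain Q r where Q: "Q \<in> carrier_mat k r" and iso: "mat_adjoint Q * Q = 1\<^sub>m r" and rk: "r \<le> k"
    and ev: "\<And>j. j < r \<Longrightarrow> ?E (col Q j)"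
    and max: "\<And>w. w \<in> carrier_vec k \<Longrightarrow> w \<noteq> 0\<^sub>v k \<Longrightarrow> mat_adjoint Q *\<^sub>v w = 0\<^sub>v r
        \<Longrightarrow> (\<And>c. ?E (c \<cdot>\<^sub>v w)) \<Longrightarrow> False"
    using maximal_isometry[of k ?E] by blast
  have Q': "mat_adjoint Q \<in> carrier_mat r k" using Q by auto
  have "r = k"
  proof (rule ccontr)
    assume "r \<noteq> k"
    obtain P s where P: "P \<in> carrier_mat k s" "mat_adjoint P * P = 1\<^sub>m s" "mat_adjoint Q * P = 0\<^sub>m r s"
      "\<And>w. w \<in> carrier_vec k \<Longrightarrow> mat_adjoint Q *\<^sub>v w = 0\<^sub>v r \<Longrightarrow> (P * mat_adjoint P) *\<^sub>v w = w"
      by (rule kernel_isometry[OF Q']) blast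
    \<comment> \<open>With a zero complement \<open>Q\<close> has orthonormal rows too, so
      \<open>mat_adjoint Q\<close> is an isometry as well and k \<le> r.\<close>
    have "s \<noteq> 0"
    proof
      assume s: "s = 0"
      have "Q * mat_adjoint Q = 1\<^sub>m k"
      proof (rule mat_eq_of_mult_vec)
        show "Q * mat_adjoint Q \<in> carrier_mat k k" "1\<^sub>m k \<in> carrier_mat k k" using Q by auto
        fix v :: "complex vec" assume v: "v \<in> carrier_vec k"
        let ?q = "(Q * mat_adjoint Q) *\<^sub>v v"
        have q: "?q \<in> carrier_vec k" using mult_carrier_mat[OF Q Q'] v by auto
        have u: "mat_adjoint Q *\<^sub>v v \<in> carrier_vec r" using mult_mat_vec_carrier[OF Q' v] .
        have q': "?q = Q *\<^sub>v (mat_adjoint Q *\<^sub>v v)" using Q v by (intro assoc_mult_mat_vec) auto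
        have "mat_adjoint Q *\<^sub>v ?q = mat_adjoint Q *\<^sub>v v"
          unfolding q' assoc_mult_mat_vec[OF Q' Q u, symmetric] iso using u by simp
        then have "mat_adjoint Q *\<^sub>v (v - ?q) = 0\<^sub>v r"
          unfolding mult_minus_distrib_mat_vec[OF Q' v q] using u by simp
        then have "(P * mat_adjoint P) *\<^sub>v (v - ?q) = v - ?q" using P(4) v q by simp
        moreover have "P * mat_adjoint P = 0\<^sub>m k k"
          using P(1) s by (intro eq_matI) (auto simp: scalar_prod_def)
        then have "(P * mat_adjoint P) *\<^sub>v (v - ?q) = 0\<^sub>v k"
          using v q by (intro eq_vecI) auto
        ultimately have z: "v - ?q = 0\<^sub>v k" by simp
        show "?q = 1\<^sub>m k *\<^sub>v v"
          using minus_vec_eq_zeroD[OF v q z] v by simp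
      qed
      then have "k \<le> r" using isometry_dim_le[OF Q'] by simp
      with rk \<open>r \<noteq> k\<close> show False by simp
    qed
    then have s: "0 < s" by simp
    \<comment> \<open>For a column q of \<open>Q\<close> and x in the complement, the inner product
      of q with M x equals that of x with the adjoint of M applied to q. The latter vector is a
      multiple of q, so the inner product vanishes.\<close>
    have inv: "P * (mat_adjoint P * (M * P)) = M * P" if M: "M \<in> F" for M
    proof -
      have Mc: "M \<in> carrier_mat k k" and Ma: "mat_adjoint M \<in> F" using M F adj by auto
      have MP: "M * P \<in> carrier_mat k s" using Mc P by auto
      have P': "mat_adjoint P \<in> carrier_mat s k" using P by auto
      have QMP: "mat_adjoint Q *\<^sub>v ((M * P) *\<^sub>v v) = 0\<^sub>v r" if v: "v \<in> carrier_vec s" for v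
      proof (rule eq_vecI)
        fix i assume "i < dim_vec (0\<^sub>v r :: complex vec)"
        then have i: "i < r" by simp
        obtain c where c: "mat_adjoint M *\<^sub>v col Q i = c \<cdot>\<^sub>v col Q i" using ev[OF i] Ma by auto
        define x where "x = P *\<^sub>v v"
        have x: "x \<in> carrier_vec k" using P v by (simp add: x_def)
        have "mat_adjoint Q *\<^sub>v x = (mat_adjoint Q * P) *\<^sub>v v"
          unfolding x_def by (rule assoc_mult_mat_vec[OF Q' P(1) v, symmetric])
        then have "(mat_adjoint Q *\<^sub>v x) $ i = 0" unfolding P(3) using v i by auto
        moreover have "(\<Sum>t<k. mat_adjoint Q $$ (i,t) * x $ t) = (\<Sum>t<k. cnj (Q $$ (t,i)) * x $ t)"
          using Q i by (intro sum.cong) auto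
        ultimately have Qx: "(\<Sum>t<k. cnj (Q $$ (t,i)) * x $ t) = 0"
          using mult_mat_vec_index_sum[OF Q' x i] by simp
        have "(mat_adjoint Q *\<^sub>v ((M * P) *\<^sub>v v)) $ i = (mat_adjoint Q *\<^sub>v (M *\<^sub>v x)) $ i"
          unfolding x_def using assoc_mult_mat_vec[OF Mc P(1) v] by simp
        also have "\<dots> = (\<Sum>t<k. cnj (Q $$ (t,i)) * (M *\<^sub>v x) $ t)"
          using Q i x Mc by (subst mult_mat_vec_index_sum[OF Q' _ i]) (auto intro!: sum.cong)
        also have "\<dots> = (\<Sum>t<k. \<Sum>l<k. cnj (Q $$ (t,i)) * M $$ (t,l) * x $ l)"
          using x by (intro sum.cong refl) (auto simp: mult_mat_vec_index_sum[OF Mc x] sum_distrib_left mult.assoc simp del: index_mult_mat_vec)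
        also have "\<dots> = (\<Sum>l<k. (\<Sum>t<k. cnj (Q $$ (t,i)) * M $$ (t,l)) * x $ l)"
          by (subst sum.swap) (simp add: sum_distrib_right)
        also have "\<dots> = (\<Sum>l<k. cnj (c * Q $$ (l,i)) * x $ l)"
        proof (intro sum.cong refl arg_cong2[where f = times])
          fix l assume "l \<in> {..<k}"
          then have l: "l < k" by simp
          have "(\<Sum>t<k. cnj (Q $$ (t,i)) * M $$ (t,l)) = cnj ((mat_adjoint M *\<^sub>v col Q i) $ l)"
            using Q i l Mc by (subst mult_mat_vec_index_sum[of _ k k]) (auto simp: mult.commute intro!: sum.cong)
          also have "\<dots> = cnj (c * Q $$ (l,i))" unfolding c using Q i l by simp
          finally show "(\<Sum>t<k. cnj (Q $$ (t,i)) * M $$ (t,l)) = cnj (c * Q $$ (l,i))" .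
        qed
        also have "\<dots> = cnj c * (\<Sum>l<k. cnj (Q $$ (l,i)) * x $ l)"
          by (simp add: sum_distrib_left mult.assoc)
        finally show "(mat_adjoint Q *\<^sub>v ((M * P) *\<^sub>v v)) $ i = 0\<^sub>v r $ i" using Qx i by simp
      qed (use Q in auto)
      show ?thesis
      proof (rule mat_eq_of_mult_vec)
        show "P * (mat_adjoint P * (M * P)) \<in> carrier_mat k s" "M * P \<in> carrier_mat k s"
          using mult_carrier_mat[OF P(1) mult_carrier_mat[OF P' MP]] MP by simp_all
        fix v :: "complex vec" assume v: "v \<in> carrier_vec s"
        have "(P * (mat_adjoint P * (M * P))) *\<^sub>v v = ((P * mat_adjoint P) * (M * P)) *\<^sub>v v"
          using assoc_mult_mat[OF P(1) P' MP] by simp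
        also have "\<dots> = (P * mat_adjoint P) *\<^sub>v ((M * P) *\<^sub>v v)"
          by (rule assoc_mult_mat_vec[OF mult_carrier_mat[OF P(1) P'] MP v])
        also have "\<dots> = (M * P) *\<^sub>v v" using P(4)[OF _ QMP[OF v]] MP v by simp
        finally show "(P * (mat_adjoint P * (M * P))) *\<^sub>v v = (M * P) *\<^sub>v v" .
      qed
    qed
    have "\<exists>u \<in> carrier_vec s. P *\<^sub>v u \<noteq> 0\<^sub>v k \<and> (\<forall>M\<in>F. \<exists>c. M *\<^sub>v (P *\<^sub>v u) = c \<cdot>\<^sub>v (P *\<^sub>v u))"
    proof (rule joint_eigenvector_lift[OF F comm adj P(1,2) inv])
      fix G :: "complex mat set"
      assume G: "G \<subseteq> carrier_mat s s" "\<And>M N. M \<in> G \<Longrightarrow> N \<in> G \<Longrightarrow> M * N = N * M"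
        "\<And>M. M \<in> G \<Longrightarrow> mat_adjoint M \<in> G"
      show "\<exists>v \<in> carrier_vec s. v \<noteq> 0\<^sub>v s \<and> (\<forall>M\<in>G. \<exists>c. M *\<^sub>v v = c \<cdot>\<^sub>v v)"
        by (rule joint_eigenvector[OF G s])
    qed
    then obtain u where u: "u \<in> carrier_vec s" "P *\<^sub>v u \<noteq> 0\<^sub>v k"
      "\<And>M. M \<in> F \<Longrightarrow> \<exists>c. M *\<^sub>v (P *\<^sub>v u) = c \<cdot>\<^sub>v (P *\<^sub>v u)"
      by auto
    have "\<exists>d. M *\<^sub>v (c \<cdot>\<^sub>v (P *\<^sub>v u)) = d \<cdot>\<^sub>v (c \<cdot>\<^sub>v (P *\<^sub>v u))" if M: "M \<in> F" for M c
    proof -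
      have Mc: "M \<in> carrier_mat k k" using M F by auto
      obtain d where d: "M *\<^sub>v (P *\<^sub>v u) = d \<cdot>\<^sub>v (P *\<^sub>v u)" using u(3)[OF M] by blast
      have "M *\<^sub>v (c \<cdot>\<^sub>v (P *\<^sub>v u)) = c \<cdot>\<^sub>v (d \<cdot>\<^sub>v (P *\<^sub>v u))"
        using mult_mat_vec[OF Mc, of "P *\<^sub>v u" c] P(1) u(1) d by simp
      also have "\<dots> = d \<cdot>\<^sub>v (c \<cdot>\<^sub>v (P *\<^sub>v u))" by (simp add: smult_smult_assoc mult.commute)
      finally show ?thesis by blast
    qed
    moreover have "mat_adjoint Q *\<^sub>v (P *\<^sub>v u) = 0\<^sub>v r"
      unfolding assoc_mult_mat_vec[OF Q' P(1) u(1), symmetric] P(3) using u by auto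
    ultimately show False using max[of "P *\<^sub>v u"] u P(1) by auto
  qed
  then show ?thesis using that[of Q] Q iso ev by auto
qed

section \<open>Square roots of positive matrices and the fidelity with a pure state\<close>

lemma unitary_cols:
  assumes "U \<in> carrier_mat k k" "mat_adjoint U * U = (1\<^sub>m k :: complex mat)" "p < k" "q < k"
  shows "(\<Sum>t<k. cnj (U $$ (t,p)) * U $$ (t,q)) = (if p = q then 1 else 0)"
  using gram_index[OF assms(1,1,3,4)] assms by simp

lemma unitary_rows:
  assumes U: "U \<in> carrier_mat k k" "mat_adjoint U * U = (1\<^sub>m k :: complex mat)" and ab: "a < k" "b < k"
  shows "(\<Sum>p<k. U $$ (a,p) * cnj (U $$ (b,p))) = (if a = b then 1 else 0)"
proof -
  have "(U * mat_adjoint U) $$ (a,b) = (\<Sum>p<k. U $$ (a,p) * cnj (U $$ (b,p)))"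
    unfolding mult_mat_index_sum[OF U(1) mat_adjoint_carrier[OF U(1)] ab]
    using U ab by (intro sum.cong) auto
  then show ?thesis using isometry_square[OF U] ab by simp
qed

text \<open>The product of \<open>U\<close>, the diagonal matrix of \<open>f\<close> and the adjoint
  of \<open>U\<close>, written out. Functional calculus in a fixed eigenbasis thereby becomes
  pointwise algebra in \<open>f\<close>.\<close>

definition spectral_mat :: "nat \<Rightarrow> complex mat \<Rightarrow> (nat \<Rightarrow> complex) \<Rightarrow> complex mat" where
  "spectral_mat k U f = mat k k (\<lambda>(a,b). \<Sum>p<k. U $$ (a,p) * f p * cnj (U $$ (b,p)))"

lemma spectral_mat_carrier [simp]: "spectral_mat k U f \<in> carrier_mat k k"
  by (simp add: spectral_mat_def)

lemma spectral_mat_index: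
  "a < k \<Longrightarrow> b < k \<Longrightarrow> spectral_mat k U f $$ (a,b) = (\<Sum>p<k. U $$ (a,p) * f p * cnj (U $$ (b,p)))"
  by (simp add: spectral_mat_def)

lemma spectral_mat_mult:
  assumes U: "U \<in> carrier_mat k k" "mat_adjoint U * U = (1\<^sub>m k :: complex mat)"
  shows "spectral_mat k U f * spectral_mat k U g = spectral_mat k U (\<lambda>p. f p * g p)"
proof (rule eq_matI)
  fix a b assume "a < dim_row (spectral_mat k U (\<lambda>p. f p * g p))" "b < dim_col (spectral_mat k U (\<lambda>p. f p * g p))"
  then have ab: "a < k" "b < k" by (auto simp: spectral_mat_def)
  have "(spectral_mat k U f * spectral_mat k U g) $$ (a,b)
      = (\<Sum>t<k. (\<Sum>p<k. U $$ (a,p) * f p * cnj (U $$ (t,p))) * (\<Sum>q<k. U $$ (t,q) * g q * cnj (U $$ (b,q))))"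
    using ab by (subst mult_mat_index_sum[of _ k k _ k]) (auto simp: spectral_mat_index intro!: sum.cong)
  also have "\<dots> = (\<Sum>t<k. \<Sum>p<k. \<Sum>q<k. U $$ (a,p) * f p * g q * cnj (U $$ (b,q)) * (cnj (U $$ (t,p)) * U $$ (t,q)))"
    unfolding sum_product by (intro sum.cong refl) (simp add: mult_ac)
  also have "\<dots> = (\<Sum>p<k. \<Sum>q<k. \<Sum>t<k. U $$ (a,p) * f p * g q * cnj (U $$ (b,q)) * (cnj (U $$ (t,p)) * U $$ (t,q)))"
    by (subst sum.swap, rule sum.cong[OF refl], rule sum.swap)
  also have "\<dots> = (\<Sum>p<k. \<Sum>q<k. if p = q then U $$ (a,p) * f p * g p * cnj (U $$ (b,p)) else 0)"
    unfolding sum_distrib_left[symmetric] using unitary_cols[OF U] by (intro sum.cong refl) auto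
  also have "\<dots> = (\<Sum>p<k. U $$ (a,p) * (f p * g p) * cnj (U $$ (b,p)))"
    by (intro sum.cong refl) (simp add: sum.delta mult.assoc)
  finally show "(spectral_mat k U f * spectral_mat k U g) $$ (a,b) = spectral_mat k U (\<lambda>p. f p * g p) $$ (a,b)"
    using ab by (simp add: spectral_mat_index del: index_mult_mat)
qed (auto simp: spectral_mat_def)

lemma spectral_mat_eqI:
  assumes U: "U \<in> carrier_mat k k" "mat_adjoint U * U = (1\<^sub>m k :: complex mat)" and M: "M \<in> carrier_mat k k"
    and ev: "\<And>p. p < k \<Longrightarrow> M *\<^sub>v col U p = f p \<cdot>\<^sub>v col U p"
  shows "M = spectral_mat k U f"
proof (rule eq_matI)
  fix a b assume "a < dim_row (spectral_mat k U f)" "b < dim_col (spectral_mat k U f)"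
  then have ab: "a < k" "b < k" by (auto simp: spectral_mat_def)
  have ev': "(\<Sum>t<k. M $$ (a,t) * U $$ (t,p)) = f p * U $$ (a,p)" if p: "p < k" for p
  proof -
    have "(M *\<^sub>v col U p) $ a = (\<Sum>t<k. M $$ (a,t) * U $$ (t,p))"
      using U M p ab by (subst mult_mat_vec_index_sum[of _ k k]) (auto intro!: sum.cong)
    then show ?thesis unfolding ev[OF p] using U p ab by simp
  qed
  have "M $$ (a,b) = (\<Sum>t<k. if t = b then M $$ (a,t) else 0)" using ab by simp
  also have "\<dots> = (\<Sum>t<k. M $$ (a,t) * (\<Sum>p<k. U $$ (t,p) * cnj (U $$ (b,p))))"
    using unitary_rows[OF U] ab by (intro sum.cong) auto
  also have "\<dots> = (\<Sum>p<k. (\<Sum>t<k. M $$ (a,t) * U $$ (t,p)) * cnj (U $$ (b,p)))"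
    unfolding sum_distrib_left sum_distrib_right by (subst sum.swap) (simp add: mult.assoc)
  also have "\<dots> = spectral_mat k U f $$ (a,b)"
    using ev' ab by (simp add: spectral_mat_index mult_ac)
  finally show "M $$ (a,b) = spectral_mat k U f $$ (a,b)" .
qed (use M in \<open>auto simp: spectral_mat_def\<close>)

text \<open>The form in the coordinates of the eigenbasis. Positivity, Parseval's identity and the
  norm bound for the generators are all read off from it.\<close>

lemma spectral_mat_form:
  "(\<Sum>a<k. \<Sum>b<k. cnj (u a) * spectral_mat k U f $$ (a,b) * v b)
   = (\<Sum>p<k. f p * (cnj (\<Sum>a<k. cnj (U $$ (a,p)) * u a) * (\<Sum>b<k. cnj (U $$ (b,p)) * v b)))"
proof -
  have "(\<Sum>a<k. \<Sum>b<k. cnj (u a) * spectral_mat k U f $$ (a,b) * v b)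
      = (\<Sum>a<k. \<Sum>b<k. \<Sum>p<k. f p * ((U $$ (a,p) * cnj (u a)) * (cnj (U $$ (b,p)) * v b)))"
    by (intro sum.cong refl) (simp add: spectral_mat_index sum_distrib_left sum_distrib_right mult_ac)
  also have "\<dots> = (\<Sum>a<k. \<Sum>p<k. \<Sum>b<k. f p * ((U $$ (a,p) * cnj (u a)) * (cnj (U $$ (b,p)) * v b)))"
    by (rule sum.cong[OF refl], rule sum.swap)
  also have "\<dots> = (\<Sum>p<k. \<Sum>a<k. \<Sum>b<k. f p * ((U $$ (a,p) * cnj (u a)) * (cnj (U $$ (b,p)) * v b)))"
    by (rule sum.swap)
  also have "\<dots> = (\<Sum>p<k. f p * ((\<Sum>a<k. U $$ (a,p) * cnj (u a)) * (\<Sum>b<k. cnj (U $$ (b,p)) * v b)))"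
    by (simp only: sum_product) (simp only: sum_distrib_left)
  finally show ?thesis by simp
qed

text \<open>Test vectors are plain functions here, which lets positivity be checked on index sums
  without building vectors.\<close>

lemma psd_iff_form:
  assumes A: "A \<in> carrier_mat k k"
  shows "psd A \<longleftrightarrow> mat_adjoint A = A \<and>
    (\<forall>v :: nat \<Rightarrow> complex. 0 \<le> Re (\<Sum>a<k. \<Sum>b<k. cnj (v a) * A $$ (a,b) * v b))"
proof -
  have eq: "(A *\<^sub>v v) \<bullet>c v = (\<Sum>a<k. \<Sum>b<k. cnj (v $ a) * A $$ (a,b) * v $ b)" if v: "v \<in> carrier_vec k" for v
    unfolding cscalar_prod_sum[OF v]
    by (intro sum.cong refl)
      (simp add: mult_mat_vec_index_sum[OF A v] sum_distrib_left sum_distrib_right mult_ac del: index_mult_mat_vec)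
  have dims: "dim_row A = k" "dim_col A = k" using A by auto
  show ?thesis
  proof
    assume psd: "psd A"
    have "0 \<le> Re (\<Sum>a<k. \<Sum>b<k. cnj (v a) * A $$ (a,b) * v b)" for v :: "nat \<Rightarrow> complex"
    proof -
      have "0 \<le> Re ((A *\<^sub>v vec k v) \<bullet>c vec k v)" using psd dims unfolding psd_def by auto
      then show ?thesis using eq[of "vec k v"] by simp
    qed
    then show "mat_adjoint A = A \<and> (\<forall>v. 0 \<le> Re (\<Sum>a<k. \<Sum>b<k. cnj (v a) * A $$ (a,b) * v b))"
      using psd unfolding psd_def by blast
  next
    assume "mat_adjoint A = A \<and> (\<forall>v. 0 \<le> Re (\<Sum>a<k. \<Sum>b<k. cnj (v a) * A $$ (a,b) * v b))"
    then show "psd A" unfolding psd_def dims using eq by auto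
  qed
qed

lemma hermitian_index:
  assumes "A \<in> carrier_mat k k" "mat_adjoint A = (A :: complex mat)" "a < k" "b < k"
  shows "cnj (A $$ (a,b)) = A $$ (b,a)"
  using assms mat_adjoint_index[of b A a] by auto

text \<open>Each eigenvalue is the value of the form at its unit eigenvector, so hermiticity makes
  it real and positivity makes it nonnegative.\<close>

lemma psd_spectral:
  assumes A: "A \<in> carrier_mat k k" and psd: "psd A"
  obtains U lam where "U \<in> carrier_mat k k" "mat_adjoint U * U = 1\<^sub>m k"
    "\<And>p. p < k \<Longrightarrow> A *\<^sub>v col U p = of_real (lam p) \<cdot>\<^sub>v col U p" "\<And>p. p < k \<Longrightarrow> 0 \<le> (lam p :: real)"
proof -
  have herm: "mat_adjoint A = A" and pos: "\<And>v. 0 \<le> Re (\<Sum>a<k. \<Sum>b<k. cnj (v a) * A $$ (a,b) * v b)"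
    using psd psd_iff_form[OF A] by auto
  have "\<exists>U. U \<in> carrier_mat k k \<and> mat_adjoint U * U = 1\<^sub>m k \<and> (\<forall>j<k. \<exists>c. A *\<^sub>v col U j = c \<cdot>\<^sub>v col U j)"
    by (rule simultaneous_diagonalisation[of "{A}" k]) (use A herm in auto)
  then obtain U where U: "U \<in> carrier_mat k k" "mat_adjoint U * U = 1\<^sub>m k"
    and ev: "\<And>j. j < k \<Longrightarrow> \<exists>c. A *\<^sub>v col U j = c \<cdot>\<^sub>v col U j" by auto
  define c where "c p = (SOME c. A *\<^sub>v col U p = c \<cdot>\<^sub>v col U p)" for p
  have c: "A *\<^sub>v col U p = c p \<cdot>\<^sub>v col U p" if "p < k" for p
    unfolding c_def by (rule someI_ex) (use ev that in auto)
  have AU: "A = spectral_mat k U c" by (rule spectral_mat_eqI[OF U A c])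
  have form: "c p = (\<Sum>a<k. \<Sum>b<k. cnj (U $$ (a,p)) * A $$ (a,b) * U $$ (b,p))" if p: "p < k" for p
  proof -
    have "(\<Sum>a<k. \<Sum>b<k. cnj (U $$ (a,p)) * A $$ (a,b) * U $$ (b,p))
        = (\<Sum>q<k. c q * (cnj (\<Sum>a<k. cnj (U $$ (a,q)) * U $$ (a,p)) * (\<Sum>b<k. cnj (U $$ (b,q)) * U $$ (b,p))))"
      by (subst AU) (rule spectral_mat_form)
    also have "\<dots> = (\<Sum>q<k. if q = p then c p else 0)"
      using unitary_cols[OF U _ p] by (intro sum.cong refl) auto
    finally show ?thesis using p by simp
  qed
  have real: "c p = of_real (Re (c p))" if p: "p < k" for p
  proof -
    have "cnj (c p) = (\<Sum>a<k. \<Sum>b<k. U $$ (a,p) * A $$ (b,a) * cnj (U $$ (b,p)))"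
      using hermitian_index[OF A herm] by (subst form[OF p]) simp
    also have "\<dots> = c p" by (subst sum.swap) (simp add: form[OF p] mult_ac)
    finally show ?thesis by (auto simp: complex_eq_iff)
  qed
  show ?thesis
  proof (rule that[OF U, of "\<lambda>p. Re (c p)"])
    show "A *\<^sub>v col U p = of_real (Re (c p)) \<cdot>\<^sub>v col U p" if "p < k" for p
      using c[OF that] real[OF that] by simp
    show "0 \<le> Re (c p)" if "p < k" for p
      unfolding form[OF that] by (rule pos)
  qed
qed

lemma psd_spectral_mat:
  assumes "\<And>p. p < k \<Longrightarrow> 0 \<le> (f p :: real)"
  shows "psd (spectral_mat k U (\<lambda>p. of_real (f p)))"
  unfolding psd_iff_form[OF spectral_mat_carrier]
proof
  show "mat_adjoint (spectral_mat k U (\<lambda>p. of_real (f p))) = spectral_mat k U (\<lambda>p. of_real (f p))"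
    by (rule eq_matI) (auto simp: spectral_mat_def mult_ac intro!: sum.cong)
  have pos: "0 \<le> Re (of_real r * (cnj z * z))" if "0 \<le> r" for r z
    using that by (simp add: complex_mult_cnj mult.commute[of "cnj z"])
  show "\<forall>v. 0 \<le> Re (\<Sum>a<k. \<Sum>b<k. cnj (v a) * spectral_mat k U (\<lambda>p. of_real (f p)) $$ (a,b) * v b)"
    unfolding spectral_mat_form Re_sum by (intro allI sum_nonneg pos assms) simp
qed

text \<open>Since \<open>msqrt\<close> is a definite description, uniqueness must be settled before
  any value can be computed. Let v be an eigenvector of \<open>A\<close> and s the root of its
  eigenvalue. If s is positive, B v - s v is an eigenvector of \<open>B\<close> for - s unless it
  vanishes, and positivity of \<open>B\<close> forces the latter. If s is zero, the squared norm of
  B v is the value of \<open>A\<close> at v, hence zero.\<close>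

lemma psd_root_unique:
  assumes A: "A \<in> carrier_mat k k" and U: "U \<in> carrier_mat k k" "mat_adjoint U * U = 1\<^sub>m k"
    and ev: "\<And>p. p < k \<Longrightarrow> A *\<^sub>v col U p = of_real (lam p) \<cdot>\<^sub>v col U p" "\<And>p. p < k \<Longrightarrow> 0 \<le> lam p"
    and B: "B \<in> carrier_mat k k" "psd B" "B * B = A"
  shows "B = spectral_mat k U (\<lambda>p. of_real (sqrt (lam p)))"
proof (rule spectral_mat_eqI[OF U B(1)])
  fix p assume p: "p < k"
  define v where "v = col U p"
  define s where "s = complex_of_real (sqrt (lam p))"
  have v: "v \<in> carrier_vec k" using U p by (simp add: v_def)
  have Bv: "B *\<^sub>v v \<in> carrier_vec k" by (rule mult_mat_vec_carrier[OF B(1) v])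
  have sv: "s \<cdot>\<^sub>v v \<in> carrier_vec k" using v by simp
  have herm: "mat_adjoint B = B" using B(2) by (simp add: psd_def)
  have ss: "s * s = of_real (lam p)" unfolding s_def using ev(2)[OF p] by (simp flip: of_real_mult)
  have BB: "B *\<^sub>v (B *\<^sub>v v) = (s * s) \<cdot>\<^sub>v v"
    using assoc_mult_mat_vec[OF B(1) B(1) v] ev(1)[OF p] unfolding B(3) ss v_def by simp
  have sq0: "w = 0\<^sub>v k" if "w \<in> carrier_vec k" "(\<Sum>a<k. cnj (w $ a) * w $ a) = 0" for w :: "complex vec"
  proof -
    have "w \<bullet>c w = 0" using that by (simp add: cscalar_prod_sum[OF that(1)] mult.commute)
    then show ?thesis using that(1) by simp
  qed
  show "B *\<^sub>v col U p = complex_of_real (sqrt (lam p)) \<cdot>\<^sub>v col U p"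
  proof (cases "lam p = 0")
    case True
    then have s0: "s = 0" by (simp add: s_def)
    have "(\<Sum>a<k. cnj ((B *\<^sub>v v) $ a) * (B *\<^sub>v v) $ a) = (\<Sum>a<k. \<Sum>b<k. cnj (v $ b) * (B $$ (b,a) * (B *\<^sub>v v) $ a))"
    proof (rule sum.cong[OF refl])
      fix a assume "a \<in> {..<k}"
      then have a: "a < k" by simp
      have "cnj ((B *\<^sub>v v) $ a) = (\<Sum>b<k. cnj (v $ b) * B $$ (b,a))"
        unfolding mult_mat_vec_index_sum[OF B(1) v a] using hermitian_index[OF B(1) herm a] by (simp add: mult.commute)
      then show "cnj ((B *\<^sub>v v) $ a) * (B *\<^sub>v v) $ a = (\<Sum>b<k. cnj (v $ b) * (B $$ (b,a) * (B *\<^sub>v v) $ a))"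
        by (simp add: sum_distrib_right mult.assoc del: index_mult_mat_vec)
    qed
    also have "\<dots> = (\<Sum>b<k. cnj (v $ b) * (B *\<^sub>v (B *\<^sub>v v)) $ b)"
      by (subst sum.swap) (simp add: mult_mat_vec_index_sum[OF B(1) Bv] sum_distrib_left del: index_mult_mat_vec)
    also have "\<dots> = 0" unfolding BB using s0 v by simp
    finally have "B *\<^sub>v v = 0\<^sub>v k" using sq0[OF Bv] by blast
    moreover have "s \<cdot>\<^sub>v v = 0\<^sub>v k" using s0 v by (intro eq_vecI) auto
    ultimately show ?thesis unfolding v_def s_def by simp
  next
    case False
    then have lam: "lam p > 0" using ev(2)[OF p] by simp
    define w where "w = B *\<^sub>v v - s \<cdot>\<^sub>v v"
    have w: "w \<in> carrier_vec k" using Bv sv by (simp add: w_def)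
    have wi: "w $ a = (B *\<^sub>v v) $ a - s * v $ a" if "a < k" for a
      using that v sv unfolding w_def by (subst index_minus_vec) auto
    have Bw: "B *\<^sub>v w = (s * s) \<cdot>\<^sub>v v - s \<cdot>\<^sub>v (B *\<^sub>v v)"
      unfolding w_def mult_minus_distrib_mat_vec[OF B(1) Bv sv] BB mult_mat_vec[OF B(1) v] ..
    have Bwi: "(B *\<^sub>v w) $ a = - s * w $ a" if a: "a < k" for a
    proof -
      have d: "dim_vec (B *\<^sub>v v) = k" using Bv by (rule carrier_vecD)
      have "(B *\<^sub>v w) $ a = s * s * v $ a - s * (B *\<^sub>v v) $ a"
        unfolding Bw using a v d by (subst index_minus_vec) (simp_all del: index_mult_mat_vec dim_mult_mat_vec)
      then show ?thesis unfolding wi[OF a] by (simp add: algebra_simps del: index_mult_mat_vec)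
    qed
    have "(\<Sum>a<k. \<Sum>b<k. cnj (w $ a) * B $$ (a,b) * w $ b) = (\<Sum>a<k. cnj (w $ a) * (B *\<^sub>v w) $ a)"
      by (intro sum.cong refl) (simp add: mult_mat_vec_index_sum[OF B(1) w] sum_distrib_left mult.assoc del: index_mult_mat_vec)
    also have "\<dots> = (\<Sum>a<k. - s * (cnj (w $ a) * w $ a))"
      by (intro sum.cong refl) (simp add: Bwi del: index_mult_mat_vec)
    also have "\<dots> = of_real (- sqrt (lam p) * (\<Sum>a<k. (cmod (w $ a))\<^sup>2))"
      unfolding s_def of_real_mult of_real_sum sum_distrib_left
      by (intro sum.cong refl) (simp add: complex_norm_square mult.commute del: of_real_power)
    finally have eq: "(\<Sum>a<k. \<Sum>b<k. cnj (w $ a) * B $$ (a,b) * w $ b) = of_real (- sqrt (lam p) * (\<Sum>a<k. (cmod (w $ a))\<^sup>2))" .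
    have "0 \<le> Re (\<Sum>a<k. \<Sum>b<k. cnj (w $ a) * B $$ (a,b) * w $ b)"
      using psd_iff_form[OF B(1)] B(2) by blast
    then have "0 \<le> - sqrt (lam p) * (\<Sum>a<k. (cmod (w $ a))\<^sup>2)" unfolding eq by simp
    moreover have "sqrt (lam p) > 0" using lam by simp
    moreover have "(\<Sum>a<k. (cmod (w $ a))\<^sup>2) \<ge> 0" by (simp add: sum_nonneg)
    ultimately have "(\<Sum>a<k. (cmod (w $ a))\<^sup>2) = 0"
      by (smt (verit) mult_pos_pos mult_minus_left)
    then have "(\<Sum>a<k. cnj (w $ a) * w $ a) = 0"
      by (subst (asm) sum_nonneg_eq_0_iff) auto
    then have "w = 0\<^sub>v k" using sq0[OF w] by blast
    then show ?thesis using minus_vec_eq_zeroD[OF Bv sv] unfolding w_def v_def s_def by blast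
  qed
qed

lemma psd_root_exists:
  assumes A: "A \<in> carrier_mat k k" and psd: "psd A"
  shows "\<exists>!B. B \<in> carrier_mat k k \<and> psd B \<and> B * B = A"
proof -
  obtain U lam where U: "U \<in> carrier_mat k k" "mat_adjoint U * U = 1\<^sub>m k"
    and ev: "\<And>p. p < k \<Longrightarrow> A *\<^sub>v col U p = of_real (lam p) \<cdot>\<^sub>v col U p" "\<And>p. p < k \<Longrightarrow> 0 \<le> lam p"
    using psd_spectral[OF A psd] by metis
  have "spectral_mat k U (\<lambda>p. of_real (sqrt (lam p))) * spectral_mat k U (\<lambda>p. of_real (sqrt (lam p)))
      = spectral_mat k U (\<lambda>p. of_real (sqrt (lam p)) * of_real (sqrt (lam p)))"
    by (rule spectral_mat_mult[OF U])
  also have "\<dots> = spectral_mat k U (\<lambda>p. of_real (lam p))"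
    using ev(2) unfolding spectral_mat_def by (intro cong_mat refl) (auto intro!: sum.cong simp flip: of_real_mult)
  also have "\<dots> = A" by (rule spectral_mat_eqI[OF U A ev(1), symmetric])
  finally have "spectral_mat k U (\<lambda>p. of_real (sqrt (lam p))) * spectral_mat k U (\<lambda>p. of_real (sqrt (lam p))) = A" .
  moreover have "psd (spectral_mat k U (\<lambda>p. of_real (sqrt (lam p))))"
    by (rule psd_spectral_mat) (use ev(2) in auto)
  ultimately show ?thesis using psd_root_unique[OF A U ev] by (intro ex1I[of _ "spectral_mat k U (\<lambda>p. of_real (sqrt (lam p)))"]) auto
qed

lemma msqrt_root:
  assumes "A \<in> carrier_mat k k" "psd A"
  shows "msqrt A \<in> carrier_mat k k" "psd (msqrt A)" "msqrt A * msqrt A = A"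
  using theI'[OF psd_root_exists[OF assms]] assms(1) by (auto simp: msqrt_def)

lemma msqrt_eqI:
  assumes "A \<in> carrier_mat k k" "psd A" "B \<in> carrier_mat k k" "psd B" "B * B = A"
  shows "msqrt A = B"
  using the1_equality[OF psd_root_exists[OF assms(1,2)], of B] assms by (auto simp: msqrt_def)

section \<open>Rank one projections and the fidelity with a pure state\<close>

lemma psd_scaled_ket_bra:
  assumes phi: "\<phi> \<in> carrier_vec k" and c: "0 \<le> c"
  shows "psd (of_real c \<cdot>\<^sub>m ket_bra \<phi>)"
proof -
  have K: "of_real c \<cdot>\<^sub>m ket_bra \<phi> \<in> carrier_mat k k" using phi by (simp add: ket_bra_def)
  have "0 \<le> Re (\<Sum>a<k. \<Sum>b<k. cnj (v a) * (of_real c \<cdot>\<^sub>m ket_bra \<phi>) $$ (a,b) * v b)" for v :: "nat \<Rightarrow> complex"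
  proof -
    have "(\<Sum>a<k. \<Sum>b<k. cnj (v a) * (of_real c \<cdot>\<^sub>m ket_bra \<phi>) $$ (a,b) * v b)
        = (\<Sum>a<k. \<Sum>b<k. of_real c * ((cnj (v a) * \<phi> $ a) * (cnj (\<phi> $ b) * v b)))"
      using phi by (intro sum.cong refl) (simp add: ket_bra_def mult_ac)
    also have "\<dots> = of_real c * ((\<Sum>a<k. cnj (v a) * \<phi> $ a) * (\<Sum>b<k. cnj (\<phi> $ b) * v b))"
      by (simp only: sum_product) (simp only: sum_distrib_left)
    also have "(\<Sum>b<k. cnj (\<phi> $ b) * v b) = cnj (\<Sum>a<k. cnj (v a) * \<phi> $ a)" by (simp add: mult.commute)
    finally show ?thesis using c by (simp add: complex_mult_cnj del: cnj_sum)
  qed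
  moreover have "mat_adjoint (of_real c \<cdot>\<^sub>m ket_bra \<phi>) = of_real c \<cdot>\<^sub>m ket_bra \<phi>"
    by (rule eq_matI) (auto simp: ket_bra_def)
  ultimately show ?thesis unfolding psd_iff_form[OF K] by blast
qed

lemma ket_bra_sandwich:
  assumes phi: "\<phi> \<in> carrier_vec k" and X: "X \<in> carrier_mat k k"
  shows "ket_bra \<phi> * (X * ket_bra \<phi>) = (\<Sum>a<k. \<Sum>b<k. cnj (\<phi> $ a) * X $$ (a,b) * \<phi> $ b) \<cdot>\<^sub>m ket_bra \<phi>"
proof (rule eq_matI)
  have K: "ket_bra \<phi> \<in> carrier_mat k k" using phi by (simp add: ket_bra_def)
  have XK: "X * ket_bra \<phi> \<in> carrier_mat k k" by (rule mult_carrier_mat[OF X K])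
  let ?c = "\<Sum>a<k. \<Sum>b<k. cnj (\<phi> $ a) * X $$ (a,b) * \<phi> $ b"
  fix i j assume "i < dim_row (?c \<cdot>\<^sub>m ket_bra \<phi>)" "j < dim_col (?c \<cdot>\<^sub>m ket_bra \<phi>)"
  then have ij: "i < k" "j < k" using K by auto
  have "(ket_bra \<phi> * (X * ket_bra \<phi>)) $$ (i,j)
      = (\<Sum>a<k. \<Sum>b<k. \<phi> $ i * cnj (\<phi> $ j) * (cnj (\<phi> $ a) * X $$ (a,b) * \<phi> $ b))"
    unfolding mult_mat_index_sum[OF K XK ij]
  proof (rule sum.cong[OF refl])
    fix a assume "a \<in> {..<k}"
    then have a: "a < k" by simp
    show "ket_bra \<phi> $$ (i,a) * (X * ket_bra \<phi>) $$ (a,j) = (\<Sum>b<k. \<phi> $ i * cnj (\<phi> $ j) * (cnj (\<phi> $ a) * X $$ (a,b) * \<phi> $ b))"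
      unfolding mult_mat_index_sum[OF X K a ij(2)] sum_distrib_left
      by (intro sum.cong refl) (use phi ij a in \<open>simp add: ket_bra_def mult_ac\<close>)
  qed
  also have "\<dots> = (?c \<cdot>\<^sub>m ket_bra \<phi>) $$ (i,j)"
    unfolding sum_distrib_left[symmetric] using ij phi by (simp add: ket_bra_def mult.commute)
  finally show "(ket_bra \<phi> * (X * ket_bra \<phi>)) $$ (i,j) = (?c \<cdot>\<^sub>m ket_bra \<phi>) $$ (i,j)" .
qed (use phi X in \<open>auto simp: ket_bra_def\<close>)

lemma unit_vec_c_sum:
  assumes "unit_vec_c k \<phi>"
  shows "\<phi> \<in> carrier_vec k" "(\<Sum>a<k. cnj (\<phi> $ a) * \<phi> $ a) = 1"
  using assms cscalar_prod_sum[of \<phi> k \<phi>] by (auto simp: unit_vec_c_def mult.commute)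

text \<open>With \<open>K\<close> the projection and \<open>R\<close> the root of
  \<open>\<rho>\<close>, the matrix under the outer root is K \<rho> K, which is \<open>K\<close>
  times the overlap. Its root is \<open>K\<close> times the square root of the overlap, and
  \<open>K\<close> has trace one.\<close>

lemma fidelity_pure:
  assumes rho: "\<rho> \<in> carrier_mat k k" "psd \<rho>" and phi: "unit_vec_c k \<phi>"
  shows "fidelity \<rho> (ket_bra \<phi>) = sqrt (Re (\<Sum>a<k. \<Sum>b<k. cnj (\<phi> $ a) * \<rho> $$ (a,b) * \<phi> $ b))"
proof -
  note u = unit_vec_c_sum[OF phi]
  define K where "K = ket_bra \<phi>"
  define R where "R = msqrt \<rho>"
  define z where "z = (\<Sum>a<k. \<Sum>b<k. cnj (\<phi> $ a) * \<rho> $$ (a,b) * \<phi> $ b)"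
  define c where "c = Re z"
  have K: "K \<in> carrier_mat k k" using u by (simp add: K_def ket_bra_def)
  have R: "R \<in> carrier_mat k k" "psd R" "R * R = \<rho>" unfolding R_def using msqrt_root[OF rho] by auto
  have psdK: "psd (of_real t \<cdot>\<^sub>m K)" if "0 \<le> t" for t unfolding K_def by (rule psd_scaled_ket_bra[OF u(1) that])
  have one: "of_real 1 \<cdot>\<^sub>m K = K" by (rule eq_matI) auto
  have pK: "psd K" using psdK[of 1] one by simp
  have adjK: "mat_adjoint K = K" and adjR: "mat_adjoint R = R" using pK R(2) by (auto simp: psd_def)
  have KK: "K * K = K"
  proof -
    have "K * (1\<^sub>m k * K) = (\<Sum>a<k. \<Sum>b<k. cnj (\<phi> $ a) * 1\<^sub>m k $$ (a,b) * \<phi> $ b) \<cdot>\<^sub>m K"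
      unfolding K_def by (rule ket_bra_sandwich[OF u(1)]) simp
    also have "(\<Sum>a<k. \<Sum>b<k. cnj (\<phi> $ a) * 1\<^sub>m k $$ (a,b) * \<phi> $ b) = (\<Sum>a<k. \<Sum>b<k. if b = a then cnj (\<phi> $ a) * \<phi> $ a else 0)"
      by (intro sum.cong refl) auto
    also have "\<dots> = 1" using u(2) by simp
    finally show ?thesis using K one by simp
  qed
  have sqK: "msqrt K = K" by (rule msqrt_eqI[OF K pK K pK KK])
  have zc: "z = of_real c"
  proof -
    have herm: "mat_adjoint \<rho> = \<rho>" using rho(2) by (simp add: psd_def)
    have "cnj z = (\<Sum>a<k. \<Sum>b<k. \<phi> $ a * \<rho> $$ (b,a) * cnj (\<phi> $ b))"
      unfolding z_def using hermitian_index[OF rho(1) herm] by simp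
    also have "\<dots> = z" unfolding z_def by (subst sum.swap) (simp add: mult_ac)
    finally show ?thesis unfolding c_def by (auto simp: complex_eq_iff)
  qed
  have c0: "0 \<le> c" unfolding c_def z_def using rho psd_iff_form[OF rho(1)] by blast
  have "mat_adjoint (R * K) * (R * K) = (K * R) * (R * K)"
    using mat_adjoint_mult[OF R(1) K] adjK adjR by simp
  also have "\<dots> = K * (R * (R * K))"
    by (rule assoc_mult_mat[OF K R(1) mult_carrier_mat[OF R(1) K]])
  also have "R * (R * K) = \<rho> * K" using assoc_mult_mat[OF R(1) R(1) K] R(3) by simp
  also have "K * (\<rho> * K) = of_real c \<cdot>\<^sub>m K"
    unfolding K_def zc[symmetric] z_def by (rule ket_bra_sandwich[OF u(1) rho(1)])
  finally have M: "mat_adjoint (R * K) * (R * K) = of_real c \<cdot>\<^sub>m K" .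
  have "msqrt (of_real c \<cdot>\<^sub>m K) = of_real (sqrt c) \<cdot>\<^sub>m K"
  proof (rule msqrt_eqI)
    show "of_real c \<cdot>\<^sub>m K \<in> carrier_mat k k" "of_real (sqrt c) \<cdot>\<^sub>m K \<in> carrier_mat k k" using K by auto
    show "psd (of_real c \<cdot>\<^sub>m K)" "psd (of_real (sqrt c) \<cdot>\<^sub>m K)" using psdK c0 by auto
    have sK: "of_real (sqrt c) \<cdot>\<^sub>m K \<in> carrier_mat k k" using K by simp
    have "(of_real (sqrt c) \<cdot>\<^sub>m K) * (of_real (sqrt c) \<cdot>\<^sub>m K) = of_real (sqrt c) \<cdot>\<^sub>m (of_real (sqrt c) \<cdot>\<^sub>m (K * K))"
      unfolding mult_smult_assoc_mat[OF K sK] mult_smult_distrib[OF K K] ..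
    also have "\<dots> = of_real c \<cdot>\<^sub>m K" unfolding KK using c0
      by (intro eq_matI) (auto simp flip: mult.assoc of_real_mult)
    finally show "(of_real (sqrt c) \<cdot>\<^sub>m K) * (of_real (sqrt c) \<cdot>\<^sub>m K) = of_real c \<cdot>\<^sub>m K" .
  qed
  then have "fidelity \<rho> (ket_bra \<phi>) = Re (mtrace (of_real (sqrt c) \<cdot>\<^sub>m K))"
    using M sqK unfolding fidelity_def trace_norm_def R_def K_def by simp
  also have "mtrace (of_real (sqrt c) \<cdot>\<^sub>m K) = (\<Sum>i<k. of_real (sqrt c) * (cnj (\<phi> $ i) * \<phi> $ i))"
    unfolding mtrace_def using u(1) by (simp add: K_def ket_bra_def mult.commute)
  also have "\<dots> = of_real (sqrt c)" unfolding sum_distrib_left[symmetric] u(2) by simp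
  finally show ?thesis unfolding c_def z_def by simp
qed

section \<open>Embedded copies of SU(2) and the characters of the circle\<close>

text \<open>The SU(2) matrix with rows (a, - cnj b) and (b, cnj a) acting on coordinates
  \<open>i\<close> and \<open>j\<close>, extended by the identity. The case \<open>b = 0\<close> is
  the one-parameter torus of the pair.\<close>

definition emb :: "nat \<Rightarrow> nat \<Rightarrow> nat \<Rightarrow> complex \<Rightarrow> complex \<Rightarrow> complex mat" where
  "emb d i j a b = mat d d (\<lambda>(x,y).
     if x = i \<and> y = i then a else if x = i \<and> y = j then - cnj b
     else if x = j \<and> y = i then b else if x = j \<and> y = j then cnj a
     else if x = y then 1 else 0)"

definition tor :: "nat \<Rightarrow> (nat \<Rightarrow> complex) \<Rightarrow> complex mat" where
  "tor d f = mat d d (\<lambda>(x,y). if x = y then f x else 0)"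

text \<open>The entry \<open>cnj z\<close> is the inverse of \<open>z\<close> on the unit circle,
  where the torus elements live.\<close>

definition torf :: "nat \<Rightarrow> nat \<Rightarrow> complex \<Rightarrow> nat \<Rightarrow> complex" where
  "torf k l z x = (if x = k then z else if x = l then cnj z else 1)"

lemma emb_carrier [simp]: "emb d i j a b \<in> carrier_mat d d"
  by (simp add: emb_def)

lemma tor_carrier [simp]: "tor d f \<in> carrier_mat d d"
  by (simp add: tor_def)

lemma emb_index:
  "x < d \<Longrightarrow> y < d \<Longrightarrow> emb d i j a b $$ (x,y) =
    (if x = i \<and> y = i then a else if x = i \<and> y = j then - cnj b
     else if x = j \<and> y = i then b else if x = j \<and> y = j then cnj a
     else if x = y then 1 else 0)"
  by (simp add: emb_def)

lemma tor_index: "x < d \<Longrightarrow> y < d \<Longrightarrow> tor d f $$ (x,y) = (if x = y then f x else 0)"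
  by (simp add: tor_def)

lemma emb_eq_tor:
  assumes "i \<noteq> j"
  shows "emb d i j z 0 = tor d (torf i j z)"
proof (rule eq_matI)
  fix x y assume "x < dim_row (tor d (torf i j z))" "y < dim_col (tor d (torf i j z))"
  then have xy: "x < d" "y < d" by (simp_all add: tor_def)
  show "emb d i j z 0 $$ (x,y) = tor d (torf i j z) $$ (x,y)"
    unfolding emb_index[OF xy] tor_index[OF xy] torf_def using assms
    by (cases "x = i"; cases "x = j"; cases "y = i"; cases "y = j"; simp)
qed (simp_all add: emb_def tor_def)

lemma tor_mult_left:
  assumes "M \<in> carrier_mat d d" "x < d" "y < d"
  shows "(tor d f * M) $$ (x,y) = f x * M $$ (x,y)"
proof -
  have "(tor d f * M) $$ (x,y) = (\<Sum>t<d. if t = x then f x * M $$ (x,y) else 0)"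
    unfolding mult_mat_index_sum[OF tor_carrier assms] using assms by (intro sum.cong) (auto simp: tor_index)
  then show ?thesis using assms by simp
qed

lemma tor_mult_right:
  assumes "M \<in> carrier_mat d d" "x < d" "y < d"
  shows "(M * tor d f) $$ (x,y) = M $$ (x,y) * f y"
proof -
  have "(M * tor d f) $$ (x,y) = (\<Sum>t<d. if t = y then M $$ (x,y) * f y else 0)"
    unfolding mult_mat_index_sum[OF assms(1) tor_carrier assms(2,3)] using assms
    by (intro sum.cong) (auto simp: tor_index)
  then show ?thesis using assms by simp
qed

lemma tor_mult: "tor d f * tor d g = tor d (\<lambda>x. f x * g x)"
proof (rule eq_matI)
  fix x y assume "x < dim_row (tor d (\<lambda>x. f x * g x))" "y < dim_col (tor d (\<lambda>x. f x * g x))"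
  then have xy: "x < d" "y < d" by (auto simp: tor_def)
  show "(tor d f * tor d g) $$ (x,y) = tor d (\<lambda>x. f x * g x) $$ (x,y)"
    unfolding tor_mult_left[OF tor_carrier xy] using xy by (simp add: tor_index)
qed (auto simp: tor_def)

lemma tor_one: "(\<And>x. x < d \<Longrightarrow> f x = 1) \<Longrightarrow> tor d f = 1\<^sub>m d"
  by (rule eq_matI) (auto simp: tor_def)

lemma tor_cong: "(\<And>x. x < d \<Longrightarrow> f x = g x) \<Longrightarrow> tor d f = tor d g"
  by (rule eq_matI) (auto simp: tor_def)

lemma emb_row_sum:
  assumes ij: "i < d" "j < d" "i \<noteq> j" and x: "x < d"
  shows "(\<Sum>t<d. emb d i j a b $$ (x,t) * g t)
    = (if x = i then a * g i - cnj b * g j else if x = j then b * g i + cnj a * g j else g x)"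
proof -
  have "(\<Sum>t<d. emb d i j a b $$ (x,t) * g t) = (\<Sum>t<d. 
      (if t = i then (if x = i then a else if x = j then b else 0) * g i else 0)
    + (if t = j then (if x = i then - cnj b else if x = j then cnj a else 0) * g j else 0)
    + (if t = x then (if x = i \<or> x = j then 0 else g x) else 0))"
  proof (rule sum.cong[OF refl])
    fix t assume "t \<in> {..<d}"
    then have t: "t < d" by simp
    show "emb d i j a b $$ (x,t) * g t = (if t = i then (if x = i then a else if x = j then b else 0) * g i else 0)
      + (if t = j then (if x = i then - cnj b else if x = j then cnj a else 0) * g j else 0)
      + (if t = x then (if x = i \<or> x = j then 0 else g x) else 0)"
      unfolding emb_index[OF x t] using ij(3)
      by (cases "x = i"; cases "x = j"; cases "t = i"; cases "t = j"; simp)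
  qed
  also have "\<dots> = (if x = i then a else if x = j then b else 0) * g i
    + (if x = i then - cnj b else if x = j then cnj a else 0) * g j + (if x = i \<or> x = j then 0 else g x)"
    unfolding sum.distrib using ij x by simp
  finally show ?thesis using ij(3) by (cases "x = i"; cases "x = j"; simp)
qed

lemma emb_mult:
  assumes ij: "i < d" "j < d" "i \<noteq> j"
  shows "emb d i j a b * emb d i j a' b' = emb d i j (a * a' - cnj b * b') (b * a' + cnj a * b')"
proof (rule eq_matI)
  fix x y assume "x < dim_row (emb d i j (a * a' - cnj b * b') (b * a' + cnj a * b'))"
    "y < dim_col (emb d i j (a * a' - cnj b * b') (b * a' + cnj a * b'))"
  then have xy: "x < d" "y < d" by (auto simp: emb_def)
  have "(emb d i j a b * emb d i j a' b') $$ (x,y) = (\<Sum>t<d. emb d i j a b $$ (x,t) * emb d i j a' b' $$ (t,y))"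
    by (rule mult_mat_index_sum[OF emb_carrier emb_carrier xy])
  also have "\<dots> = emb d i j (a * a' - cnj b * b') (b * a' + cnj a * b') $$ (x,y)"
    unfolding emb_row_sum[OF ij xy(1)] emb_index[OF ij(1) xy(2)] emb_index[OF ij(2) xy(2)] emb_index[OF xy]
    using ij(3) by (cases "x = i"; cases "x = j"; cases "y = i"; cases "y = j"; simp add: algebra_simps)
  finally show "(emb d i j a b * emb d i j a' b') $$ (x,y)
    = emb d i j (a * a' - cnj b * b') (b * a' + cnj a * b') $$ (x,y)" .
qed (auto simp: emb_def)

lemma emb_one: "i \<noteq> j \<Longrightarrow> emb d i j 1 0 = 1\<^sub>m d"
  unfolding emb_eq_tor by (rule tor_one) (simp add: torf_def)

lemma emb_adjoint:
  assumes "i \<noteq> j"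
  shows "mat_adjoint (emb d i j a b) = emb d i j (cnj a) (- b)"
proof (rule eq_matI)
  fix x y assume "x < dim_row (emb d i j (cnj a) (- b))" "y < dim_col (emb d i j (cnj a) (- b))"
  then have xy: "x < d" "y < d" by (auto simp: emb_def)
  have "mat_adjoint (emb d i j a b) $$ (x,y) = cnj (emb d i j a b $$ (y,x))"
    using xy by (intro mat_adjoint_index) (simp_all add: emb_def)
  also have "\<dots> = emb d i j (cnj a) (- b) $$ (x,y)"
    unfolding emb_index[OF xy] emb_index[OF xy(2,1)] using assms
    by (cases "x = i"; cases "x = j"; cases "y = i"; cases "y = j"; simp)
  finally show "mat_adjoint (emb d i j a b) $$ (x,y) = emb d i j (cnj a) (- b) $$ (x,y)" .
qed (simp_all add: emb_def)

lemma det_emb_offdiag: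
  assumes ij: "i < d" "j < d" "i \<noteq> j" and b: "b \<noteq> 0" and ab: "a * cnj a + b * cnj b = 1"
  shows "det (emb d i j a b) = 1"
proof -
  \<comment> \<open>every element of SL(2) with nonzero lower left entry is a product of three shears\<close>
  define s where "s = (a - 1) / b"
  define t where "t = (cnj a - 1) / b"
  define E where "E = addrow s i j (addrow b j i (addrow t i j (1\<^sub>m d)))"
  have E: "E = emb d i j a b"
  proof (rule eq_matI)
    fix x y assume "x < dim_row (emb d i j a b)" "y < dim_col (emb d i j a b)"
    then have xy: "x < d" "y < d" by (auto simp: emb_def)
    have 1: "s * b = a - 1" "b * t = cnj a - 1" using b by (simp_all add: s_def t_def)
    have "(t + s * cnj a) * b = b * t + (s * b) * cnj a" by (simp add: algebra_simps)
    also have "\<dots> = a * cnj a - 1" unfolding 1 by (simp add: algebra_simps)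
    also have "\<dots> = (- cnj b) * b" using ab by (simp add: algebra_simps eq_diff_eq)
    finally have 2: "t + s * cnj a = - cnj b" using b by (metis mult_right_cancel)
    have 3: "s * (b * t + 1) + t = - cnj b" using 1 2 by (simp add: algebra_simps)
    show "E $$ (x,y) = emb d i j a b $$ (x,y)"
      unfolding emb_index[OF xy] using xy ij 1 3
      by (cases "x = i"; cases "x = j"; cases "y = i"; cases "y = j"; simp add: E_def)
  qed (simp_all add: E_def emb_def)
  have "det E = 1"
    unfolding E_def using ij by (simp add: det_addrow[of _ d])
  then show ?thesis unfolding E .
qed

text \<open>For \<open>b = 0\<close> the shears would divide by zero; the matrix is first split into
  two factors with nonzero lower left entry.\<close>

lemma det_emb:
  assumes ij: "i < d" "j < d" "i \<noteq> j" and ab: "a * cnj a + b * cnj b = 1"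
  shows "det (emb d i j a b) = 1"
proof (cases "b = 0")
  case True
  then have a: "a \<noteq> 0" using ab by auto
  have "emb d i j a b = emb d i j 0 1 * emb d i j 0 (- a)"
    unfolding emb_mult[OF ij] using True by simp
  also have "det \<dots> = det (emb d i j 0 1) * det (emb d i j 0 (- a))"
    by (rule det_mult[of _ d]) auto
  also have "\<dots> = 1" using a ab True ij by (simp add: det_emb_offdiag)
  finally show ?thesis .
qed (use det_emb_offdiag assms in auto)

lemma emb_SU:
  assumes ij: "i < d" "j < d" "i \<noteq> j" and ab: "a * cnj a + b * cnj b = 1"
  shows "emb d i j a b \<in> SU d"
proof -
  have "mat_adjoint (emb d i j a b) * emb d i j a b = emb d i j 1 0"
    unfolding emb_adjoint[OF ij(3)] emb_mult[OF ij] using ab by (simp add: mult.commute)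
  then have "unitary_mat d (emb d i j a b)" unfolding unitary_mat_def emb_one[OF ij(3)] by simp
  then show ?thesis unfolding SU_def using det_emb[OF assms] by blast
qed

text \<open>The off-diagonal entry is multiplied by the root character of the pair. All weight
  shifts originate here.\<close>

lemma emb_torus_conj:
  assumes ij: "i < d" "j < d" "i \<noteq> j" and f: "\<And>x. x < d \<Longrightarrow> f x * cnj (f x) = 1"
  shows "tor d f * emb d i j a b * tor d (\<lambda>x. cnj (f x)) = emb d i j a (b * (f j * cnj (f i)))"
proof (rule eq_matI)
  fix x y assume "x < dim_row (emb d i j a (b * (f j * cnj (f i))))" "y < dim_col (emb d i j a (b * (f j * cnj (f i))))"
  then have xy: "x < d" "y < d" by (auto simp: emb_def)
  have "(tor d f * emb d i j a b * tor d (\<lambda>x. cnj (f x))) $$ (x,y) = (f x * emb d i j a b $$ (x,y)) * cnj (f y)"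
    unfolding tor_mult_right[OF mult_carrier_mat[OF tor_carrier emb_carrier] xy] tor_mult_left[OF emb_carrier xy] ..
  also have "\<dots> = emb d i j a (b * (f j * cnj (f i))) $$ (x,y)"
  proof -
    have fm: "f x * m * cnj (f x) = m" for m
      using f[OF xy(1)] by (metis mult.assoc mult.commute mult_1)
    have ff: "f x * cnj (f x) = 1" by (rule f[OF xy(1)])
    consider "x = i" "y = i" | "x = i" "y = j" | "x = j" "y = i" | "x = j" "y = j"
      | "x \<noteq> y" "x \<notin> {i, j} \<or> y \<notin> {i, j}" | "x = y" "x \<notin> {i, j}" by blast
    then show ?thesis
    proof cases
      case 2
      then show ?thesis unfolding emb_index[OF xy] using ij(3) by (simp add: mult_ac)
    next
      case 3
      then show ?thesis unfolding emb_index[OF xy] using ij(3) by (simp add: mult_ac)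
    next
      case 5
      then have "emb d i j a c $$ (x,y) = 0" for c unfolding emb_index[OF xy] by auto
      then show ?thesis by simp
    next
      case 1
      then show ?thesis using fm[of a] ff unfolding emb_index[OF xy] by simp
    next
      case 4
      have "j \<noteq> i" using ij(3) by simp
      then show ?thesis using 4 fm[of "cnj a"] ff unfolding emb_index[OF xy] by simp
    next
      case 6
      then show ?thesis using ff unfolding emb_index[OF xy] by simp
    qed
  qed
  finally show "(tor d f * emb d i j a b * tor d (\<lambda>x. cnj (f x))) $$ (x,y) = emb d i j a (b * (f j * cnj (f i))) $$ (x,y)" .
qed (auto simp: emb_def tor_def)

text \<open>The matrix \<open>emb d i j 0 1\<close> represents the Weyl reflection exchanging two
  coordinates.\<close>

lemma emb_swap_torus:
  assumes ij: "i < d" "j < d" "i \<noteq> j"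
  shows "emb d i j 0 1 * tor d f = tor d (\<lambda>x. f (Transposition.transpose i j x)) * emb d i j 0 1"
proof (rule eq_matI)
  fix x y assume "x < dim_row (tor d (\<lambda>x. f (Transposition.transpose i j x)) * emb d i j 0 1)"
    "y < dim_col (tor d (\<lambda>x. f (Transposition.transpose i j x)) * emb d i j 0 1)"
  then have xy: "x < d" "y < d" by (auto simp: emb_def tor_def)
  show "(emb d i j 0 1 * tor d f) $$ (x,y) = (tor d (\<lambda>x. f (Transposition.transpose i j x)) * emb d i j 0 1) $$ (x,y)"
    unfolding tor_mult_right[OF emb_carrier xy] tor_mult_left[OF emb_carrier xy] emb_index[OF xy] Transposition.transpose_def
    using ij(3) by (cases "x = i"; cases "x = j"; cases "y = i"; cases "y = j"; simp)
qed (auto simp: emb_def tor_def)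

lemma torf_transpose:
  "torf k l z (Transposition.transpose i j x) = torf (Transposition.transpose i j k) (Transposition.transpose i j l) z x"
proof -
  have "Transposition.transpose i j x = y \<longleftrightarrow> x = Transposition.transpose i j y" for y
    by (metis transpose_involutory)
  from this[of k] this[of l] show ?thesis unfolding torf_def by (simp only:)
qed

text \<open>Integrating the functional equation expresses \<open>\<chi>\<close> through an
  antiderivative G: the product of \<chi>(s) and G(a) - G(0) is G(s + a) - G(s). So continuity
  improves to differentiability, the derivative is a constant multiple of \<chi>, and the period
  makes this constant an integer multiple of the imaginary unit.\<close>

lemma circle_character:
  fixes \<chi> :: "real \<Rightarrow> complex"
  assumes cont: "\<And>t. isCont \<chi> t" and hom: "\<And>s t. \<chi> (s + t) = \<chi> s * \<chi> t"
    and nz: "\<chi> 0 = 1" and per: "\<chi> (2 * pi) = 1"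
  obtains m :: int where "\<And>t. \<chi> t = cis (of_int m * t)"
proof -
  have "\<exists>F. \<forall>x :: real. (- \<infinity> :: ereal) < x \<longrightarrow> x < (\<infinity> :: ereal) \<longrightarrow> (F has_vector_derivative \<chi> x) (at x)"
    by (rule einterval_antiderivative) (use cont in auto)
  then obtain G where G: "\<And>x. (G has_vector_derivative \<chi> x) (at x)" by auto
  have Gs: "((\<lambda>a. G (s + a)) has_vector_derivative \<chi> (s + a)) (at a)" for s a
  proof -
    have "((\<lambda>a. s + a) has_vector_derivative 0 + 1) (at a)"
      by (intro has_vector_derivative_add has_vector_derivative_const has_vector_derivative_id)
    from vector_diff_chain_at[OF this, of G "\<chi> (s + a)"] G[of "s + a"]
    show ?thesis by (simp add: o_def)
  qed
  have key: "G (s + a) - \<chi> s * G a = G s - \<chi> s * G 0" for s a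
  proof -
    have "((\<lambda>a. G (s + a) - \<chi> s * G a) has_vector_derivative 0) (at x within UNIV)" for x
      using Gs[of s x] G[of x] hom[of s x] by (auto intro!: derivative_eq_intros)
    then obtain c where "\<And>x. x \<in> UNIV \<Longrightarrow> G (s + x) - \<chi> s * G x = c"
      using has_vector_derivative_zero_constant[of UNIV "\<lambda>a. G (s + a) - \<chi> s * G a"] by (metis convex_UNIV)
    from this[of a] this[of 0] show ?thesis by simp
  qed
  have "\<exists>a. G a \<noteq> G 0"
  proof (rule ccontr)
    assume "\<not> ?thesis"
    then have "G = (\<lambda>_. G 0)" by auto
    then have "(G has_vector_derivative 0) (at 0)" by (metis has_vector_derivative_const)
    then have "\<chi> 0 = 0" using G[of 0] vector_derivative_unique_at by blast
    with nz show False by simp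
  qed
  then obtain a where a: "G a - G 0 \<noteq> 0" by auto
  have chi: "\<chi> s = (G (s + a) - G s) / (G a - G 0)" for s
  proof -
    have "\<chi> s * (G a - G 0) = G (s + a) - G s" using key[of s a] by (simp add: algebra_simps)
    then show ?thesis using a by (simp add: field_simps)
  qed
  define c where "c = (\<chi> a - 1) / (G a - G 0)"
  have d: "(\<chi> has_vector_derivative c * \<chi> s) (at s)" for s
  proof -
    have "((\<lambda>s. (G (s + a) - G s) / (G a - G 0)) has_vector_derivative (\<chi> (s + a) - \<chi> s) / (G a - G 0)) (at s)"
      using Gs[of a s] G[of s] by (intro has_vector_derivative_divide has_vector_derivative_diff) (auto simp: add.commute)
    moreover have "(\<lambda>s. (G (s + a) - G s) / (G a - G 0)) = \<chi>" using chi by auto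
    moreover have "(\<chi> (s + a) - \<chi> s) / (G a - G 0) = c * \<chi> s"
      unfolding hom c_def using a by (simp add: field_simps)
    ultimately show ?thesis by simp
  qed
  have e: "((\<lambda>s. exp (- c * of_real s)) has_vector_derivative - c * exp (- c * of_real s)) (at s)" for s
    by (rule has_vector_derivative_real_field) (auto intro!: derivative_eq_intros)
  have "((\<lambda>s. \<chi> s * exp (- c * of_real s)) has_vector_derivative 0) (at s within UNIV)" for s
    using has_vector_derivative_mult[OF d[of s] e[of s]] by (simp add: algebra_simps)
  then obtain k where k: "\<And>x. x \<in> UNIV \<Longrightarrow> \<chi> x * exp (- c * of_real x) = k"
    using has_vector_derivative_zero_constant[of UNIV "\<lambda>s. \<chi> s * exp (- c * of_real s)"] by (metis convex_UNIV)
  have chi_exp: "\<chi> t = exp (c * of_real t)" for t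
  proof -
    have "\<chi> t * exp (- c * of_real t) = 1" using k[of t] k[of 0] nz by simp
    then have "\<chi> t * exp (- c * of_real t) * exp (c * of_real t) = exp (c * of_real t)" by simp
    then show ?thesis by (simp add: mult.assoc flip: exp_add)
  qed
  then have "exp (c * of_real (2 * pi)) = 1" using per by metis
  then obtain n :: int where n: "Re (c * of_real (2 * pi)) = 0" "Im (c * of_real (2 * pi)) = of_int (2 * n) * pi"
    unfolding exp_eq_1 by auto
  then have "Re c = 0" "Im c = of_int n" by auto
  then have c: "c = \<i> * of_int n" by (simp add: complex_eq_iff)
  have "\<chi> t = cis (of_int n * t)" for t
    unfolding chi_exp c cis_conv_exp by (simp add: mult_ac)
  then show ?thesis using that by blast
qed

section \<open>Representations that are diagonal on the torus\<close>

lemma SU_mult: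
  assumes "U \<in> SU d" "W \<in> SU d"
  shows "U * W \<in> SU d"
proof -
  have U: "U \<in> carrier_mat d d" "mat_adjoint U * U = 1\<^sub>m d" "det U = 1"
    and W: "W \<in> carrier_mat d d" "mat_adjoint W * W = 1\<^sub>m d" "det W = 1"
    using assms by (auto simp: SU_def unitary_mat_def)
  have U': "mat_adjoint U \<in> carrier_mat d d" and W': "mat_adjoint W \<in> carrier_mat d d" using U(1) W(1) by simp_all
  have UW: "U * W \<in> carrier_mat d d" by (rule mult_carrier_mat[OF U(1) W(1)])
  have "mat_adjoint (U * W) * (U * W) = mat_adjoint W * (mat_adjoint U * (U * W))"
    unfolding mat_adjoint_mult[OF U(1) W(1)] by (rule assoc_mult_mat[OF W' U' UW])
  also have "mat_adjoint U * (U * W) = W"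
    using assoc_mult_mat[OF U' U(1) W(1)] U(2) W(1) by simp
  finally have "mat_adjoint (U * W) * (U * W) = 1\<^sub>m d" using W(2) by simp
  then show ?thesis using UW det_mult[OF U(1) W(1)] U(3) W(3) by (simp add: SU_def unitary_mat_def)
qed

text \<open>The telescoping bound for powers on the unit circle; it supplies the Lipschitz constant
  of the torus.\<close>

lemma norm_cis_int_minus_one:
  "cmod (cis (of_int m * t) - 1) \<le> \<bar>of_int m\<bar> * cmod (cis t - 1)"
proof -
  have nat: "cmod (cis (of_nat n * t) - 1) \<le> of_nat n * cmod (cis t - 1)" for n :: nat and t
    using norm_power_diff[of "cis t" 1 n] by (simp add: Complex.DeMoivre)
  show ?thesis
  proof (cases "m \<ge> 0")
    case True
    then show ?thesis using nat[of "nat m" t] by simp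
  next
    case False
    have "cmod (cis (of_int m * t) - 1) = cmod (cnj (cis (of_int m * t) - 1))" by (simp only: complex_mod_cnj)
    also have "\<dots> = cmod (cis (of_nat (nat (- m)) * t) - 1)" using False by (simp add: cis_cnj)
    finally show ?thesis using nat[of "nat (- m)" t] False by simp
  qed
qed

text \<open>Turns a Lipschitz bound at the identity into the vanishing of derivatives along curves
  whose two matrix entries are stationary.\<close>

lemma has_vector_derivative_zero_bound:
  fixes f a b :: "real \<Rightarrow> complex"
  assumes a: "(a has_vector_derivative 0) (at 0)" and b: "(b has_vector_derivative 0) (at 0)"
    and bound: "\<And>t. cmod (f t - f 0) \<le> C * (cmod (a t - a 0) + cmod (b t - b 0))"
  shows "(f has_vector_derivative 0) (at 0)"
proof -
  have lim: "((\<lambda>y. cmod (g y - g 0) / \<bar>y\<bar>) \<longlongrightarrow> 0) (at 0)" if "(g has_vector_derivative 0) (at 0)" for g :: "real \<Rightarrow> complex"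
    using that unfolding has_vector_derivative_def has_derivative_iff_norm by simp
  have "((\<lambda>y. C * (cmod (a y - a 0) / \<bar>y\<bar> + cmod (b y - b 0) / \<bar>y\<bar>)) \<longlongrightarrow> C * (0 + 0)) (at 0)"
    by (intro tendsto_intros lim a b)
  moreover have "norm (cmod (f y - f 0) / \<bar>y\<bar>) \<le> C * (cmod (a y - a 0) / \<bar>y\<bar> + cmod (b y - b 0) / \<bar>y\<bar>)" for y
    using divide_right_mono[OF bound[of y], of "\<bar>y\<bar>"] by (simp add: add_divide_distrib algebra_simps)
  ultimately have "((\<lambda>y. cmod (f y - f 0) / \<bar>y\<bar>) \<longlongrightarrow> 0) (at 0)"
    by (intro Lim_null_comparison[of "\<lambda>y. cmod (f y - f 0) / \<bar>y\<bar>"]) auto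
  then show ?thesis unfolding has_vector_derivative_def has_derivative_iff_norm
    by (simp add: bounded_linear_zero)
qed

lemma has_vector_derivative_cis:
  "((\<lambda>t. cis (r * t)) has_vector_derivative \<i> * of_real r * cis (r * t)) (at t)"
proof -
  have "((\<lambda>t. exp (\<i> * of_real r * of_real t)) has_vector_derivative \<i> * of_real r * exp (\<i> * of_real r * of_real t)) (at t)"
    by (rule has_vector_derivative_real_field) (auto intro!: derivative_eq_intros)
  then show ?thesis by (simp add: cis_conv_exp mult_ac)
qed

lemma has_vector_derivative_sum_zero_point:
  assumes "\<And>s. s < k \<Longrightarrow> ((\<lambda>t. f t s) has_vector_derivative f' s) (at 0)"
    and "\<And>s. s < k \<Longrightarrow> ((\<lambda>t. g t s) has_vector_derivative g' s) (at 0)"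
  shows "((\<lambda>t. \<Sum>s<k. f t s * g t s :: complex) has_vector_derivative (\<Sum>s<k. f 0 s * g' s + f' s * g 0 s)) (at 0)"
  using assms by (intro has_vector_derivative_sum has_vector_derivative_mult) auto

section \<open>Matrix entries of a unitary representation near the identity\<close>

locale unitary_rep =
  fixes d k :: nat and \<rho> :: "complex mat \<Rightarrow> complex mat"
  assumes unitary: "\<And>U. U \<in> SU d \<Longrightarrow> unitary_mat k (\<rho> U)"
    and mult: "\<And>U W. U \<in> SU d \<Longrightarrow> W \<in> SU d \<Longrightarrow> \<rho> (U * W) = \<rho> U * \<rho> W"
begin

lemma rep_carrier: "U \<in> SU d \<Longrightarrow> \<rho> U \<in> carrier_mat k k"
  using unitary by (simp add: unitary_mat_def)

lemma rep_mult_index: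
  assumes "U \<in> SU d" "W \<in> SU d" "p < k" "q < k"
  shows "\<rho> (U * W) $$ (p,q) = (\<Sum>t<k. \<rho> U $$ (p,t) * \<rho> W $$ (t,q))"
  unfolding mult[OF assms(1,2)]
  by (rule mult_mat_index_sum[OF rep_carrier[OF assms(1)] rep_carrier[OF assms(2)] assms(3,4)])

lemma one_SU: "1\<^sub>m d \<in> SU d"
  by (simp add: SU_def unitary_mat_def)

lemma rep_one: "\<rho> (1\<^sub>m d) = 1\<^sub>m k"
proof -
  let ?A = "\<rho> (1\<^sub>m d)"
  have A: "?A \<in> carrier_mat k k" "mat_adjoint ?A * ?A = 1\<^sub>m k" using unitary[OF one_SU] by (auto simp: unitary_mat_def)
  have "?A * ?A = ?A" using mult[OF one_SU one_SU] by simp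
  then have "mat_adjoint ?A * (?A * ?A) = 1\<^sub>m k" using A by simp
  then show ?thesis
    using assoc_mult_mat[OF mat_adjoint_carrier[OF A(1)] A(1) A(1)] A by simp
qed

lemma rep_inverse:
  assumes U: "U \<in> SU d" and W: "W \<in> SU d" and inv: "U * W = 1\<^sub>m d"
  shows "\<rho> W = mat_adjoint (\<rho> U)"
proof -
  have A: "\<rho> U \<in> carrier_mat k k" "mat_adjoint (\<rho> U) * \<rho> U = 1\<^sub>m k" using unitary[OF U] by (auto simp: unitary_mat_def)
  note B = rep_carrier[OF W]
  have "\<rho> U * \<rho> W = 1\<^sub>m k" using mult[OF U W] inv rep_one by simp
  then have "mat_adjoint (\<rho> U) * (\<rho> U * \<rho> W) = mat_adjoint (\<rho> U)"
    using A(1) by (simp add: right_mult_one_mat[of _ k k])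
  then show ?thesis using assoc_mult_mat[OF mat_adjoint_carrier[OF A(1)] A(1) B] A(2) B by simp
qed

lemma rep_inverse_index:
  assumes "U \<in> SU d" "W \<in> SU d" "U * W = 1\<^sub>m d" "p < k" "q < k"
  shows "\<rho> W $$ (p,q) = cnj (\<rho> U $$ (q,p))"
  unfolding rep_inverse[OF assms(1-3)] using rep_carrier[OF assms(1)] assms(4,5)
  by (intro mat_adjoint_index) auto

lemma rep_orth_cols:
  assumes "U \<in> SU d" "p < k" "q < k"
  shows "(\<Sum>t<k. cnj (\<rho> U $$ (t,p)) * \<rho> U $$ (t,q)) = (if p = q then 1 else 0)"
  using unitary[OF assms(1)] assms(2,3) unfolding unitary_mat_def by (intro unitary_cols) auto

lemma rep_norm_le: 
  assumes U: "U \<in> SU d" and pq: "p < k" "q < k"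
  shows "cmod (\<rho> U $$ (p,q)) \<le> 1"
proof -
  have "complex_of_real (\<Sum>t<k. (cmod (\<rho> U $$ (t,q)))\<^sup>2) = (\<Sum>t<k. cnj (\<rho> U $$ (t,q)) * \<rho> U $$ (t,q))"
    unfolding of_real_sum by (intro sum.cong refl) (simp add: complex_norm_square mult.commute del: of_real_power)
  also have "\<dots> = 1" using rep_orth_cols[OF U pq(2,2)] by simp
  finally have "(\<Sum>t<k. (cmod (\<rho> U $$ (t,q)))\<^sup>2) = 1" using of_real_eq_1_iff by blast
  moreover have "(cmod (\<rho> U $$ (p,q)))\<^sup>2 \<le> (\<Sum>t<k. (cmod (\<rho> U $$ (t,q)))\<^sup>2)"
    using pq by (intro member_le_sum) auto
  ultimately show ?thesis by (simp add: power2_le_iff_abs_le abs_square_le_1)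
qed

abbreviation \<delta> :: "nat \<Rightarrow> nat \<Rightarrow> complex" where "\<delta> p q \<equiv> (if p = q then 1 else 0)"

lemma rep_mult_near:
  assumes UW: "U \<in> SU d" "W \<in> SU d"
    and near: "\<And>p q. p < k \<Longrightarrow> q < k \<Longrightarrow> cmod (\<rho> U $$ (p,q) - \<delta> p q) \<le> e"
      "\<And>p q. p < k \<Longrightarrow> q < k \<Longrightarrow> cmod (\<rho> W $$ (p,q) - \<delta> p q) \<le> e'"
    and pq: "p < k" "q < k"
  shows "cmod (\<rho> (U * W) $$ (p,q) - \<delta> p q) \<le> e + real k * e'"
proof -
  have "(\<Sum>t<k. \<rho> U $$ (p,t) * \<delta> t q) = (\<Sum>t<k. if t = q then \<rho> U $$ (p,q) else 0)" by (intro sum.cong) auto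
  also have "\<dots> = \<rho> U $$ (p,q)" using pq by simp
  finally have eq: "(\<Sum>t<k. \<rho> U $$ (p,t) * \<delta> t q) = \<rho> U $$ (p,q)" .
  have "\<rho> (U * W) $$ (p,q) - \<delta> p q = (\<rho> U $$ (p,q) - \<delta> p q) + (\<Sum>t<k. \<rho> U $$ (p,t) * (\<rho> W $$ (t,q) - \<delta> t q))"
    unfolding rep_mult_index[OF UW pq] right_diff_distrib sum_subtractf eq by simp
  also have "cmod \<dots> \<le> e + (\<Sum>t<k. e')"
  proof (intro norm_triangle_le add_mono near pq order_trans[OF norm_sum] sum_mono)
    fix t assume "t \<in> {..<k}"
    then have t: "t < k" by simp
    show "cmod (\<rho> U $$ (p,t) * (\<rho> W $$ (t,q) - \<delta> t q)) \<le> e'"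
      unfolding norm_mult using mult_mono[OF rep_norm_le[OF UW(1) pq(1) t] near(2)[OF t pq(2)]] by simp
  qed
  finally show ?thesis by simp
qed

lemma rep_conj_index:
  assumes w: "w \<in> SU d" "w' \<in> SU d" "w * w' = 1\<^sub>m d" and G: "G \<in> SU d" and pq: "p < k" "q < k"
  shows "\<rho> (w * G * w') $$ (p,q) = (\<Sum>v<k. \<Sum>s<k. \<rho> w $$ (p,s) * \<rho> G $$ (s,v) * cnj (\<rho> w $$ (q,v)))"
  unfolding rep_mult_index[OF SU_mult[OF w(1) G] w(2) pq]
proof (rule sum.cong[OF refl])
  fix v assume "v \<in> {..<k}"
  then have v: "v < k" by simp
  show "\<rho> (w * G) $$ (p,v) * \<rho> w' $$ (v,q) = (\<Sum>s<k. \<rho> w $$ (p,s) * \<rho> G $$ (s,v) * cnj (\<rho> w $$ (q,v)))"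
    unfolding rep_mult_index[OF w(1) G pq(1) v] rep_inverse_index[OF w v pq(2)] sum_distrib_right ..
qed

text \<open>Entries of a unitary matrix are bounded by 1, so conjugation enlarges the entrywise
  distance from the identity by at most the number of index pairs. So crude a factor is harmless
  where any Lipschitz constant will do.\<close>

lemma rep_conj_near:
  assumes w: "w \<in> SU d" "w' \<in> SU d" "w * w' = 1\<^sub>m d" and G: "G \<in> SU d"
    and near: "\<And>p q. p < k \<Longrightarrow> q < k \<Longrightarrow> cmod (\<rho> G $$ (p,q) - \<delta> p q) \<le> e"
    and pq: "p < k" "q < k"
  shows "cmod (\<rho> (w * G * w') $$ (p,q) - \<delta> p q) \<le> real k * (real k * e)"
proof -
  have "\<rho> (w * 1\<^sub>m d * w') $$ (p,q) = \<delta> p q"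
  proof -
    have "w \<in> carrier_mat d d" using w(1) by (simp add: SU_def unitary_mat_def)
    then have "w * 1\<^sub>m d * w' = 1\<^sub>m d" using w(3) by simp
    then show ?thesis using rep_one pq by simp
  qed
  then have one: "\<delta> p q = (\<Sum>v<k. \<Sum>s<k. \<rho> w $$ (p,s) * \<delta> s v * cnj (\<rho> w $$ (q,v)))"
    unfolding rep_conj_index[OF w one_SU pq] rep_one by (auto intro!: sum.cong)
  have "\<rho> (w * G * w') $$ (p,q) - \<delta> p q
      = (\<Sum>v<k. \<Sum>s<k. \<rho> w $$ (p,s) * (\<rho> G $$ (s,v) - \<delta> s v) * cnj (\<rho> w $$ (q,v)))"
    unfolding rep_conj_index[OF w G pq] by (subst one) (simp only: sum_subtractf left_diff_distrib right_diff_distrib)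
  also have "cmod \<dots> \<le> (\<Sum>v<k. \<Sum>s<k. e)"
  proof (intro order_trans[OF norm_sum] sum_mono)
    fix v s assume "v \<in> {..<k}" "s \<in> {..<k}"
    then have vs: "v < k" "s < k" by auto
    have "cmod (\<rho> w $$ (p,s)) * cmod (\<rho> G $$ (s,v) - \<delta> s v) \<le> 1 * e"
      by (intro mult_mono rep_norm_le w pq vs near) auto
    from mult_mono[OF this rep_norm_le[OF w(1) pq(2) vs(1)]] order_trans[OF norm_ge_zero near[OF vs(2,1)]]
    have "cmod (\<rho> w $$ (p,s)) * cmod (\<rho> G $$ (s,v) - \<delta> s v) * cmod (\<rho> w $$ (q,v)) \<le> e" by simp
    then show "cmod (\<rho> w $$ (p,s) * (\<rho> G $$ (s,v) - \<delta> s v) * cnj (\<rho> w $$ (q,v))) \<le> e"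
      unfolding norm_mult complex_mod_cnj .
  qed
  finally show ?thesis by simp
qed

lemma rep_conj_deriv:
  assumes w: "w \<in> SU d" "w' \<in> SU d" "w * w' = 1\<^sub>m d" and G: "\<And>t :: real. G t \<in> SU d"
    and der: "\<And>p q. p < k \<Longrightarrow> q < k \<Longrightarrow> ((\<lambda>t. \<rho> (G t) $$ (p,q)) has_vector_derivative \<i> * Y p q) (at 0)"
    and pq: "p < k" "q < k"
  shows "((\<lambda>t. \<rho> (w * G t * w') $$ (p,q)) has_vector_derivative
     \<i> * (\<Sum>v<k. \<Sum>s<k. \<rho> w $$ (p,s) * Y s v * cnj (\<rho> w $$ (q,v)))) (at 0)"
proof -
  have "((\<lambda>t. \<Sum>v<k. \<Sum>s<k. \<rho> w $$ (p,s) * \<rho> (G t) $$ (s,v) * cnj (\<rho> w $$ (q,v))) has_vector_derivative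
     (\<Sum>v<k. \<Sum>s<k. \<rho> w $$ (p,s) * (\<i> * Y s v) * cnj (\<rho> w $$ (q,v)))) (at 0)"
    by (intro has_vector_derivative_sum has_vector_derivative_mult_left has_vector_derivative_mult_right der) auto
  then show ?thesis unfolding rep_conj_index[OF w G pq]
    by (simp add: sum_distrib_left mult_ac)
qed

end

text \<open>\<open>m p i j\<close> is the pairing of the weight of the \<open>p\<close>-th basis
  vector with the coroot of the ordered pair (i, j). Relations between different pairs are derived
  later from multiplicativity.\<close>

locale diag_rep = unitary_rep +
  fixes m :: "nat \<Rightarrow> nat \<Rightarrow> nat \<Rightarrow> int"
  assumes torus: "\<And>i j t. i < d \<Longrightarrow> j < d \<Longrightarrow> i \<noteq> j \<Longrightarrow>
      \<rho> (emb d i j (cis t) 0) = tor k (\<lambda>p. cis (of_int (m p i j) * t))"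

section \<open>Lipschitz control on one embedded SU(2)\<close>

locale su2_rep = diag_rep +
  fixes i j :: nat
  assumes ij: "i < d" "j < d" "i \<noteq> j"
begin

abbreviation "g \<equiv> emb d i j"

lemma g_SU: "a * cnj a + b * cnj b = 1 \<Longrightarrow> g a b \<in> SU d"
  using emb_SU ij by blast

lemma g_mult: "g a b * g a' b' = g (a * a' - cnj b * b') (b * a' + cnj a * b')"
  using emb_mult ij by blast

lemma g_one: "g 1 0 = 1\<^sub>m d"
  using emb_one ij by blast

lemma g_inverse: "a * cnj a + b * cnj b = 1 \<Longrightarrow> g a b * g (cnj a) (- b) = 1\<^sub>m d"
  unfolding g_mult g_one[symmetric] by (simp add: mult.commute)

lemma g_adj_SU: "a * cnj a + b * cnj b = 1 \<Longrightarrow> g (cnj a) (- b) \<in> SU d"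
  by (rule g_SU) (simp add: mult.commute)

lemma g_conj: "g a b * g c e * g (cnj a) (- b)
   = g ((a * c - cnj b * e) * cnj a + cnj (b * c + cnj a * e) * b)
       ((b * c + cnj a * e) * cnj a - cnj (a * c - cnj b * e) * b)"
  unfolding g_mult by simp

definition C0 :: real where "C0 = (\<Sum>p<k. \<bar>of_int (m p i j)\<bar>)"

lemma C0_nonneg: "C0 \<ge> 0"
  unfolding C0_def by (simp add: sum_nonneg)

lemma torus_near:
  assumes z: "z * cnj z = 1" and pq: "p < k" "q < k"
  shows "cmod (\<rho> (g z 0) $$ (p,q) - \<delta> p q) \<le> C0 * cmod (z - 1)"
proof -
  have "complex_of_real ((cmod z)\<^sup>2) = 1" unfolding complex_norm_square by (rule z)
  then have "(cmod z)\<^sup>2 = 1" using of_real_eq_1_iff by blast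
  then have cz: "cmod z = 1" using abs_square_eq_1[of "cmod z"] by simp
  moreover have "z \<noteq> 0" using cz by auto
  ultimately have "cis (Arg z) = z" by (simp add: cis_Arg sgn_eq)
  then obtain t where t: "z = cis t" by metis
  show ?thesis
  proof (cases "p = q")
    case True
    have "\<bar>of_int (m p i j)\<bar> \<le> C0" unfolding C0_def using pq by (intro member_le_sum) auto
    then have "\<bar>of_int (m p i j)\<bar> * cmod (cis t - 1) \<le> C0 * cmod (cis t - 1)" by (intro mult_right_mono) auto
    then show ?thesis unfolding t torus[OF ij] tor_index[OF pq]
      using True norm_cis_int_minus_one[of "m p i j" t] by simp
  next
    case False
    then show ?thesis unfolding t torus[OF ij] tor_index[OF pq] using C0_nonneg by simp
  qed
qed

text \<open>Chosen so that \<open>g \<kappa> \<kappa>\<close> lies in SU(2) and permutes its three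
  coordinate axes cyclically under conjugation. Multiplying its two entries by u and cnj u rotates
  the image of the diagonal torus about the diagonal axis.\<close>

definition \<kappa> :: complex where "\<kappa> = (1 + \<i>) / 2"

lemma kappa: "\<kappa> * cnj \<kappa> = 1 / 2" "\<kappa> * \<kappa> = \<i> / 2" "cnj \<kappa> * cnj \<kappa> = - \<i> / 2"
  unfolding \<kappa>_def by (simp_all add: complex_eq_iff)

lemma kappa_unit: "\<kappa> * cnj \<kappa> + \<kappa> * cnj \<kappa> = 1"
  unfolding kappa by simp

lemma conj_kappa_torus:
  assumes u: "u * cnj u = 1"
  shows "g (u * \<kappa>) (cnj u * \<kappa>) * g (cis t) 0 * g (cnj (u * \<kappa>)) (- (cnj u * \<kappa>))
    = g (of_real (cos t)) (\<i> * (cnj u)\<^sup>2 * of_real (sin t))"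
proof -
  have c: "cis t = of_real (cos t) + \<i> * of_real (sin t)" by (simp add: complex_eq_iff)
  have a: "(u * \<kappa> * cis t) * cnj (u * \<kappa>) + cnj (cnj u * \<kappa> * cis t) * (cnj u * \<kappa>) = of_real (cos t)"
  proof -
    have "(u * \<kappa> * cis t) * cnj (u * \<kappa>) + cnj (cnj u * \<kappa> * cis t) * (cnj u * \<kappa>)
      = (u * cnj u) * (\<kappa> * cnj \<kappa>) * (cis t + cnj (cis t))" by (simp add: algebra_simps)
    then show ?thesis unfolding u kappa c by simp
  qed
  have b: "(cnj u * \<kappa> * cis t) * cnj (u * \<kappa>) - cnj (u * \<kappa> * cis t) * (cnj u * \<kappa>) = \<i> * (cnj u)\<^sup>2 * of_real (sin t)"
  proof -
    have "(cnj u * \<kappa> * cis t) * cnj (u * \<kappa>) - cnj (u * \<kappa> * cis t) * (cnj u * \<kappa>)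
      = (cnj u)\<^sup>2 * (\<kappa> * cnj \<kappa>) * (cis t - cnj (cis t))" by (simp add: algebra_simps power2_eq_square)
    then show ?thesis unfolding kappa c by simp
  qed
  show ?thesis unfolding g_conj using a b by simp
qed

lemma kappa_conj_unit:
  assumes "u * cnj u = 1"
  shows "(u * \<kappa>) * cnj (u * \<kappa>) + (cnj u * \<kappa>) * cnj (cnj u * \<kappa>) = 1"
proof -
  have "(u * \<kappa>) * cnj (u * \<kappa>) + (cnj u * \<kappa>) * cnj (cnj u * \<kappa>) = 2 * (u * cnj u) * (\<kappa> * cnj \<kappa>)"
    by (simp add: algebra_simps)
  then show ?thesis unfolding assms kappa by simp
qed

lemma conj_kappa_SU:
  assumes "u * cnj u = 1"
  shows "g (u * \<kappa>) (cnj u * \<kappa>) \<in> SU d" "g (cnj (u * \<kappa>)) (- (cnj u * \<kappa>)) \<in> SU d"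
    "g (u * \<kappa>) (cnj u * \<kappa>) * g (cnj (u * \<kappa>)) (- (cnj u * \<kappa>)) = 1\<^sub>m d"
  by (rule g_SU g_adj_SU g_inverse, rule kappa_conj_unit[OF assms])+

lemma rotation_near:
  assumes "c\<^sup>2 + s\<^sup>2 = (1 :: real)" and pq: "p < k" "q < k"
  shows "cmod (\<rho> (g (of_real c) (of_real s)) $$ (p,q) - \<delta> p q) \<le> real k * (real k * (C0 * (\<bar>c - 1\<bar> + \<bar>s\<bar>)))"
proof -
  obtain t where t: "c = cos t" "s = sin t" using assms(1) sincos_total_2pi_le[of c s] by auto
  \<comment> \<open>With this phase the square of \<open>cnj u\<close> is - i, which cancels the
    factor i in \<open>conj_kappa_torus\<close> and leaves a real rotation.\<close>
  define u where "u = cis (pi / 4)"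
  have u: "u * cnj u = 1" by (simp add: u_def cis_cnj cis_mult)
  have u2: "(cnj u)\<^sup>2 = - \<i>" by (simp add: u_def cis_cnj power2_eq_square cis_mult complex_eq_iff)
  have eq: "g (of_real c) (of_real s) = g (u * \<kappa>) (cnj u * \<kappa>) * g (cis t) 0 * g (cnj (u * \<kappa>)) (- (cnj u * \<kappa>))"
    unfolding conj_kappa_torus[OF u] u2 t by simp
  note w = conj_kappa_SU[OF u]
  have z: "cis t * cnj (cis t) = 1" by (simp add: cis_cnj cis_mult)
  have G: "g (cis t) 0 \<in> SU d" by (rule g_SU) (use z in simp)
  have "cmod (cis t - 1) \<le> \<bar>c - 1\<bar> + \<bar>s\<bar>" using cmod_le[of "cis t - 1"] t by simp
  then have "C0 * cmod (cis t - 1) \<le> C0 * (\<bar>c - 1\<bar> + \<bar>s\<bar>)" using C0_nonneg by (rule mult_left_mono)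
  then have near: "cmod (\<rho> (g (cis t) 0) $$ (p,q) - \<delta> p q) \<le> C0 * (\<bar>c - 1\<bar> + \<bar>s\<bar>)" if "p < k" "q < k" for p q
    using torus_near[OF z that] by linarith
  show ?thesis unfolding eq by (rule rep_conj_near[OF w G near pq])
qed

text \<open>Polar decomposition of the two entries: up to conjugation by the torus, an element of SU(2)
  is the product of a torus element and a real rotation.\<close>

lemma rep_lipschitz:
  obtains C where "\<And>a b p q. a * cnj a + b * cnj b = 1 \<Longrightarrow> p < k \<Longrightarrow> q < k \<Longrightarrow>
    cmod (\<rho> (g a b) $$ (p,q) - \<delta> p q) \<le> C * (cmod (a - 1) + cmod b)"
proof
  fix a b p q assume ab: "a * cnj a + b * cnj b = 1" and pq: "p < k" "q < k"
  \<comment> \<open>Phases of the two entries; the value 1 replaces the missing phase of zero and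
    still has modulus one.\<close>
  define z where "z = (if a = 0 then 1 else sgn a)"
  define y where "y = (if b = 0 then 1 else sgn b)"
  \<comment> \<open>Conjugation by \<open>g (cnj u) 0\<close> multiplies the lower left entry by u^2
    = z y. Left multiplication by \<open>g z 0\<close> then cancels z there and attaches it to the
    upper left entry.\<close>
  define u where "u = csqrt (z * y)"
  have sgn1: "sgn x * cnj (sgn x) = 1" if "x \<noteq> 0" for x :: complex
    using that by (simp add: norm_sgn flip: complex_norm_square)
  have sgn2: "x = of_real (cmod x) * sgn x" for x :: complex by (simp add: sgn_eq)
  have z: "z * cnj z = 1" "a = of_real (cmod a) * z"
    unfolding z_def using sgn1[of a] sgn2[of a] by (cases "a = 0"; simp only: if_True if_False; simp)+
  have y: "y * cnj y = 1" "b = of_real (cmod b) * y"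
    unfolding y_def using sgn1[of b] sgn2[of b] by (cases "b = 0"; simp only: if_True if_False; simp)+
  have u2: "u * u = z * y" unfolding u_def by (metis power2_csqrt power2_eq_square)
  have "(u * cnj u) * (u * cnj u) = (u * u) * cnj (u * u)" by simp
  also have "\<dots> = (z * cnj z) * (y * cnj y)" unfolding u2 by simp
  also have "\<dots> = 1" using z y by simp
  finally have "(u * cnj u)\<^sup>2 = 1" by (simp add: power2_eq_square)
  then have "u * cnj u = 1 \<or> u * cnj u = - 1" by (rule power2_eq_1_iff[THEN iffD1])
  moreover have "u * cnj u \<noteq> - 1"
    unfolding complex_mult_cnj by (metis Re_complex_of_real minus_complex.simps(1) one_complex.simps(1) uminus_complex.simps(1) sum_power2_ge_zero neg_0_le_iff_le not_one_le_zero)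
  ultimately have u: "u * cnj u = 1" by blast
  define R where "R = g (of_real (cmod a)) (of_real (cmod b))"
  have ab1: "(cmod a)\<^sup>2 + (cmod b)\<^sup>2 = 1"
  proof -
    have "complex_of_real ((cmod a)\<^sup>2 + (cmod b)\<^sup>2) = 1"
      unfolding of_real_add complex_norm_square by (rule ab)
    then show ?thesis using of_real_eq_1_iff by blast
  qed
  have R_SU: "R \<in> SU d" unfolding R_def by (rule g_SU) (use ab1 in \<open>simp flip: of_real_mult of_real_add add: power2_eq_square\<close>)
  have w: "g (cnj u) 0 \<in> SU d" "g (cnj (cnj u)) (- 0) \<in> SU d" "g (cnj u) 0 * g (cnj (cnj u)) (- 0) = 1\<^sub>m d"
    by (rule g_SU g_adj_SU g_inverse, use u in \<open>simp add: mult.commute\<close>)+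
  define W where "W = g (cnj u) 0 * R * g (cnj (cnj u)) (- 0)"
  have W: "W = g (of_real (cmod a)) (of_real (cmod b) * (u * u))"
    unfolding W_def R_def g_conj using u by (simp add: mult_ac) (simp add: mult.assoc[symmetric])
  have W_SU: "W \<in> SU d" unfolding W_def by (intro SU_mult w R_SU)
  have Z_SU: "g z 0 \<in> SU d" by (rule g_SU) (use z in simp)
  have eq: "g a b = g z 0 * W"
  proof -
    have "cnj z * (of_real (cmod b) * (u * u)) = (z * cnj z) * (of_real (cmod b) * y)" unfolding u2 by (simp add: mult_ac)
    then have "cnj z * (of_real (cmod b) * (u * u)) = b" using z(1) y(2) by simp
    then show ?thesis unfolding W g_mult using z(2) by (simp add: mult.commute)
  qed
  have abs_a: "\<bar>cmod a - 1\<bar> \<le> cmod (a - 1)" using norm_triangle_ineq3[of a 1] by simp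
  \<comment> \<open>The radial projection of \<open>a\<close> to the circle moves it by at most its
    distance from 1, hence the factor 2.\<close>
  have z1: "cmod (z - 1) \<le> 2 * cmod (a - 1)"
  proof (cases "a = 0")
    case False
    have "z - a = (1 - of_real (cmod a)) * z" using z(2) by (simp add: algebra_simps)
    then have "cmod (z - a) = cmod (1 - of_real (cmod a)) * cmod z" by (simp add: norm_mult)
    also have "cmod z = 1" using False by (simp add: z_def norm_sgn)
    also have "cmod (1 - of_real (cmod a)) = \<bar>1 - cmod a\<bar>" by (metis norm_of_real of_real_1 of_real_diff)
    finally have "cmod (z - a) \<le> cmod (a - 1)" using abs_a by simp
    then show ?thesis using norm_triangle_ineq[of "z - a" "a - 1"] by simp
  qed (simp add: z_def)
  let ?E = "real k * (real k * (C0 * (cmod (a - 1) + cmod b)))"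
  have near_R: "cmod (\<rho> R $$ (p,q) - \<delta> p q) \<le> real k * (real k * (C0 * (cmod (a - 1) + cmod b)))" if "p < k" "q < k" for p q
    unfolding R_def
    by (rule order_trans[OF rotation_near[OF ab1 that]])
      (use abs_a C0_nonneg in \<open>intro mult_left_mono add_mono, auto\<close>)
  have near_W: "cmod (\<rho> W $$ (p,q) - \<delta> p q) \<le> real k * (real k * ?E)" if "p < k" "q < k" for p q
    unfolding W_def by (rule rep_conj_near[OF w R_SU near_R that])
  have near_Z: "cmod (\<rho> (g z 0) $$ (p,q) - \<delta> p q) \<le> C0 * (2 * (cmod (a - 1) + cmod b))" if "p < k" "q < k" for p q
  proof -
    have "cmod (z - 1) \<le> 2 * (cmod (a - 1) + cmod b)" by (rule order_trans[OF z1 mult_left_mono]) simp_all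
    from order_trans[OF torus_near[OF z(1) that] mult_left_mono[OF this C0_nonneg]] show ?thesis .
  qed
  have "cmod (\<rho> (g a b) $$ (p,q) - \<delta> p q) \<le> C0 * (2 * (cmod (a - 1) + cmod b)) + real k * (real k * (real k * ?E))"
    unfolding eq by (rule rep_mult_near[OF Z_SU W_SU near_Z near_W pq])
  also have "\<dots> = (C0 * 2 + real k * real k * real k * real k * real k * C0) * (cmod (a - 1) + cmod b)"
    by (simp add: algebra_simps)
  finally show "cmod (\<rho> (g a b) $$ (p,q) - \<delta> p q) \<le> (C0 * 2 + real k * real k * real k * real k * real k * C0) * (cmod (a - 1) + cmod b)" .
qed

text \<open>The substitute for smoothness of the representation: a curve in the embedded SU(2) that
  is stationary to first order at the identity stays so in the representation.\<close>

lemma rep_tangent_zero: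
  assumes unit: "\<And>t. a t * cnj (a t) + b t * cnj (b t) = 1" and 0: "a 0 = 1" "b 0 = 0"
    and der: "(a has_vector_derivative 0) (at 0)" "(b has_vector_derivative 0) (at 0)" and pq: "p < k" "q < k"
  shows "((\<lambda>t :: real. \<rho> (g (a t) (b t)) $$ (p,q)) has_vector_derivative 0) (at 0)"
proof -
  obtain C where C: "\<And>a b p q. a * cnj a + b * cnj b = 1 \<Longrightarrow> p < k \<Longrightarrow> q < k \<Longrightarrow>
    cmod (\<rho> (g a b) $$ (p,q) - \<delta> p q) \<le> C * (cmod (a - 1) + cmod b)" using rep_lipschitz by blast
  have one: "\<rho> (g (a 0) (b 0)) $$ (p,q) = \<delta> p q" unfolding 0 g_one rep_one using pq by simp
  have "cmod (\<rho> (g (a t) (b t)) $$ (p,q) - \<rho> (g (a 0) (b 0)) $$ (p,q)) \<le> C * (cmod (a t - a 0) + cmod (b t - b 0))" for t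
    unfolding one using C[OF unit pq, of t] by (simp add: 0)
  then show ?thesis by (rule has_vector_derivative_zero_bound[OF der])
qed

end

section \<open>Ladder operators and the closure properties of the weights\<close>

text \<open>At t = pi / (a - b) the two characters would differ by the factor - 1.\<close>

lemma cis_int_eqD:
  assumes "\<And>t. cis (of_int a * t) = cis (of_int b * t)"
  shows "a = b"
proof (rule ccontr)
  assume "a \<noteq> b"
  then have "real_of_int a - of_int b \<noteq> 0" by simp
  then have e: "(of_int a - of_int b) * (pi / (real_of_int a - of_int b)) = pi" by simp
  have "cis (of_int a * (pi / (of_int a - of_int b))) / cis (of_int b * (pi / (of_int a - of_int b))) = 1"
    unfolding assms by simp
  then have "cis ((of_int a - of_int b) * (pi / (real_of_int a - of_int b))) = 1"
    unfolding cis_divide by (simp add: left_diff_distrib diff_divide_distrib)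
  then show False unfolding e by (simp add: complex_eq_iff)
qed

text \<open>The coroot of the ordered pair as a function of the coordinate; by
  \<open>torf_cis\<close> it gives the exponents of the torus entries.\<close>

definition root_pairing :: "nat \<Rightarrow> nat \<Rightarrow> nat \<Rightarrow> int" where
  "root_pairing u v x = of_bool (x = u) - of_bool (x = v)"

lemma torf_cis: "u \<noteq> v \<Longrightarrow> torf u v (cis s) x = cis (of_int (root_pairing u v x) * s)"
  by (simp add: torf_def root_pairing_def cis_cnj)

lemma unit_mult:
  fixes a b a' b' :: complex
  assumes "a * cnj a + b * cnj b = 1" "a' * cnj a' + b' * cnj b' = 1"
  shows "(a * a' - cnj b * b') * cnj (a * a' - cnj b * b') + (b * a' + cnj a * b') * cnj (b * a' + cnj a * b') = 1"
proof -
  have "(a * a' - cnj b * b') * cnj (a * a' - cnj b * b') + (b * a' + cnj a * b') * cnj (b * a' + cnj a * b')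
    = (a * cnj a + b * cnj b) * (a' * cnj a' + b' * cnj b')" by (simp add: algebra_simps)
  then show ?thesis unfolding assms by simp
qed

lemma has_vector_derivative_cos_zero:
  "((\<lambda>t. complex_of_real (cos (t * r))) has_vector_derivative 0) (at 0)"
proof -
  have "((\<lambda>t. cos (of_real t * complex_of_real r)) has_vector_derivative 0) (at 0)"
    by (rule has_vector_derivative_real_field) (auto intro!: derivative_eq_intros)
  then show ?thesis by (simp flip: of_real_mult cos_of_real)
qed

lemma has_vector_derivative_sin_zero:
  "((\<lambda>t. complex_of_real (sin (t * r))) has_vector_derivative of_real r) (at 0)"
proof -
  have "((\<lambda>t. sin (of_real t * complex_of_real r)) has_vector_derivative of_real r) (at 0)"
    by (rule has_vector_derivative_real_field) (auto intro!: derivative_eq_intros)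
  then show ?thesis by (simp flip: of_real_mult sin_of_real)
qed

section \<open>Generators along the three axes, their commutators and the ladder operator\<close>

context su2_rep
begin

text \<open>The adjoint action of \<open>w\<close> on a matrix given by its entries, the form in
  which derivatives of representation entries arrive.\<close>

definition conjugated :: "complex mat \<Rightarrow> (nat \<Rightarrow> nat \<Rightarrow> complex) \<Rightarrow> nat \<Rightarrow> nat \<Rightarrow> complex" where
  "conjugated w Y p q = (\<Sum>v<k. \<Sum>s<k. \<rho> w $$ (p,s) * Y s v * cnj (\<rho> w $$ (q,v)))"

definition H :: "nat \<Rightarrow> nat \<Rightarrow> complex" where
  "H s v = (if s = v then of_int (m s i j) else 0)"

text \<open>In the defining representation of SU(2) this is cos \<alpha> times the first Pauli
  matrix minus sin \<alpha> times the second. Defined as a conjugate of \<open>H\<close>, it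
  inherits its role as a derivative from the torus.\<close>

definition X :: "real \<Rightarrow> nat \<Rightarrow> nat \<Rightarrow> complex" where
  "X \<alpha> = conjugated (g (cis (\<alpha>/2) * \<kappa>) (cnj (cis (\<alpha>/2)) * \<kappa>)) H"

lemma cis_unit: "cis t * cnj (cis t) = 1"
  by (simp add: cis_cnj cis_mult)

lemma gt_SU: "g (cis t) 0 \<in> SU d"
  by (rule g_SU) (simp add: cis_unit)

lemma gx_unit: "of_real (cos t) * cnj (of_real (cos t)) + (\<i> * cis \<beta> * of_real (sin t)) * cnj (\<i> * cis \<beta> * of_real (sin t)) = 1"
proof -
  have "of_real (cos t) * cnj (of_real (cos t)) + (\<i> * cis \<beta> * of_real (sin t)) * cnj (\<i> * cis \<beta> * of_real (sin t))
    = of_real (cos t * cos t) + of_real (sin t * sin t) * (cis \<beta> * cnj (cis \<beta>))" by (simp add: mult_ac)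
  also have "\<dots> = of_real (cos t * cos t + sin t * sin t)" unfolding cis_unit by (simp only: mult_1_right of_real_add)
  also have "cos t * cos t + sin t * sin t = 1" using sin_cos_squared_add2[of t] by (simp add: power2_eq_square)
  finally show ?thesis by (simp only: of_real_1)
qed

lemma H_deriv:
  assumes "p < k" "q < k"
  shows "((\<lambda>t. \<rho> (g (cis t) 0) $$ (p,q)) has_vector_derivative \<i> * H p q) (at 0)"
  unfolding torus[OF ij] tor_index[OF assms] H_def
  using has_vector_derivative_cis[of "of_int (m p i j)" 0] by (cases "p = q") simp_all

lemma X_deriv:
  assumes pq: "p < k" "q < k"
  shows "((\<lambda>t. \<rho> (g (of_real (cos t)) (\<i> * cis (- \<alpha>) * of_real (sin t))) $$ (p,q)) has_vector_derivative \<i> * X \<alpha> p q) (at 0)"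
proof -
  define u where "u = cis (\<alpha>/2)"
  have u: "u * cnj u = 1" unfolding u_def by (rule cis_unit)
  have u2: "(cnj u)\<^sup>2 = cis (- \<alpha>)" by (simp add: u_def cis_cnj power2_eq_square cis_mult)
  note w = conj_kappa_SU[OF u]
  show ?thesis
    using rep_conj_deriv[OF w gt_SU H_deriv pq]
    unfolding conj_kappa_torus[OF u] u2 X_def conjugated_def u_def[symmetric] .
qed

lemma X_hermitian: "cnj (X \<alpha> p q) = X \<alpha> q p"
proof -
  have h: "cnj (H s v) = H v s" for s v by (simp add: H_def)
  show ?thesis unfolding X_def conjugated_def cnj_sum
    by (subst sum.swap) (simp add: h mult_ac)
qed

lemma rep_prod_deriv:
  assumes G: "\<And>t :: real. G1 t \<in> SU d" "\<And>t. G2 t \<in> SU d" and 0: "G1 0 = 1\<^sub>m d" "G2 0 = 1\<^sub>m d"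
    and der: "\<And>p q. p < k \<Longrightarrow> q < k \<Longrightarrow> ((\<lambda>t. \<rho> (G1 t) $$ (p,q)) has_vector_derivative Y1 p q) (at 0)"
      "\<And>p q. p < k \<Longrightarrow> q < k \<Longrightarrow> ((\<lambda>t. \<rho> (G2 t) $$ (p,q)) has_vector_derivative Y2 p q) (at 0)"
    and pq: "p < k" "q < k"
  shows "((\<lambda>t. \<rho> (G1 t * G2 t) $$ (p,q)) has_vector_derivative Y1 p q + Y2 p q) (at 0)"
proof -
  have "((\<lambda>t. \<Sum>s<k. \<rho> (G1 t) $$ (p,s) * \<rho> (G2 t) $$ (s,q)) has_vector_derivative
      (\<Sum>s<k. \<rho> (G1 0) $$ (p,s) * Y2 s q + Y1 p s * \<rho> (G2 0) $$ (s,q))) (at 0)"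
    using der pq by (intro has_vector_derivative_sum_zero_point) auto
  moreover have "(\<Sum>s<k. \<rho> (G1 0) $$ (p,s) * Y2 s q + Y1 p s * \<rho> (G2 0) $$ (s,q))
      = (\<Sum>s<k. (if s = p then Y2 p q else 0) + (if s = q then Y1 p q else 0))"
    unfolding 0 rep_one using pq by (intro sum.cong) auto
  moreover have "\<dots> = Y1 p q + Y2 p q" unfolding sum.distrib using pq by simp
  ultimately show ?thesis unfolding rep_mult_index[OF G pq] by simp
qed

text \<open>Linearity of the derived action in the plane of two axes. The curve at angle \<alpha> is
  the product of the curves along the axes, run at speeds cos \<alpha> and sin \<alpha>, and a
  correction \<open>E\<close> with zero tangent, which contributes nothing by
  \<open>rep_tangent_zero\<close>.\<close>

lemma X_cos_sin:
  assumes pq: "p < k" "q < k"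
  shows "X \<alpha> p q = of_real (cos \<alpha>) * X 0 p q + of_real (sin \<alpha>) * X (pi/2) p q"
proof -
  define C where "C r t = complex_of_real (cos (t * r))" for r t
  define S where "S r t = complex_of_real (sin (t * r))" for r t
  let ?c = "cos \<alpha>" and ?s = "sin \<alpha>"
  define b where "b t = \<i> * cis (- \<alpha>) * S 1 t" for t
  define A where "A t = g (C ?c t) (\<i> * S ?c t)" for t
  define B where "B t = g (C ?s t) (S ?s t)" for t
  define G where "G t = g (C 1 t) (b t)" for t
  \<comment> \<open>\<open>a1\<close> and \<open>b1\<close> are the entries of the inverse of
    \<open>A\<close> times \<open>G\<close>; \<open>e1\<close> and \<open>e2\<close> are those of
    the inverse of \<open>B\<close> times that product.\<close>
  define a1 where "a1 t = C ?c t * C 1 t - \<i> * S ?c t * b t" for t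
  define b1 where "b1 t = - (\<i> * S ?c t) * C 1 t + C ?c t * b t" for t
  define e1 where "e1 t = C ?s t * a1 t + S ?s t * b1 t" for t
  define e2 where "e2 t = - S ?s t * a1 t + C ?s t * b1 t" for t
  define E where "E t = g (e1 t) (e2 t)" for t
  have CS: "C r t * C r t + S r t * S r t = 1" for r t
    unfolding C_def S_def of_real_mult[symmetric] of_real_add[symmetric]
    using sin_cos_squared_add2[of "t * r"] by (simp add: power2_eq_square)
  have cnjC: "cnj (C r t) = C r t" "cnj (S r t) = S r t" for r t by (auto simp: C_def S_def)
  have ii: "\<i> * z * (\<i> * z) = - (z * z)" for z :: complex by (simp add: algebra_simps)
  have uA: "C ?c t * cnj (C ?c t) + (\<i> * S ?c t) * cnj (\<i> * S ?c t) = 1" for t using CS[of ?c t] by (simp add: cnjC ii)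
  have uA': "C ?c t * cnj (C ?c t) + (- (\<i> * S ?c t)) * cnj (- (\<i> * S ?c t)) = 1" for t using CS[of ?c t] by (simp add: cnjC ii)
  have uB: "C ?s t * cnj (C ?s t) + S ?s t * cnj (S ?s t) = 1" for t using CS[of ?s t] by (simp add: cnjC)
  have uB': "C ?s t * cnj (C ?s t) + (- S ?s t) * cnj (- S ?s t) = 1" for t using CS[of ?s t] by (simp add: cnjC)
  have uG: "C 1 t * cnj (C 1 t) + b t * cnj (b t) = 1" for t
    using gx_unit[of t "- \<alpha>"] unfolding C_def S_def b_def by simp
  have eq1: "g (C ?c t) (- (\<i> * S ?c t)) * G t = g (a1 t) (b1 t)" for t
    unfolding G_def g_mult a1_def b1_def by (simp add: cnjC)
  have u1: "a1 t * cnj (a1 t) + b1 t * cnj (b1 t) = 1" for t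
    using unit_mult[OF uA' uG, of t t] unfolding a1_def b1_def by (simp add: cnjC)
  have eq2: "g (C ?s t) (- S ?s t) * g (a1 t) (b1 t) = E t" for t
    unfolding E_def g_mult e1_def e2_def by (simp add: cnjC)
  have uE: "e1 t * cnj (e1 t) + e2 t * cnj (e2 t) = 1" for t
    using unit_mult[OF uB' u1, of t t] unfolding e1_def e2_def by (simp add: cnjC)
  have SUs: "A t \<in> SU d" "B t \<in> SU d" "G t \<in> SU d" "E t \<in> SU d" for t
    unfolding A_def B_def G_def E_def by (rule g_SU; fact uA uB uG uE)+
  have BE: "B t * E t = g (a1 t) (b1 t)" for t
  proof -
    have "B t * E t = (B t * g (C ?s t) (- S ?s t)) * g (a1 t) (b1 t)"
      unfolding eq2[symmetric] B_def by (rule assoc_mult_mat[OF emb_carrier emb_carrier emb_carrier, symmetric])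
    also have "B t * g (C ?s t) (- S ?s t) = 1\<^sub>m d"
      using g_inverse[OF uB] unfolding B_def by (simp add: cnjC)
    finally show ?thesis by (simp only: left_mult_one_mat[OF emb_carrier])
  qed
  have ABE: "A t * (B t * E t) = G t" for t
  proof -
    have "A t * (B t * E t) = (A t * g (C ?c t) (- (\<i> * S ?c t))) * G t"
      unfolding BE eq1[symmetric] A_def G_def by (rule assoc_mult_mat[OF emb_carrier emb_carrier emb_carrier, symmetric])
    also have "A t * g (C ?c t) (- (\<i> * S ?c t)) = 1\<^sub>m d"
      using g_inverse[OF uA] unfolding A_def by (simp add: cnjC)
    finally show ?thesis unfolding G_def by (simp only: left_mult_one_mat[OF emb_carrier])
  qed
  have v0: "C r 0 = 1" "S r 0 = 0" "b 0 = 0" for r by (auto simp: C_def S_def b_def)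
  have w0: "a1 0 = 1" "b1 0 = 0" "e1 0 = 1" "e2 0 = 0" by (auto simp: a1_def b1_def e1_def e2_def v0)
  have ones: "A 0 = 1\<^sub>m d" "B 0 = 1\<^sub>m d" "E 0 = 1\<^sub>m d"
    unfolding A_def B_def E_def v0 w0 by (simp_all add: g_one)
  have dC: "(C r has_vector_derivative 0) (at 0)" for r
    unfolding C_def by (rule has_vector_derivative_cos_zero)
  have dS: "(S r has_vector_derivative of_real r) (at 0)" for r
    unfolding S_def by (rule has_vector_derivative_sin_zero)
  have db: "(b has_vector_derivative \<i> * cis (- \<alpha>)) (at 0)"
    unfolding b_def using has_vector_derivative_mult_right[OF dS[of 1], of "\<i> * cis (- \<alpha>)"] by simp
  have diS: "((\<lambda>t. \<i> * S r t) has_vector_derivative \<i> * of_real r) (at 0)" for r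
    by (rule has_vector_derivative_mult_right[OF dS])
  have da1: "(a1 has_vector_derivative 0) (at 0)"
    unfolding a1_def using has_vector_derivative_diff[OF has_vector_derivative_mult[OF dC[of ?c] dC[of 1]]
      has_vector_derivative_mult[OF diS[of ?c] db]] by (simp add: v0)
  have db1: "(b1 has_vector_derivative - (\<i> * of_real ?c) + \<i> * cis (- \<alpha>)) (at 0)"
    unfolding b1_def using has_vector_derivative_add[OF has_vector_derivative_mult[OF has_vector_derivative_minus[OF diS[of ?c]] dC[of 1]]
      has_vector_derivative_mult[OF dC[of ?c] db]] by (simp add: v0)
  have de1: "(e1 has_vector_derivative 0) (at 0)"
    unfolding e1_def using has_vector_derivative_add[OF has_vector_derivative_mult[OF dC[of ?s] da1]
      has_vector_derivative_mult[OF dS[of ?s] db1]] by (simp add: v0 w0)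
  \<comment> \<open>Here the choice of the two speeds makes the tangent of \<open>E\<close>
    vanish.\<close>
  have z: "- of_real ?s + (- (\<i> * of_real ?c) + \<i> * cis (- \<alpha>)) = 0" by (simp add: complex_eq_iff)
  have de2: "(e2 has_vector_derivative 0) (at 0)"
    unfolding e2_def using has_vector_derivative_add[OF has_vector_derivative_mult[OF has_vector_derivative_minus[OF dS[of ?s]] da1]
      has_vector_derivative_mult[OF dC[of ?s] db1]] z by (simp add: v0 w0)
  have dE: "((\<lambda>t. \<rho> (E t) $$ (p,q)) has_vector_derivative 0) (at 0)" if "p < k" "q < k" for p q
    unfolding E_def by (rule rep_tangent_zero[OF uE w0(3,4) de1 de2 that])
  have dscale: "((\<lambda>t. t * r) has_vector_derivative r) (at 0)" for r :: real
  proof -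
    have "((\<lambda>t. t * r) has_vector_derivative 1 * r) (at 0)"
      by (rule has_vector_derivative_mult_left[OF has_vector_derivative_id])
    then show ?thesis by simp
  qed
  have dA: "((\<lambda>t. \<rho> (A t) $$ (p,q)) has_vector_derivative ?c *\<^sub>R (\<i> * X 0 p q)) (at 0)" if "p < k" "q < k" for p q
    using vector_diff_chain_at[OF dscale, of "\<lambda>t. \<rho> (g (of_real (cos t)) (\<i> * cis (- 0) * of_real (sin t))) $$ (p,q)" "\<i> * X 0 p q" ?c]
      X_deriv[OF that, of 0] unfolding A_def C_def S_def o_def by simp
  have ic: "\<i> * cis (- (pi / 2)) = 1" by (simp add: complex_eq_iff)
  have dB: "((\<lambda>t. \<rho> (B t) $$ (p,q)) has_vector_derivative ?s *\<^sub>R (\<i> * X (pi/2) p q)) (at 0)" if "p < k" "q < k" for p q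
    using vector_diff_chain_at[OF dscale, of "\<lambda>t. \<rho> (g (of_real (cos t)) (\<i> * cis (- (pi/2)) * of_real (sin t))) $$ (p,q)" "\<i> * X (pi/2) p q" ?s]
      X_deriv[OF that, of "pi/2"] unfolding B_def C_def S_def o_def ic by simp
  have dBE: "((\<lambda>t. \<rho> (B t * E t) $$ (p,q)) has_vector_derivative ?s *\<^sub>R (\<i> * X (pi/2) p q) + 0) (at 0)" if "p < k" "q < k" for p q
    by (rule rep_prod_deriv[OF SUs(2,4) ones(2,3) dB dE that])
  have one: "B 0 * E 0 = 1\<^sub>m d" using ones by simp
  have "((\<lambda>t. \<rho> (A t * (B t * E t)) $$ (p,q)) has_vector_derivative ?c *\<^sub>R (\<i> * X 0 p q) + (?s *\<^sub>R (\<i> * X (pi/2) p q) + 0)) (at 0)"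
    by (rule rep_prod_deriv[OF SUs(1) SU_mult[OF SUs(2,4)] ones(1) one dA dBE pq])
  moreover have "((\<lambda>t. \<rho> (A t * (B t * E t)) $$ (p,q)) has_vector_derivative \<i> * X \<alpha> p q) (at 0)"
    unfolding ABE using X_deriv[OF pq, of \<alpha>] unfolding G_def C_def S_def b_def by simp
  ultimately have "?c *\<^sub>R (\<i> * X 0 p q) + (?s *\<^sub>R (\<i> * X (pi/2) p q) + 0) = \<i> * X \<alpha> p q"
    by (rule vector_derivative_unique_at)
  from this[symmetric] have "\<i> * X \<alpha> p q = \<i> * (of_real ?c * X 0 p q + of_real ?s * X (pi/2) p q)"
    by (simp add: scaleR_conv_of_real algebra_simps)
  then show ?thesis by simp
qed

text \<open>Conjugation by a torus element acts on the entry (p, q) through two weights and on the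
  curve itself through a root character. Both describe the derivative of the same curve, which ties
  weights to rotations of \<alpha>.\<close>

lemma X_torus_conj:
  assumes uv: "u < d" "v < d" "u \<noteq> v" and pq: "p < k" "q < k"
  shows "cis (of_int (m p u v - m q u v) * s) * X \<alpha> p q = X (\<alpha> + s * of_int (root_pairing u v i - root_pairing u v j)) p q"
proof -
  let ?N = "of_int (root_pairing u v i - root_pairing u v j) :: real"
  define T where "T = emb d u v (cis s) 0"
  define T' where "T' = emb d u v (cis (- s)) 0"
  define G where "G t = g (of_real (cos t)) (\<i> * cis (- \<alpha>) * of_real (sin t))" for t
  have G: "G t \<in> SU d" for t unfolding G_def by (rule g_SU[OF gx_unit])
  have T: "T \<in> SU d" "T' \<in> SU d" unfolding T_def T'_def by (intro emb_SU uv; simp add: cis_unit)+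
  have conj: "T * G t * T' = g (of_real (cos t)) (\<i> * cis (- (\<alpha> + s * ?N)) * of_real (sin t))" for t
  proof -
    define f where "f = torf u v (cis s)"
    have T1: "T = tor d f" unfolding T_def f_def by (rule emb_eq_tor[OF uv(3)])
    have T2: "T' = tor d (\<lambda>x. cnj (f x))" unfolding T'_def f_def emb_eq_tor[OF uv(3)]
      by (rule tor_cong) (simp add: torf_cis[OF uv(3)] cis_cnj)
    have ff: "f x * cnj (f x) = 1" for x unfolding f_def torf_cis[OF uv(3)] by (rule cis_unit)
    have "f j * cnj (f i) = cis (- (s * ?N))" unfolding f_def torf_cis[OF uv(3)] cis_cnj cis_mult
      by (rule arg_cong[where f = cis]) (simp add: algebra_simps)
    then have "\<i> * cis (- \<alpha>) * of_real (sin t) * (f j * cnj (f i)) = \<i> * (cis (- \<alpha>) * cis (- (s * ?N))) * of_real (sin t)"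
      by (simp add: mult_ac)
    also have "cis (- \<alpha>) * cis (- (s * ?N)) = cis (- (\<alpha> + s * ?N))" by (simp add: cis_mult)
    finally have E: "\<i> * cis (- \<alpha>) * of_real (sin t) * (f j * cnj (f i)) = \<i> * cis (- (\<alpha> + s * ?N)) * of_real (sin t)" .
    show ?thesis unfolding T1 T2 G_def by (subst emb_torus_conj[OF ij ff]) (simp only: E)
  qed
  have rep: "\<rho> (T * G t * T') $$ (p,q) = cis (of_int (m p u v - m q u v) * s) * \<rho> (G t) $$ (p,q)" for t
  proof -
    have "\<rho> (T * G t * T') $$ (p,q) = (\<rho> T * \<rho> (G t) * \<rho> T') $$ (p,q)"
      unfolding mult[OF SU_mult[OF T(1) G] T(2)] mult[OF T(1) G] ..
    also have "\<dots> = (cis (of_int (m p u v) * s) * \<rho> (G t) $$ (p,q)) * cis (of_int (m q u v) * (- s))"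
      unfolding T_def T'_def torus[OF uv]
        tor_mult_right[OF mult_carrier_mat[OF tor_carrier rep_carrier[OF G]] pq]
        tor_mult_left[OF rep_carrier[OF G] pq] ..
    also have "\<dots> = (cis (of_int (m p u v) * s) * cis (of_int (m q u v) * (- s))) * \<rho> (G t) $$ (p,q)"
      by (simp only: mult_ac)
    also have "cis (of_int (m p u v) * s) * cis (of_int (m q u v) * (- s)) = cis (of_int (m p u v - m q u v) * s)"
      unfolding cis_mult by (rule arg_cong[where f = cis]) (simp add: algebra_simps)
    finally show ?thesis .
  qed
  have "((\<lambda>t. \<rho> (T * G t * T') $$ (p,q)) has_vector_derivative cis (of_int (m p u v - m q u v) * s) * (\<i> * X \<alpha> p q)) (at 0)"
    unfolding rep unfolding G_def by (rule has_vector_derivative_mult_right[OF X_deriv[OF pq]])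
  moreover have "((\<lambda>t. \<rho> (T * G t * T') $$ (p,q)) has_vector_derivative \<i> * X (\<alpha> + s * ?N) p q) (at 0)"
    unfolding conj by (rule X_deriv[OF pq])
  ultimately have "cis (of_int (m p u v - m q u v) * s) * (\<i> * X \<alpha> p q) = \<i> * X (\<alpha> + s * ?N) p q"
    by (rule vector_derivative_unique_at)
  then have "\<i> * (cis (of_int (m p u v - m q u v) * s) * X \<alpha> p q) = \<i> * X (\<alpha> + s * ?N) p q"
    by (simp only: mult_ac)
  then show ?thesis by (metis mult_left_cancel complex_i_not_zero)
qed

text \<open>Differentiating the rotation of \<alpha> under the torus of the pair gives the
  commutator of \<open>H\<close> and \<open>X 0\<close>; the left side is its entry because
  \<open>H\<close> is diagonal. The factor 2 is the speed of that rotation.\<close>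

lemma commutator_HX:
  assumes pq: "p < k" "q < k"
  shows "of_int (m p i j - m q i j) * X 0 p q = - 2 * \<i> * X (pi/2) p q"
proof -
  have N: "root_pairing i j i - root_pairing i j j = 2" using ij by (simp add: root_pairing_def)
  have eq: "cis (of_int (m p i j - m q i j) * s) * X 0 p q = of_real (cos (s * 2)) * X 0 p q + of_real (sin (s * 2)) * X (pi/2) p q" for s
    using X_torus_conj[OF ij pq, of s 0] X_cos_sin[OF pq, of "s * 2"] unfolding N by simp
  have "((\<lambda>s. cis (of_int (m p i j - m q i j) * s) * X 0 p q) has_vector_derivative \<i> * of_int (m p i j - m q i j) * X 0 p q) (at 0)"
    using has_vector_derivative_mult_left[OF has_vector_derivative_cis[of "of_int (m p i j - m q i j)" 0]] by simp
  moreover have "((\<lambda>s. cis (of_int (m p i j - m q i j) * s) * X 0 p q) has_vector_derivative 0 * X 0 p q + of_real 2 * X (pi/2) p q) (at 0)"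
    unfolding eq by (intro has_vector_derivative_add has_vector_derivative_mult_left
        has_vector_derivative_cos_zero has_vector_derivative_sin_zero)
  ultimately have "\<i> * of_int (m p i j - m q i j) * X 0 p q = 0 * X 0 p q + of_real 2 * X (pi/2) p q"
    by (rule vector_derivative_unique_at)
  then have *: "\<i> * of_int (m p i j - m q i j) * X 0 p q = 2 * X (pi/2) p q" by simp
  have "of_int (m p i j - m q i j) * X 0 p q = - (\<i> * (\<i> * of_int (m p i j - m q i j) * X 0 p q))"
    by (simp add: mult.assoc)
  then show ?thesis unfolding * by simp
qed

text \<open>Unitarity cancels the two inner factors, so the adjoint action respects products and
  therefore commutators.\<close>

lemma conjugated_mult:
  assumes w: "w \<in> SU d" and pq: "p < k" "q < k"
  shows "(\<Sum>r<k. conjugated w Y p r * conjugated w Y' r q) = conjugated w (\<lambda>s v. \<Sum>u<k. Y s u * Y' u v) p q"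
proof -
  define L where "L v = (\<Sum>s<k. \<rho> w $$ (p,s) * Y s v)" for v
  define R where "R s = (\<Sum>v<k. Y' s v * cnj (\<rho> w $$ (q,v)))" for s
  have l: "conjugated w Y p r = (\<Sum>v<k. L v * cnj (\<rho> w $$ (r,v)))" for r
    unfolding conjugated_def L_def sum_distrib_right ..
  have r: "conjugated w Y' r q = (\<Sum>s<k. \<rho> w $$ (r,s) * R s)" for r
    unfolding conjugated_def R_def sum_distrib_left by (subst sum.swap) (simp add: mult.assoc)
  have "(\<Sum>r<k. conjugated w Y p r * conjugated w Y' r q)
    = (\<Sum>r<k. \<Sum>v<k. \<Sum>s<k. L v * R s * (cnj (\<rho> w $$ (r,v)) * \<rho> w $$ (r,s)))"
    unfolding l r sum_product by (simp only: mult_ac)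
  also have "\<dots> = (\<Sum>v<k. \<Sum>s<k. \<Sum>r<k. L v * R s * (cnj (\<rho> w $$ (r,v)) * \<rho> w $$ (r,s)))"
    by (subst sum.swap, rule sum.cong[OF refl], rule sum.swap)
  also have "\<dots> = (\<Sum>v<k. \<Sum>s<k. if s = v then L v * R v else 0)"
    unfolding sum_distrib_left[symmetric] using rep_orth_cols[OF w] by (intro sum.cong refl) auto
  also have "\<dots> = (\<Sum>v<k. L v * R v)" by simp
  also have "\<dots> = (\<Sum>u<k. \<Sum>v<k. \<Sum>s<k. \<rho> w $$ (p,s) * (Y s u * Y' u v) * cnj (\<rho> w $$ (q,v)))"
    unfolding L_def R_def sum_product by (subst (2) sum.swap) (simp add: mult_ac)
  also have "\<dots> = (\<Sum>v<k. \<Sum>u<k. \<Sum>s<k. \<rho> w $$ (p,s) * (Y s u * Y' u v) * cnj (\<rho> w $$ (q,v)))"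
    by (rule sum.swap)
  also have "\<dots> = (\<Sum>v<k. \<Sum>s<k. \<Sum>u<k. \<rho> w $$ (p,s) * (Y s u * Y' u v) * cnj (\<rho> w $$ (q,v)))"
    by (rule sum.cong[OF refl], rule sum.swap)
  finally show ?thesis unfolding conjugated_def by (simp only: sum_distrib_left sum_distrib_right)
qed

text \<open>Conjugation by \<open>cyc\<close> moves \<open>H\<close> to \<open>X 0\<close>,
  \<open>X 0\<close> to \<open>X (pi/2)\<close> and \<open>X (pi/2)\<close> back to
  \<open>H\<close>.\<close>

abbreviation "cyc \<equiv> g \<kappa> \<kappa>"
abbreviation "cyc' \<equiv> g (cnj \<kappa>) (- \<kappa>)"

lemma cyc: "cyc \<in> SU d" "cyc' \<in> SU d" "cyc * cyc' = 1\<^sub>m d"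
  by (rule g_SU g_adj_SU g_inverse, rule kappa_unit)+

lemma cyc_H: "conjugated cyc H = X 0"
  unfolding X_def by simp

lemma cyc_conj: "cyc * g a b * cyc' = g ((\<kappa> * a - cnj \<kappa> * b) * cnj \<kappa> + cnj (\<kappa> * a + cnj \<kappa> * b) * \<kappa>)
    ((\<kappa> * a + cnj \<kappa> * b) * cnj \<kappa> - cnj (\<kappa> * a - cnj \<kappa> * b) * \<kappa>)"
  by (rule g_conj)

lemma cyc_X0:
  assumes pq: "p < k" "q < k"
  shows "conjugated cyc (X 0) p q = X (pi/2) p q"
proof -
  have ic: "\<i> * cis (- (pi / 2)) = 1" by (simp add: complex_eq_iff)
  have eq: "cyc * g (of_real (cos t)) (\<i> * cis (- 0) * of_real (sin t)) * cyc'
     = g (of_real (cos t)) (\<i> * cis (- (pi/2)) * of_real (sin t))" for t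
    unfolding cyc_conj ic by (rule arg_cong2[where f = g]) (simp_all add: \<kappa>_def complex_eq_iff field_simps)
  have "((\<lambda>t. \<rho> (cyc * g (of_real (cos t)) (\<i> * cis (- 0) * of_real (sin t)) * cyc') $$ (p,q))
      has_vector_derivative \<i> * conjugated cyc (X 0) p q) (at 0)"
    unfolding conjugated_def by (rule rep_conj_deriv[OF cyc g_SU[OF gx_unit] X_deriv pq])
  moreover have "((\<lambda>t. \<rho> (cyc * g (of_real (cos t)) (\<i> * cis (- 0) * of_real (sin t)) * cyc') $$ (p,q))
      has_vector_derivative \<i> * X (pi/2) p q) (at 0)"
    unfolding eq by (rule X_deriv[OF pq])
  ultimately have "\<i> * conjugated cyc (X 0) p q = \<i> * X (pi/2) p q" by (rule vector_derivative_unique_at)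
  then show ?thesis by simp
qed

lemma cyc_Z:
  assumes pq: "p < k" "q < k"
  shows "conjugated cyc (X (pi/2)) p q = H p q"
proof -
  have ic: "\<i> * cis (- (pi / 2)) = 1" by (simp add: complex_eq_iff)
  have eq: "cyc * g (of_real (cos t)) (\<i> * cis (- (pi/2)) * of_real (sin t)) * cyc' = g (cis t) 0" for t
    unfolding cyc_conj ic by (rule arg_cong2[where f = g]) (simp_all add: \<kappa>_def complex_eq_iff field_simps)
  have "((\<lambda>t. \<rho> (cyc * g (of_real (cos t)) (\<i> * cis (- (pi/2)) * of_real (sin t)) * cyc') $$ (p,q))
      has_vector_derivative \<i> * conjugated cyc (X (pi/2)) p q) (at 0)"
    unfolding conjugated_def by (rule rep_conj_deriv[OF cyc g_SU[OF gx_unit] X_deriv pq])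
  moreover have "((\<lambda>t. \<rho> (cyc * g (of_real (cos t)) (\<i> * cis (- (pi/2)) * of_real (sin t)) * cyc') $$ (p,q))
      has_vector_derivative \<i> * H p q) (at 0)"
    unfolding eq by (rule H_deriv[OF pq])
  ultimately have "\<i> * conjugated cyc (X (pi/2)) p q = \<i> * H p q" by (rule vector_derivative_unique_at)
  then show ?thesis by simp
qed

lemma conjugated_cong:
  "(\<And>s v. s < k \<Longrightarrow> v < k \<Longrightarrow> Y s v = Y' s v) \<Longrightarrow> conjugated w Y p q = conjugated w Y' p q"
  unfolding conjugated_def by (intro sum.cong refl) auto

text \<open>The commutator of \<open>H\<close> and \<open>X 0\<close> carried along the cyclic
  permutation of the axes.\<close>

lemma commutator_XZ:
  assumes pq: "p < k" "q < k"
  shows "(\<Sum>r<k. X 0 p r * X (pi/2) r q - X (pi/2) p r * X 0 r q) = - 2 * \<i> * H p q"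
proof -
  have HX: "(\<Sum>u<k. H s u * X 0 u v) = of_int (m s i j) * X 0 s v" if "s < k" for s v
  proof -
    have "(\<Sum>u<k. H s u * X 0 u v) = (\<Sum>u<k. if u = s then of_int (m s i j) * X 0 s v else 0)"
      by (intro sum.cong) (auto simp: H_def)
    then show ?thesis using that by simp
  qed
  have XH: "(\<Sum>u<k. X 0 s u * H u v) = of_int (m v i j) * X 0 s v" if "v < k" for s v
  proof -
    have "(\<Sum>u<k. X 0 s u * H u v) = (\<Sum>u<k. if u = v then of_int (m v i j) * X 0 s v else 0)"
      by (intro sum.cong) (auto simp: H_def)
    then show ?thesis using that by simp
  qed
  have "(\<Sum>r<k. X 0 p r * X (pi/2) r q) = (\<Sum>r<k. conjugated cyc H p r * conjugated cyc (X 0) r q)"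
    unfolding cyc_H using cyc_X0 pq by (intro sum.cong) auto
  also have "\<dots> = conjugated cyc (\<lambda>s v. of_int (m s i j) * X 0 s v) p q"
    unfolding conjugated_mult[OF cyc(1) pq] by (rule conjugated_cong) (simp add: HX)
  finally have 1: "(\<Sum>r<k. X 0 p r * X (pi/2) r q) = conjugated cyc (\<lambda>s v. of_int (m s i j) * X 0 s v) p q" .
  have "(\<Sum>r<k. X (pi/2) p r * X 0 r q) = (\<Sum>r<k. conjugated cyc (X 0) p r * conjugated cyc H r q)"
    unfolding cyc_H using cyc_X0 pq by (intro sum.cong) auto
  also have "\<dots> = conjugated cyc (\<lambda>s v. of_int (m v i j) * X 0 s v) p q"
    unfolding conjugated_mult[OF cyc(1) pq] by (rule conjugated_cong) (simp add: XH)
  finally have 2: "(\<Sum>r<k. X (pi/2) p r * X 0 r q) = conjugated cyc (\<lambda>s v. of_int (m v i j) * X 0 s v) p q" .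
  have "(\<Sum>r<k. X 0 p r * X (pi/2) r q - X (pi/2) p r * X 0 r q)
     = conjugated cyc (\<lambda>s v. of_int (m s i j - m v i j) * X 0 s v) p q"
    unfolding sum_subtractf 1 2 conjugated_def by (simp add: sum_subtractf[symmetric] algebra_simps)
  also have "\<dots> = conjugated cyc (\<lambda>s v. - 2 * \<i> * X (pi/2) s v) p q"
    by (rule conjugated_cong) (rule commutator_HX)
  also have "\<dots> = - 2 * \<i> * conjugated cyc (X (pi/2)) p q"
    unfolding conjugated_def sum_distrib_left by (simp only: mult_ac)
  finally show ?thesis unfolding cyc_Z[OF pq] .
qed

text \<open>The lowering operator of the pair: in the defining representation, twice the matrix unit
  with row \<open>j\<close> and column \<open>i\<close>.\<close>

definition F :: "nat \<Rightarrow> nat \<Rightarrow> complex" where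
  "F p q = X 0 p q + \<i> * X (pi/2) p q"

text \<open>Under the torus the two components of \<open>F\<close> rotate in such a way that
  \<open>F\<close> picks up a pure character. A nonzero entry therefore forces its two weights to
  differ by minus the root of the pair.\<close>

lemma F_shifts_weight:
  assumes uv: "u < d" "v < d" "u \<noteq> v" and pq: "p < k" "q < k" and nz: "F p q \<noteq> 0"
  shows "m p u v - m q u v = root_pairing u v j - root_pairing u v i"
proof -
  let ?N = "root_pairing u v i - root_pairing u v j"
  have "cis (of_int (m p u v - m q u v) * s) = cis (of_int (- ?N) * s)" for s
  proof -
    define b where "b = s * of_int ?N"
    define c where "c = cis (of_int (m p u v - m q u v) * s)"
    have c: "c * X 0 p q = X b p q" "c * X (pi/2) p q = X (pi/2 + b) p q"
      unfolding c_def b_def X_torus_conj[OF uv pq] by simp_all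
    have "c * F p q = c * X 0 p q + \<i> * (c * X (pi/2) p q)"
      unfolding F_def by (simp add: algebra_simps)
    also have "\<dots> = (of_real (cos b) - \<i> * of_real (sin b)) * F p q"
      unfolding c X_cos_sin[OF pq, of b] X_cos_sin[OF pq, of "pi/2 + b"] F_def
      by (simp add: cos_add sin_add algebra_simps)
    also have "of_real (cos b) - \<i> * of_real (sin b) = cis (- b)" by (simp add: complex_eq_iff)
    also have "- b = of_int (- ?N) * s" by (simp add: b_def algebra_simps)
    finally show ?thesis using nz unfolding c_def by simp
  qed
  then show ?thesis using cis_int_eqD[of "m p u v - m q u v" "- ?N"] by simp
qed

text \<open>The commutator of the adjoint of \<open>F\<close> with \<open>F\<close> is 4 times
  \<open>H\<close>. At the diagonal entry \<open>p\<close> a vanishing column leaves minus a squared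
  row norm, which cannot equal the positive number 4 \<open>m p i j\<close>.\<close>

lemma lowering_nonzero:
  assumes p: "p < k" and pos: "m p i j > 0"
  shows "\<exists>r<k. F r p \<noteq> 0"
proof (rule ccontr)
  assume "\<not> ?thesis"
  then have z: "F r p = 0" if "r < k" for r using that by auto
  have "(\<Sum>r<k. cnj (F r p) * F r p) - (\<Sum>r<k. F p r * cnj (F p r))
      = (\<Sum>r<k. 2 * \<i> * (X 0 p r * X (pi/2) r p - X (pi/2) p r * X 0 r p))"
    unfolding sum_subtractf[symmetric] F_def by (intro sum.cong refl) (simp add: X_hermitian algebra_simps)
  also have "\<dots> = 2 * \<i> * (- 2 * \<i> * H p p)"
    unfolding sum_distrib_left[symmetric] commutator_XZ[OF p p] ..
  also have "\<dots> = of_real (4 * of_int (m p i j))" by (simp add: H_def)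
  finally have "- (\<Sum>r<k. F p r * cnj (F p r)) = of_real (4 * of_int (m p i j))"
    using z by simp
  then have "- of_real (\<Sum>r<k. (cmod (F p r))\<^sup>2) = complex_of_real (4 * of_int (m p i j))"
    by (simp only: of_real_sum complex_norm_square)
  then have "- (\<Sum>r<k. (cmod (F p r))\<^sup>2) = 4 * of_int (m p i j)"
    by (metis of_real_eq_iff of_real_minus)
  moreover have "(\<Sum>r<k. (cmod (F p r))\<^sup>2) \<ge> 0" by (simp add: sum_nonneg)
  ultimately show False using pos by simp
qed

lemma weight_step:
  assumes "p < k" "m p i j > 0"
  obtains r where "r < k" "\<And>u v. u < d \<Longrightarrow> v < d \<Longrightarrow> u \<noteq> v \<Longrightarrow>
    m r u v = m p u v - root_pairing u v i + root_pairing u v j"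
proof -
  obtain r where r: "r < k" "F r p \<noteq> 0" using lowering_nonzero[OF assms] by blast
  show ?thesis
  proof (rule that[OF r(1)])
    fix u v assume "u < d" "v < d" "u \<noteq> v"
    from F_shifts_weight[OF this r(1) assms(1) r(2)]
    show "m r u v = m p u v - root_pairing u v i + root_pairing u v j" by simp
  qed
qed

text \<open>No column of the unitary matrix of the reflection is zero, and any nonzero entry links a
  weight to its reflection.\<close>

lemma weight_swap:
  assumes p: "p < k"
  obtains r where "r < k" "\<And>u v. u < d \<Longrightarrow> v < d \<Longrightarrow> u \<noteq> v \<Longrightarrow>
    m r (Transposition.transpose i j u) (Transposition.transpose i j v) = m p u v"
proof -
  let ?t = "Transposition.transpose i j"
  have S: "g 0 1 \<in> SU d" by (rule g_SU) simp
  have "\<exists>r<k. \<rho> (g 0 1) $$ (r,p) \<noteq> 0"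
  proof (rule ccontr)
    assume "\<not> ?thesis"
    then have "(\<Sum>t<k. cnj (\<rho> (g 0 1) $$ (t,p)) * \<rho> (g 0 1) $$ (t,p)) = 0" by (intro sum.neutral) auto
    then show False using rep_orth_cols[OF S p p] by simp
  qed
  then obtain r where r: "r < k" "\<rho> (g 0 1) $$ (r,p) \<noteq> 0" by blast
  show ?thesis
  proof (rule that[OF r(1)])
    fix u v assume uv: "u < d" "v < d" "u \<noteq> v"
    have tuv: "?t u < d" "?t v < d" "?t u \<noteq> ?t v"
      using uv ij by (auto simp: Transposition.transpose_def split: if_splits)
    have "cis (of_int (m r (?t u) (?t v)) * s) = cis (of_int (m p u v) * s)" for s
    proof -
      have T: "emb d u v (cis s) 0 \<in> SU d" "emb d (?t u) (?t v) (cis s) 0 \<in> SU d"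
        by (intro emb_SU uv tuv; simp add: cis_unit)+
      have "g 0 1 * emb d u v (cis s) 0 = emb d (?t u) (?t v) (cis s) 0 * g 0 1"
        unfolding emb_eq_tor[OF uv(3)] emb_eq_tor[OF tuv(3)] emb_swap_torus[OF ij] torf_transpose ..
      then have "\<rho> (g 0 1) * \<rho> (emb d u v (cis s) 0) = \<rho> (emb d (?t u) (?t v) (cis s) 0) * \<rho> (g 0 1)"
        using mult[OF S T(1)] mult[OF T(2) S] by simp
      then have "(\<rho> (g 0 1) * tor k (\<lambda>p. cis (of_int (m p u v) * s))) $$ (r,p)
        = (tor k (\<lambda>p. cis (of_int (m p (?t u) (?t v)) * s)) * \<rho> (g 0 1)) $$ (r,p)"
        unfolding torus[OF uv] torus[OF tuv] by (rule arg_cong)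
      then show ?thesis
        unfolding tor_mult_left[OF rep_carrier[OF S] r(1) p] tor_mult_right[OF rep_carrier[OF S] r(1) p]
        using r(2) by simp
    qed
    then show "m r (?t u) (?t v) = m p u v" by (rule cis_int_eqD)
  qed
qed

end

section \<open>Counting weights\<close>

text \<open>One step down a root string from a positive pairing, and transpositions of coordinates:
  the two moves that \<open>weight_step\<close> and \<open>weight_swap\<close> supply.\<close>

definition weight_closed :: "nat \<Rightarrow> (nat \<Rightarrow> int) set \<Rightarrow> bool" where
  "weight_closed d W \<longleftrightarrow> (\<forall>x\<in>W. \<forall>i<d. \<forall>j<d. i \<noteq> j \<longrightarrow>
     (x i > x j \<longrightarrow> x(i := x i - 1, j := x j + 1) \<in> W) \<and> x(i := x j, j := x i) \<in> W)"

lemma weight_closed_swap: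
  "weight_closed d W \<Longrightarrow> x \<in> W \<Longrightarrow> i < d \<Longrightarrow> j < d \<Longrightarrow> i \<noteq> j \<Longrightarrow> x(i := x j, j := x i) \<in> W"
  by (simp add: weight_closed_def)

text \<open>Before each step the \<open>i\<close>-th coordinate must exceed the \<open>j\<close>-th.
  The summand 1 admits the last such step, which crosses the middle of the string when the
  difference is odd.\<close>

lemma weight_closed_half_string:
  assumes W: "weight_closed d W" and ij: "i < d" "j < d" "i \<noteq> j"
  shows "x \<in> W \<Longrightarrow> 2 * int c \<le> x i - x j + 1 \<Longrightarrow> x(i := x i - int c, j := x j + int c) \<in> W"
proof (induction c)
  case 0
  then show ?case by simp
next
  case (Suc c)
  let ?y = "x(i := x i - int c, j := x j + int c)"
  have y: "?y \<in> W" by (rule Suc.IH) (use Suc.prems in auto)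
  have gt: "?y i > ?y j" using Suc.prems(2) ij by simp
  have "?y(i := ?y i - 1, j := ?y j + 1) \<in> W"
    using W y gt ij unfolding weight_closed_def by blast
  moreover have "?y(i := ?y i - 1, j := ?y j + 1) = x(i := x i - int (Suc c), j := x j + int (Suc c))"
    using ij(3) by (auto simp: fun_eq_iff)
  ultimately show ?case by (simp only:)
qed

lemma weight_closed_string:
  assumes W: "weight_closed d W" and ij: "i < d" "j < d" "i \<noteq> j" and x: "x \<in> W" and c: "int c \<le> x i - x j"
  shows "x(i := x i - int c, j := x j + int c) \<in> W"
proof (cases "2 * int c \<le> x i - x j + 1")
  case True
  then show ?thesis using weight_closed_half_string[OF W ij x] by blast
next
  case False
  \<comment> \<open>beyond the midpoint of the string, reflect a point of its first half\<close>
  define c' where "c' = nat (x i - x j - int c)"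
  have c': "int c' = x i - x j - int c" using c by (simp add: c'_def)
  let ?y = "x(i := x i - int c', j := x j + int c')"
  have y: "?y \<in> W" using weight_closed_half_string[OF W ij x, of c'] c' False by simp
  have "?y(i := ?y j, j := ?y i) \<in> W" by (rule weight_closed_swap[OF W y ij])
  moreover have "?y(i := ?y j, j := ?y i) = x(i := x i - int c, j := x j + int c)"
    using ij(3) c' by (auto simp: fun_eq_iff)
  ultimately show ?thesis by (simp only:)
qed

text \<open>The hockey stick identity, in the form that matches slicing by one coordinate.\<close>

lemma sum_choose_fixed_lower: "(\<Sum>j\<le>J. (e + j) choose e) = (Suc e + J) choose Suc e"
  by (induction J) auto

lemma card_ge_sum_fibres:
  assumes "finite W"
  shows "(\<Sum>c\<le>J. card {y \<in> W. y l = b + int c}) \<le> card W"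
proof -
  have "(\<Sum>c\<le>J. card {y \<in> W. y l = b + int c}) = card (\<Union>c\<in>{..J}. {y \<in> W. y l = b + int c})"
    using assms by (subst card_UN_disjoint) auto
  also have "\<dots> \<le> card W" using assms by (intro card_mono) auto
  finally show ?thesis .
qed

text \<open>The argument runs from J - m up to J and then from J - m - 1 down to 0, so it takes each
  value once.\<close>

lemma sum_split_reindex:
  fixes f :: "nat \<Rightarrow> nat"
  assumes "m \<le> J"
  shows "(\<Sum>c\<le>J. f (if c \<le> m then J - m + c else J - c)) = (\<Sum>j\<le>J. f j)"
  by (rule sum.reindex_bij_betw[OF bij_betwI[where g = "\<lambda>v. if J - m \<le> v then v - (J - m) else J - v"]])
    (use assms in auto)

lemma weight_closed_fibre:
  assumes "weight_closed (Suc e) W"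
  shows "weight_closed e {y \<in> W. y e = b}"
  using assms unfolding weight_closed_def by auto

text \<open>The set is sliced by its last coordinate. Closure passes to each slice, so it suffices
  to find in each slice a vector with a large gap among the remaining coordinates; the sizes that
  the induction hypothesis guarantees add up by the hockey stick identity.\<close>

lemma weight_closed_card:
  assumes "finite W" "weight_closed (Suc e) W" "x \<in> W" "i < Suc e" "j < Suc e" "x i - x j = int J"
  shows "(e + J) choose e \<le> card W"
  using assms
proof (induction e arbitrary: W x i j J)
  case 0
  then have "card W > 0" by (auto simp: card_gt_0_iff)
  then show ?case by simp
next
  case (Suc e)
  note fin = Suc.prems(1) and W = Suc.prems(2) and x = Suc.prems(3)
  let ?L = "Suc e"
  \<comment> \<open>The whole spread of \<open>x\<close> is used; it is at least the given
    difference \<open>J\<close>, and the bound is monotone in it.\<close>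
  define M where "M = Max (x ` {..?L})"
  define b where "b = Min (x ` {..?L})"
  have "M \<in> x ` {..?L}" "b \<in> x ` {..?L}" unfolding M_def b_def by (intro Max_in Min_in; simp)+
  then obtain i' j' where i': "i' \<le> ?L" "x i' = M" and j': "j' \<le> ?L" "x j' = b" by auto
  have bounds: "b \<le> x l" "x l \<le> M" if "l \<le> ?L" for l
    unfolding M_def b_def using that by auto
  define J' where "J' = nat (M - b)"
  have J': "int J' = M - b" using bounds[of 0] by (simp add: J'_def)
  have JJ: "J \<le> J'"
  proof -
    have "int J \<le> int J'" unfolding J' Suc.prems(6)[symmetric]
      using bounds(2)[of i] bounds(1)[of j] Suc.prems(4,5) by simp
    then show ?thesis by simp
  qed
  have mono: "(?L + J) choose ?L \<le> (?L + J') choose ?L" using JJ by (intro binomial_right_mono) auto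
  show ?case
  proof (cases "J' = 0")
    case True
    have "card W > 0" using fin x by (auto simp: card_gt_0_iff)
    then show ?thesis using True mono by simp
  next
    case False
    then have Mb: "M \<noteq> b" using J' by auto
    \<comment> \<open>A transposition, if necessary, brings a smallest entry to the last place and
      keeps a largest one among the others.\<close>
    obtain y i where y: "y \<in> W" "y ?L = b" "i < ?L" "y i = M" "\<And>l. l \<le> ?L \<Longrightarrow> b \<le> y l \<and> y l \<le> M"
    proof (cases "j' = ?L")
      case True
      have "i' \<noteq> ?L" using True i' j' Mb by auto
      then show ?thesis using that[of x i'] x i' j' True bounds by auto
    next
      case False
      let ?y = "x(j' := x ?L, ?L := x j')"
      have y: "?y \<in> W" using weight_closed_swap[OF W x, of j' ?L] False j' by auto
      have ne: "i' \<noteq> j'" using i' j' Mb by auto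
      define i where "i = (if i' = ?L then j' else i')"
      have "i < ?L" "?y i = M" using i' j' False ne by (auto simp: i_def)
      moreover have "b \<le> ?y l \<and> ?y l \<le> M" if "l \<le> ?L" for l using bounds[of l] bounds[of ?L] bounds[of j'] that j' by auto
      ultimately show ?thesis using that[of ?y i] y j' False by auto
    qed
    have fibre: "(e + l) choose e \<le> card {z \<in> W. z ?L = b + int c}"
      if "z \<in> W" "z ?L = b + int c" "u < ?L" "v < ?L" "z u - z v = int l" for z c u v l
      by (rule Suc.IH[OF _ weight_closed_fibre[OF W], where x = z and i = u and j = v]) (use that fin in auto)
    \<comment> \<open>\<open>c0\<close> is the height above \<open>b\<close> of a further coordinate
      \<open>q\<close>. Up to this height the last coordinate is filled from \<open>q\<close>, which
      widens the gap between \<open>i\<close> and \<open>q\<close>. Beyond it \<open>q\<close> and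
      the last coordinate are exchanged and the filling comes from \<open>i\<close>. The gaps used
      run through 0, ..., J' exactly once. For e = 0 there is no \<open>q\<close>, and nonempty
      slices suffice.\<close>
    have "(\<Sum>c\<le>J'. (e + (if c \<le> c0 then J' - c0 + c else J' - c)) choose e) \<le> (\<Sum>c\<le>J'. card {z \<in> W. z ?L = b + int c})"
      if "c0 = (if e = 0 then 0 else nat (y (if i = 0 then 1 else 0) - b))" for c0
    proof (rule sum_mono)
      fix c assume "c \<in> {..J'}"
      then have c: "c \<le> J'" by simp
      show "(e + (if c \<le> c0 then J' - c0 + c else J' - c)) choose e \<le> card {z \<in> W. z ?L = b + int c}"
      proof (cases "e = 0")
        case True
        let ?z = "y(i := y i - int c, ?L := y ?L + int c)"
        have z: "?z \<in> W" by (rule weight_closed_string[OF W]) (use y c J' in auto)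
        have "(e + 0) choose e \<le> card {z \<in> W. z ?L = b + int c}"
          by (rule fibre[OF z, where c = c and u = 0 and v = 0 and l = 0]) (use y True in auto)
        then show ?thesis using True by simp
      next
        case e: False
        define q where "q = (if i = 0 then 1 else 0 :: nat)"
        have q: "q < ?L" "q \<noteq> i" using e by (auto simp: q_def)
        have c0: "int c0 = y q - b" using that e y(5)[of q] q by (simp add: q_def)
        have c0J: "c0 \<le> J'" using c0 J' y(5)[of q] q by linarith
        show ?thesis
        proof (cases "c \<le> c0")
          case True
          let ?z = "y(q := y q - int c, ?L := y ?L + int c)"
          have z: "?z \<in> W" by (rule weight_closed_string[OF W]) (use y q c0 True in auto)
          have "(e + (J' - c0 + c)) choose e \<le> card {z \<in> W. z ?L = b + int c}"
            by (rule fibre[OF z, where c = c and u = i and v = q]) (use y q c0 c0J J' True in \<open>auto simp: of_nat_diff\<close>)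
          then show ?thesis using True by simp
        next
          case False
          let ?x = "y(q := y ?L, ?L := y q)"
          have x': "?x \<in> W" by (rule weight_closed_swap[OF W y(1)]) (use q in auto)
          let ?z = "?x(i := ?x i - int (c - c0), ?L := ?x ?L + int (c - c0))"
          have z: "?z \<in> W"
            by (rule weight_closed_string[OF W _ _ _ x']) (use y q c0 c J' False in \<open>auto simp: of_nat_diff\<close>)
          have "(e + (J' - c + c0)) choose e \<le> card {z \<in> W. z ?L = b + int c}"
            by (rule fibre[OF z, where c = c and u = i and v = q]) (use y q c0 c J' False in \<open>auto simp: of_nat_diff\<close>)
          moreover have "(e + (J' - c)) choose e \<le> (e + (J' - c + c0)) choose e" by (intro binomial_right_mono) auto
          ultimately show ?thesis using False by simp
        qed
      qed
    qed
    from this[OF refl]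
    obtain c0 where c0: "c0 = (if e = 0 then 0 else nat (y (if i = 0 then 1 else 0) - b))"
      and le: "(\<Sum>c\<le>J'. (e + (if c \<le> c0 then J' - c0 + c else J' - c)) choose e) \<le> (\<Sum>c\<le>J'. card {z \<in> W. z ?L = b + int c})"
      by blast
    have c0J: "c0 \<le> J'" using c0 J' y(5)[of "if i = 0 then 1 else 0"] by (auto split: if_splits)
    have "(?L + J') choose ?L = (\<Sum>c\<le>J'. (e + (if c \<le> c0 then J' - c0 + c else J' - c)) choose e)"
      unfolding sum_split_reindex[OF c0J, of "\<lambda>l. (e + l) choose e"] sum_choose_fixed_lower ..
    also have "\<dots> \<le> card W" by (rule order_trans[OF le card_ge_sum_fibres[OF fin]])
    finally show ?thesis using mono by simp
  qed
qed

section \<open>Weights as integer vectors and the dimension bound\<close>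

context diag_rep
begin

text \<open>In the product of the two torus elements the entries at the common coordinate cancel;
  comparing characters makes the exponents additive.\<close>

lemma weight_add:
  assumes u: "u < d" "v < d" "w < d" "u \<noteq> v" "v \<noteq> w" "u \<noteq> w" and p: "p < k"
  shows "m p u w = m p u v + m p v w"
proof -
  have "cis (of_int (m p u w) * s) = cis (of_int (m p u v + m p v w) * s)" for s
  proof -
    have SU: "emb d u v (cis s) 0 \<in> SU d" "emb d v w (cis s) 0 \<in> SU d"
      by (intro emb_SU u; simp add: cis_cnj cis_mult)+
    have "emb d u v (cis s) 0 * emb d v w (cis s) 0 = emb d u w (cis s) 0"
      unfolding emb_eq_tor[OF u(4)] emb_eq_tor[OF u(5)] emb_eq_tor[OF u(6)] tor_mult
      by (rule tor_cong) (use u in \<open>auto simp: torf_def cis_cnj cis_mult\<close>)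
    then have "tor k (\<lambda>p. cis (of_int (m p u v) * s)) * tor k (\<lambda>p. cis (of_int (m p v w) * s)) = tor k (\<lambda>p. cis (of_int (m p u w) * s))"
      using mult[OF SU] torus[OF u(1,2,4)] torus[OF u(2,3,5)] torus[OF u(1,3,6)] by metis
    then have "tor k (\<lambda>p. cis (of_int (m p u v) * s) * cis (of_int (m p v w) * s)) $$ (p,p) = tor k (\<lambda>p. cis (of_int (m p u w) * s)) $$ (p,p)"
      unfolding tor_mult by simp
    then show ?thesis using p by (simp add: tor_index cis_mult algebra_simps)
  qed
  then show ?thesis by (rule cis_int_eqD)
qed

lemma weight_neg:
  assumes u: "u < d" "v < d" "u \<noteq> v" and p: "p < k"
  shows "m p v u = - m p u v"
proof -
  have "cis (of_int (m p u v + m p v u) * s) = cis (of_int 0 * s)" for s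
  proof -
    have SU: "emb d u v (cis s) 0 \<in> SU d" "emb d v u (cis s) 0 \<in> SU d"
      by (intro emb_SU u u(3)[symmetric]; simp add: cis_cnj cis_mult)+
    have "emb d u v (cis s) 0 * emb d v u (cis s) 0 = 1\<^sub>m d"
      unfolding emb_eq_tor[OF u(3)] emb_eq_tor[OF u(3)[symmetric]] tor_mult
      by (rule tor_one) (use u in \<open>auto simp: torf_def cis_cnj cis_mult\<close>)
    then have "tor k (\<lambda>p. cis (of_int (m p u v) * s)) * tor k (\<lambda>p. cis (of_int (m p v u) * s)) = 1\<^sub>m k"
      using mult[OF SU] rep_one torus[OF u] torus[OF u(2,1) u(3)[symmetric]] by metis
    then have "tor k (\<lambda>p. cis (of_int (m p u v) * s) * cis (of_int (m p v u) * s)) $$ (p,p) = 1\<^sub>m k $$ (p,p)"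
      unfolding tor_mult by simp
    then show ?thesis using p by (simp add: tor_index cis_mult algebra_simps)
  qed
  from cis_int_eqD[OF this] show ?thesis by simp
qed

text \<open>Weights of SU(d) are vectors modulo constants; fixing the sum of the entries picks one
  representative of each.\<close>

theorem dimension_ge_binomial:
  assumes d: "2 \<le> d" and ij: "i < d" "j < d" "i \<noteq> j" and p: "p < k" and J: "m p i j = int J"
  shows "(d - 1 + J) choose (d - 1) \<le> k"
proof -
  \<comment> \<open>The representative with entry 0 at coordinate 0. Entries from \<open>d\<close>
    on are 0, so a vector is determined by its first \<open>d\<close> entries.\<close>
  define wt where "wt p l = (if l = 0 \<or> l \<ge> d then 0 else m p l 0)" for p l
  have m_wt: "m p u v = wt p u - wt p v" if "u < d" "v < d" "u \<noteq> v" "p < k" for p u v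
    using that d weight_add[of u 0 v p] weight_neg[of u 0 p] weight_neg[of v 0 p] by (auto simp: wt_def)
  define S where "S = (\<Sum>l<d. wt p l)"
  define rel where "rel x p \<longleftrightarrow> (\<forall>u<d. \<forall>v<d. x u - x v = wt p u - wt p v)" for x p
  define W where "W = {x. (\<exists>p<k. rel x p) \<and> (\<Sum>l<d. x l) = S \<and> (\<forall>l\<ge>d. x l = 0)}"
  define f where "f x = (SOME p. p < k \<and> rel x p)" for x
  have f: "f x < k" "rel x (f x)" if "x \<in> W" for x
    using someI_ex[of "\<lambda>p. p < k \<and> rel x p"] that unfolding f_def W_def by auto
  \<comment> \<open>Equal indices give equal differences of entries; with equal sums this yields d
    times x 0 - y 0 equal to zero. Distinct vectors of \<open>W\<close> thus occupy distinct basis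
    indices.\<close>
  have inj: "inj_on f W"
  proof (rule inj_onI)
    fix x y assume x: "x \<in> W" and y: "y \<in> W" and eq: "f x = f y"
    have rel: "x u - x v = y u - y v" if "u < d" "v < d" for u v
      using f(2)[OF x] f(2)[OF y] that unfolding eq rel_def by simp
    have "(\<Sum>l<d. x l - y l) = 0" using x y by (simp add: W_def sum_subtractf)
    also have "(\<Sum>l<d. x l - y l) = (\<Sum>l<d. x 0 - y 0)"
      using rel[of _ 0] d by (intro sum.cong refl) (simp add: algebra_simps)
    finally have "x 0 = y 0" using d by simp
    then have "x l = y l" if "l < d" for l using rel[of l 0] that d by simp
    moreover have "x l = y l" if "l \<ge> d" for l using x y that by (simp add: W_def)
    ultimately show "x = y" by (meson ext not_le)
  qed
  have sub: "f ` W \<subseteq> {..<k}" using f by auto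
  have fin: "finite W" by (rule inj_on_finite[OF inj sub]) simp
  have card: "card W \<le> k" using card_inj_on_le[OF inj sub] by simp
  have "weight_closed d W"
    unfolding weight_closed_def
  proof (intro ballI allI impI conjI)
    fix x i j assume x: "x \<in> W" and i: "i < d" and j: "j < d" and ne: "i \<noteq> j"
    obtain p where p: "p < k" "rel x p" using x by (auto simp: W_def)
    interpret su2_rep d k \<rho> m i j by unfold_locales (use i j ne in auto)
    have sum_upd: "(\<Sum>l<d. (x(i := a, j := b)) l) = S" if "a + b = x i + x j" for a b
    proof -
      have split: "(\<Sum>l<d. y l) = y i + (y j + (\<Sum>l\<in>{..<d} - {i} - {j}. y l))" for y :: "nat \<Rightarrow> int"
        using i j ne by (simp add: sum.remove[of "{..<d}" i] sum.remove[of "{..<d} - {i}" j])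
      have "(\<Sum>l\<in>{..<d} - {i} - {j}. (x(i := a, j := b)) l) = (\<Sum>l\<in>{..<d} - {i} - {j}. x l)"
        by (intro sum.cong) auto
      then show ?thesis using split[of x] split[of "x(i := a, j := b)"] x that ne by (simp add: W_def)
    qed
    have zero: "\<forall>l\<ge>d. (x(i := a, j := b)) l = 0" for a b using x i j by (auto simp: W_def)
    {
      assume gt: "x i > x j"
      have "m p i j > 0" using m_wt[OF i j ne p(1)] p(2)[unfolded rel_def, rule_format, OF i j] gt by simp
      then obtain r where r: "r < k" "\<And>u v. u < d \<Longrightarrow> v < d \<Longrightarrow> u \<noteq> v \<Longrightarrow>
          m r u v = m p u v - root_pairing u v i + root_pairing u v j"
        using weight_step[OF p(1)] by blast
      have "rel (x(i := x i - 1, j := x j + 1)) r"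
        unfolding rel_def
      proof (intro allI impI)
        fix u v assume uv: "u < d" "v < d"
        have xx: "x u - x v = wt p u - wt p v" using p(2) uv by (simp add: rel_def)
        show "(x(i := x i - 1, j := x j + 1)) u - (x(i := x i - 1, j := x j + 1)) v = wt r u - wt r v"
        proof (cases "u = v")
          case False
          have "wt r u - wt r v = x u - x v - root_pairing u v i + root_pairing u v j"
            using r(2)[OF uv False] m_wt[OF uv False] r(1) p(1) xx by simp
          then show ?thesis using False ne by (auto simp: root_pairing_def)
        qed simp
      qed
      then show "x(i := x i - 1, j := x j + 1) \<in> W"
        using r(1) sum_upd[of "x i - 1" "x j + 1"] zero by (auto simp: W_def)
    next
      obtain r where r: "r < k" "\<And>u v. u < d \<Longrightarrow> v < d \<Longrightarrow> u \<noteq> v \<Longrightarrow>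
        m r (Transposition.transpose i j u) (Transposition.transpose i j v) = m p u v"
        using weight_swap[OF p(1)] by blast
      let ?t = "Transposition.transpose i j"
      have upd: "(x(i := x j, j := x i)) u = x (?t u)" for u by (auto simp: Transposition.transpose_def)
      have "rel (x(i := x j, j := x i)) r"
        unfolding rel_def upd
      proof (intro allI impI)
        fix u v assume uv: "u < d" "v < d"
        then have t: "?t u < d" "?t v < d" using i j by (auto simp: Transposition.transpose_def)
        show "x (?t u) - x (?t v) = wt r u - wt r v"
        proof (cases "u = v")
          case False
          then have "?t u \<noteq> ?t v" by (metis transpose_involutory)
          then have "m r u v = m p (?t u) (?t v)" using r(2)[OF t] by simp
          then show ?thesis using m_wt[OF uv False r(1)] m_wt[OF t \<open>?t u \<noteq> ?t v\<close> p(1)] p(2) t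
            by (simp add: rel_def)
        qed simp
      qed
      then show "x(i := x j, j := x i) \<in> W"
        using r(1) sum_upd[of "x j" "x i"] zero by (auto simp: W_def)
    }
  qed
  then have closed: "weight_closed (Suc (d - 1)) W" using d by simp
  have "wt p \<in> W" unfolding W_def S_def rel_def using p by (auto simp: wt_def)
  moreover have "wt p i - wt p j = int J" using m_wt[OF ij p] J by simp
  ultimately have "(d - 1 + J) choose (d - 1) \<le> card W"
    using weight_closed_card[OF fin closed, of "wt p" i j J] ij by simp
  then show ?thesis using card by simp
qed

end

section \<open>Generators of continuous unitary representations\<close>

definition basis_change :: "complex mat \<Rightarrow> complex mat \<Rightarrow> complex mat" where
  "basis_change U A = mat_adjoint U * (A * U)"

lemma basis_change_carrier:
  "U \<in> carrier_mat k k \<Longrightarrow> A \<in> carrier_mat k k \<Longrightarrow> basis_change U A \<in> carrier_mat k k"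
  unfolding basis_change_def by (intro mult_carrier_mat[of _ k k]) auto

lemma basis_change_mult:
  assumes U: "U \<in> carrier_mat k k" "mat_adjoint U * U = 1\<^sub>m k" and A: "A \<in> carrier_mat k k" and B: "B \<in> carrier_mat k k"
  shows "basis_change U A * basis_change U B = basis_change U (A * B)"
proof -
  have U': "mat_adjoint U \<in> carrier_mat k k" using U by simp
  have AU: "A * U \<in> carrier_mat k k" and BU: "B * U \<in> carrier_mat k k"
    using A B U(1) by (auto intro: mult_carrier_mat)
  have CB: "mat_adjoint U * (B * U) \<in> carrier_mat k k" by (rule mult_carrier_mat[OF U' BU])
  have "basis_change U A * basis_change U B = mat_adjoint U * ((A * U) * (mat_adjoint U * (B * U)))"
    unfolding basis_change_def by (rule assoc_mult_mat[OF U' AU CB])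
  also have "(A * U) * (mat_adjoint U * (B * U)) = A * (U * (mat_adjoint U * (B * U)))"
    by (rule assoc_mult_mat[OF A U(1) CB])
  also have "U * (mat_adjoint U * (B * U)) = (U * mat_adjoint U) * (B * U)"
    by (rule assoc_mult_mat[OF U(1) U' BU, symmetric])
  also have "\<dots> = B * U" unfolding isometry_square[OF U] by (rule left_mult_one_mat[OF BU])
  also have "A * (B * U) = (A * B) * U" by (rule assoc_mult_mat[OF A B U(1), symmetric])
  finally show ?thesis unfolding basis_change_def .
qed

lemma basis_change_adjoint:
  assumes U: "U \<in> carrier_mat k k" and A: "A \<in> carrier_mat k k"
  shows "mat_adjoint (basis_change U A) = basis_change U (mat_adjoint A)"
proof -
  have U': "mat_adjoint U \<in> carrier_mat k k" and A': "mat_adjoint A \<in> carrier_mat k k" using U A by simp_all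
  have AU: "A * U \<in> carrier_mat k k" by (rule mult_carrier_mat[OF A U])
  have "mat_adjoint (basis_change U A) = (mat_adjoint U * mat_adjoint A) * U"
    unfolding basis_change_def mat_adjoint_mult[OF U' AU] mat_adjoint_mult[OF A U] by simp
  also have "\<dots> = mat_adjoint U * (mat_adjoint A * U)" by (rule assoc_mult_mat[OF U' A' U])
  finally show ?thesis unfolding basis_change_def .
qed

lemma basis_change_one:
  assumes U: "U \<in> carrier_mat k k" "mat_adjoint U * U = 1\<^sub>m k"
  shows "basis_change U (1\<^sub>m k) = 1\<^sub>m k"
  unfolding basis_change_def left_mult_one_mat[OF U(1)] by (rule U(2))

lemma basis_change_index:
  assumes U: "U \<in> carrier_mat k k" and A: "A \<in> carrier_mat k k" and pq: "p < k" "q < k"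
  shows "basis_change U A $$ (p,q) = (\<Sum>a<k. \<Sum>b<k. cnj (U $$ (a,p)) * A $$ (a,b) * U $$ (b,q))"
  unfolding basis_change_def gram_index[OF U mult_carrier_mat[OF A U] pq]
  by (intro sum.cong refl) (simp add: mult_mat_index_sum[OF A U _ pq(2)] sum_distrib_left mult.assoc del: index_mult_mat)

lemma basis_change_spectral_mat:
  assumes U: "U \<in> carrier_mat k k" "mat_adjoint U * U = 1\<^sub>m k"
  shows "basis_change U (spectral_mat k U c) = tor k c"
proof (rule eq_matI)
  fix p q assume "p < dim_row (tor k c)" "q < dim_col (tor k c)"
  then have pq: "p < k" "q < k" by (auto simp: tor_def)
  have "basis_change U (spectral_mat k U c) $$ (p,q)
    = (\<Sum>r<k. c r * (cnj (\<Sum>a<k. cnj (U $$ (a,r)) * U $$ (a,p)) * (\<Sum>b<k. cnj (U $$ (b,r)) * U $$ (b,q))))"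
    unfolding basis_change_index[OF U(1) spectral_mat_carrier pq] by (rule spectral_mat_form)
  also have "\<dots> = (\<Sum>r<k. if r = p then c p * (if p = q then 1 else 0) else 0)"
    using unitary_cols[OF U _ pq(1)] unitary_cols[OF U _ pq(2)] by (intro sum.cong refl) auto
  finally show "basis_change U (spectral_mat k U c) $$ (p,q) = tor k c $$ (p,q)"
    using pq by (simp add: tor_index)
qed (use U in \<open>auto simp: tor_def basis_change_def\<close>)

lemma unitary_L2_set:
  assumes U: "U \<in> carrier_mat k k" "mat_adjoint U * U = 1\<^sub>m k"
  shows "L2_set (\<lambda>p. cmod (\<Sum>a<k. cnj (U $$ (a,p)) * u a)) {..<k} = L2_set (\<lambda>a. cmod (u a)) {..<k}"
proof -
  have "complex_of_real (\<Sum>p<k. (cmod (\<Sum>a<k. cnj (U $$ (a,p)) * u a))\<^sup>2)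
    = (\<Sum>p<k. 1 * (cnj (\<Sum>a<k. cnj (U $$ (a,p)) * u a) * (\<Sum>b<k. cnj (U $$ (b,p)) * u b)))"
    unfolding of_real_sum complex_norm_square by (intro sum.cong refl) (simp only: mult_1_left mult.commute)
  also have "\<dots> = (\<Sum>a<k. \<Sum>b<k. cnj (u a) * spectral_mat k U (\<lambda>_. 1) $$ (a,b) * u b)"
    by (rule spectral_mat_form[symmetric])
  also have "\<dots> = (\<Sum>a<k. \<Sum>b<k. if b = a then u a * cnj (u a) else 0)"
    using unitary_rows[OF U] by (intro sum.cong refl) (auto simp: spectral_mat_index)
  also have "\<dots> = complex_of_real (\<Sum>a<k. (cmod (u a))\<^sup>2)"
    unfolding of_real_sum complex_norm_square by simp
  finally show ?thesis unfolding L2_set_def of_real_eq_iff by simp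
qed

text \<open>Continuity of the representation is consumed in this form, along a single torus
  curve.\<close>

lemma cont_rep_entry:
  assumes rep: "cont_unitary_rep d k \<rho>" and ij: "i < d" "j < d" "i \<noteq> j" and ab: "a < k" "b < k"
  shows "isCont (\<lambda>t. \<rho> (emb d i j (cis t) 0) $$ (a,b)) t"
  unfolding continuous_at_eps_delta
proof (intro allI impI)
  fix e :: real assume e: "e > 0"
  have SU: "emb d i j (cis s) 0 \<in> SU d" for s by (rule emb_SU[OF ij]) (simp add: cis_cnj cis_mult)
  have c: "\<forall>U\<in>SU d. \<forall>e>0. \<exists>\<delta>>0. \<forall>W\<in>SU d. (\<forall>a<d. \<forall>b<d. cmod (W $$ (a,b) - U $$ (a,b)) < \<delta>) \<longrightarrow>
      (\<forall>a<k. \<forall>b<k. cmod (\<rho> W $$ (a,b) - \<rho> U $$ (a,b)) < e)"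
    using rep unfolding cont_unitary_rep_def by (elim conjE)
  from c[THEN bspec, OF SU[of t], THEN spec, THEN mp, OF e]
  obtain \<delta> where \<delta>: "\<delta> > 0" and near: "\<forall>W\<in>SU d. (\<forall>x<d. \<forall>y<d. cmod (W $$ (x,y) - emb d i j (cis t) 0 $$ (x,y)) < \<delta>)
      \<longrightarrow> (\<forall>x<k. \<forall>y<k. cmod (\<rho> W $$ (x,y) - \<rho> (emb d i j (cis t) 0) $$ (x,y)) < e)"
    by (elim exE conjE)
  have "isCont cis t" using has_vector_derivative_continuous[OF has_vector_derivative_cis[of 1 t]] by simp
  then obtain \<eta> where \<eta>: "\<eta> > 0" "\<And>s. dist s t < \<eta> \<Longrightarrow> dist (cis s) (cis t) < \<delta>"
    using \<delta> unfolding continuous_at_eps_delta by blast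
  have "dist (\<rho> (emb d i j (cis s) 0) $$ (a,b)) (\<rho> (emb d i j (cis t) 0) $$ (a,b)) < e" if s: "dist s t < \<eta>" for s
  proof -
    have "cmod (emb d i j (cis s) 0 $$ (x,y) - emb d i j (cis t) 0 $$ (x,y)) < \<delta>" if xy: "x < d" "y < d" for x y
    proof -
      have c: "cmod (cis s - cis t) < \<delta>" using \<eta>(2)[OF s] by (simp add: dist_norm)
      have c': "cmod (cnj (cis s) - cnj (cis t)) < \<delta>" using c by (metis complex_cnj_diff complex_mod_cnj)
      have other: "emb d i j (cis s) 0 $$ (x,y) = emb d i j (cis t) 0 $$ (x,y)"
        if A: "\<not> (x = i \<and> y = i)" and B: "\<not> (x = j \<and> y = j)"
        unfolding emb_index[OF xy] by (simp only: A B if_False)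
      consider "x = i \<and> y = i" | "x = j \<and> y = j" | "\<not> (x = i \<and> y = i)" "\<not> (x = j \<and> y = j)" by blast
      then show ?thesis
      proof cases
        case 1 then show ?thesis unfolding emb_index[OF xy] using c by simp
      next
        case 2 then show ?thesis unfolding emb_index[OF xy] using c' ij(3) by simp
      next
        case 3 then show ?thesis using other \<delta> by simp
      qed
    qed
    then have "\<forall>x<k. \<forall>y<k. cmod (\<rho> (emb d i j (cis s) 0) $$ (x,y) - \<rho> (emb d i j (cis t) 0) $$ (x,y)) < e"
      by (intro near[THEN bspec, OF SU[of s], THEN mp]) blast
    then show ?thesis using ab by (simp add: dist_norm)
  qed
  then show "\<exists>\<eta>>0. \<forall>s. dist s t < \<eta> \<longrightarrow> dist (\<rho> (emb d i j (cis s) 0) $$ (a,b)) (\<rho> (emb d i j (cis t) 0) $$ (a,b)) < e"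
    using \<eta>(1) by blast
qed

text \<open>The torus images commute and are closed under adjoints, the adjoint of the element at t
  being the one at - t. In a joint eigenbasis each diagonal entry is a continuous character of the
  circle and so has an integer exponent.\<close>

lemma rep_diagonalise:
  assumes rep: "cont_unitary_rep d k \<rho>"
  obtains U m where "U \<in> carrier_mat k k" "mat_adjoint U * U = 1\<^sub>m k"
    "diag_rep d k (\<lambda>G. basis_change U (\<rho> G)) m"
    "\<And>i j t. i < d \<Longrightarrow> j < d \<Longrightarrow> i \<noteq> j \<Longrightarrow>
      \<rho> (emb d i j (cis t) 0) = spectral_mat k U (\<lambda>p. cis (of_int (m p i j) * t))"
proof -
  interpret unitary_rep d k \<rho>
    by unfold_locales (use rep in \<open>auto simp: cont_unitary_rep_def\<close>)
  define F where "F = {\<rho> (emb d i j (cis t) 0) | i j t. i < d \<and> j < d \<and> i \<noteq> j}"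
  have SU: "emb d i j (cis t) 0 \<in> SU d" if "i < d" "j < d" "i \<noteq> j" for i j t
    by (rule emb_SU[OF that]) (simp add: cis_cnj cis_mult)
  have inv: "emb d i j (cis t) 0 * emb d i j (cis (- t)) 0 = 1\<^sub>m d" if "i < d" "j < d" "i \<noteq> j" for i j t
    unfolding emb_mult[OF that] using emb_one[OF that(3)] by (simp add: cis_mult)
  have "\<exists>U. U \<in> carrier_mat k k \<and> mat_adjoint U * U = 1\<^sub>m k \<and> (\<forall>M\<in>F. \<forall>j<k. \<exists>c. M *\<^sub>v col U j = c \<cdot>\<^sub>v col U j)"
  proof (rule simultaneous_diagonalisation[of F k])
    show "F \<subseteq> carrier_mat k k" unfolding F_def using rep_carrier SU by auto
    show "M * N = N * M" if MN: "M \<in> F" "N \<in> F" for M N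
    proof -
      obtain i j t i' j' t' where M: "M = \<rho> (emb d i j (cis t) 0)" "i < d" "j < d" "i \<noteq> j"
        and N: "N = \<rho> (emb d i' j' (cis t') 0)" "i' < d" "j' < d" "i' \<noteq> j'" using MN by (auto simp: F_def)
      have "emb d i j (cis t) 0 * emb d i' j' (cis t') 0 = emb d i' j' (cis t') 0 * emb d i j (cis t) 0"
        unfolding emb_eq_tor[OF M(4)] emb_eq_tor[OF N(4)] tor_mult by (rule tor_cong) simp
      then show ?thesis unfolding M(1) N(1) by (metis mult SU[OF M(2-4)] SU[OF N(2-4)])
    qed
    show "mat_adjoint M \<in> F" if MF: "M \<in> F" for M
    proof -
      obtain i j t where M: "M = \<rho> (emb d i j (cis t) 0)" "i < d" "j < d" "i \<noteq> j" using MF by (auto simp: F_def)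
      have "mat_adjoint M = \<rho> (emb d i j (cis (- t)) 0)"
        unfolding M(1) by (rule rep_inverse[OF SU[OF M(2-4)] SU[OF M(2-4)] inv[OF M(2-4)], symmetric])
      then show ?thesis using M(2-4) unfolding F_def by blast
    qed
  qed blast
  then obtain U where U: "U \<in> carrier_mat k k" "mat_adjoint U * U = 1\<^sub>m k"
    and ev: "\<And>M j. M \<in> F \<Longrightarrow> j < k \<Longrightarrow> \<exists>c. M *\<^sub>v col U j = c \<cdot>\<^sub>v col U j" by blast
  define R where "R G = basis_change U (\<rho> G)" for G
  define \<chi> where "\<chi> p i j t = R (emb d i j (cis t) 0) $$ (p,p)" for p i j t
  have spec: "\<rho> (emb d i j (cis t) 0) = spectral_mat k U (\<lambda>p. \<chi> p i j t)"
    and Rtor: "R (emb d i j (cis t) 0) = tor k (\<lambda>p. \<chi> p i j t)" if ij: "i < d" "j < d" "i \<noteq> j" for i j t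
  proof -
    let ?M = "\<rho> (emb d i j (cis t) 0)"
    have M: "?M \<in> F" using ij by (auto simp: F_def)
    define c where "c p = (SOME c. ?M *\<^sub>v col U p = c \<cdot>\<^sub>v col U p)" for p
    have c: "?M *\<^sub>v col U p = c p \<cdot>\<^sub>v col U p" if "p < k" for p
      unfolding c_def by (rule someI_ex) (rule ev[OF M that])
    have Mc: "?M = spectral_mat k U c" by (rule spectral_mat_eqI[OF U rep_carrier[OF SU[OF ij]] c])
    have R: "R (emb d i j (cis t) 0) = tor k c" unfolding R_def Mc by (rule basis_change_spectral_mat[OF U])
    have chi: "\<chi> p i j t = c p" if "p < k" for p unfolding \<chi>_def R using that by (simp add: tor_index)
    show "?M = spectral_mat k U (\<lambda>p. \<chi> p i j t)"
      unfolding Mc spectral_mat_def using chi by (intro cong_mat refl) (auto intro!: sum.cong)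
    show "R (emb d i j (cis t) 0) = tor k (\<lambda>p. \<chi> p i j t)"
      unfolding R using chi by (intro tor_cong) simp
  qed
  have Rmult: "R (G * G') = R G * R G'" if "G \<in> SU d" "G' \<in> SU d" for G G'
    unfolding R_def mult[OF that] by (rule basis_change_mult[OF U rep_carrier[OF that(1)] rep_carrier[OF that(2)], symmetric])
  have Run: "unitary_mat k (R G)" if G: "G \<in> SU d" for G
  proof -
    have g: "\<rho> G \<in> carrier_mat k k" "mat_adjoint (\<rho> G) * \<rho> G = 1\<^sub>m k" using unitary[OF G] by (auto simp: unitary_mat_def)
    show ?thesis
      unfolding unitary_mat_def R_def basis_change_adjoint[OF U(1) g(1)]
        basis_change_mult[OF U mat_adjoint_carrier[OF g(1)] g(1)] g(2) basis_change_one[OF U]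
      using basis_change_carrier[OF U(1) g(1)] by simp
  qed
  have "\<exists>n :: int. \<forall>t. \<chi> p i j t = cis (of_int n * t)" if ij: "i < d" "j < d" "i \<noteq> j" and p: "p < k" for p i j
  proof -
    have "isCont (\<chi> p i j) t" for t
      unfolding \<chi>_def R_def basis_change_index[OF U(1) rep_carrier[OF SU[OF ij]] p p]
      by (intro continuous_intros cont_rep_entry[OF rep ij]) auto
    moreover have "\<chi> p i j (s + t) = \<chi> p i j s * \<chi> p i j t" for s t
    proof -
      have "emb d i j (cis s) 0 * emb d i j (cis t) 0 = emb d i j (cis (s + t)) 0"
        unfolding emb_mult[OF ij] by (simp add: cis_mult)
      then have "R (emb d i j (cis (s + t)) 0) = R (emb d i j (cis s) 0) * R (emb d i j (cis t) 0)"
        using Rmult[OF SU[OF ij, of s] SU[OF ij, of t]] by simp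
      also have "\<dots> = tor k (\<lambda>p. \<chi> p i j s * \<chi> p i j t)" unfolding Rtor[OF ij] tor_mult ..
      finally have "R (emb d i j (cis (s + t)) 0) = tor k (\<lambda>p. \<chi> p i j s * \<chi> p i j t)" .
      then show ?thesis unfolding \<chi>_def[of p i j "s + t"] using p by (simp add: tor_index)
    qed
    moreover have one: "R (emb d i j 1 0) $$ (p,p) = 1"
      unfolding emb_one[OF ij(3)] R_def rep_one basis_change_one[OF U] using p by simp
    moreover have "\<chi> p i j 0 = 1" "\<chi> p i j (2 * pi) = 1" unfolding \<chi>_def using one by simp_all
    ultimately obtain n :: int where "\<And>t. \<chi> p i j t = cis (of_int n * t)"
      using circle_character[of "\<chi> p i j"] by metis
    then show ?thesis by blast
  qed
  then have "\<forall>p i j. \<exists>n :: int. i < d \<longrightarrow> j < d \<longrightarrow> i \<noteq> j \<longrightarrow> p < k \<longrightarrow> (\<forall>t. \<chi> p i j t = cis (of_int n * t))" by blast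
  then obtain m :: "nat \<Rightarrow> nat \<Rightarrow> nat \<Rightarrow> int" where m: "\<And>p i j t. i < d \<Longrightarrow> j < d \<Longrightarrow> i \<noteq> j \<Longrightarrow> p < k \<Longrightarrow> \<chi> p i j t = cis (of_int (m p i j) * t)"
    by metis
  have "diag_rep d k R m"
    by unfold_locales (use Run Rmult Rtor m in \<open>auto intro!: tor_cong\<close>)
  moreover have "\<rho> (emb d i j (cis t) 0) = spectral_mat k U (\<lambda>p. cis (of_int (m p i j) * t))"
    if "i < d" "j < d" "i \<noteq> j" for i j t
    unfolding spec[OF that] spectral_mat_def using m[OF that] by (intro cong_mat refl) (auto intro!: sum.cong)
  ultimately show ?thesis using that[OF U, of m] unfolding R_def by blast
qed

text \<open>\<open>J\<close> is at once a norm bound for \<open>T\<close> and, up to sign, a pairing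
  attained by a weight. The first property feeds the fidelity estimate, the second the counting of
  weights; this double role links accuracy to dimension.\<close>

theorem rep_generator:
  assumes rep: "cont_unitary_rep d k \<rho>" and d: "2 \<le> d" and k: "1 \<le> k"
  obtains T :: "nat \<Rightarrow> nat \<Rightarrow> complex" and J :: nat where
    "\<And>a b. a < k \<Longrightarrow> b < k \<Longrightarrow> ((\<lambda>t. \<rho> (emb d 0 1 (cis t) 0) $$ (a,b)) has_vector_derivative \<i> * T a b) (at 0)"
    "\<And>t a b. a < k \<Longrightarrow> b < k \<Longrightarrow> \<rho> (emb d 0 1 (cis 0) 0) $$ (a,b) = (if a = b then 1 else 0)"
    "\<And>a b. cnj (T a b) = T b a"
    "\<And>u v. cmod (\<Sum>a<k. \<Sum>b<k. cnj (u a) * T a b * v b)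
       \<le> real J * (L2_set (\<lambda>a. cmod (u a)) {..<k} * L2_set (\<lambda>a. cmod (v a)) {..<k})"
    "(d - 1 + J) choose (d - 1) \<le> k"
proof -
  obtain U m where U: "U \<in> carrier_mat k k" "mat_adjoint U * U = 1\<^sub>m k"
    and diag: "diag_rep d k (\<lambda>G. basis_change U (\<rho> G)) m"
    and spec: "\<And>i j t. i < d \<Longrightarrow> j < d \<Longrightarrow> i \<noteq> j \<Longrightarrow>
      \<rho> (emb d i j (cis t) 0) = spectral_mat k U (\<lambda>p. cis (of_int (m p i j) * t))"
    using rep_diagonalise[OF rep] by metis
  interpret diag_rep d k "\<lambda>G. basis_change U (\<rho> G)" m by (rule diag)
  have 01: "0 < d" "1 < d" "(0::nat) \<noteq> 1" using d by auto
  define M where "M = Max ((\<lambda>p. \<bar>m p 0 1\<bar>) ` {..<k})"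
  define J where "J = nat M"
  have ne: "(\<lambda>p. \<bar>m p 0 1\<bar>) ` {..<k} \<noteq> {}" using k by (auto simp: lessThan_empty_iff)
  have "M \<in> (\<lambda>p. \<bar>m p 0 1\<bar>) ` {..<k}" unfolding M_def by (rule Max_in[OF _ ne]) simp
  then obtain p0 where p0: "p0 < k" "M = \<bar>m p0 0 1\<bar>" by auto
  have J: "int J = \<bar>m p0 0 1\<bar>" unfolding J_def p0(2) by simp
  have le: "\<bar>m p 0 1\<bar> \<le> int J" if "p < k" for p
    unfolding J p0(2)[symmetric] M_def using that by auto
  define T where "T a b = (\<Sum>p<k. U $$ (a,p) * of_int (m p 0 1) * cnj (U $$ (b,p)))" for a b
  show ?thesis
  proof (rule that)
    fix a b assume ab: "a < k" "b < k"
    have "((\<lambda>t. \<Sum>p<k. U $$ (a,p) * cis (of_int (m p 0 1) * t) * cnj (U $$ (b,p))) has_vector_derivative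
       (\<Sum>p<k. U $$ (a,p) * (\<i> * of_real (of_int (m p 0 1)) * cis (of_int (m p 0 1) * 0)) * cnj (U $$ (b,p)))) (at 0)"
      by (intro has_vector_derivative_sum has_vector_derivative_mult_left has_vector_derivative_mult_right has_vector_derivative_cis)
    moreover have "(\<Sum>p<k. U $$ (a,p) * (\<i> * of_real (of_int (m p 0 1)) * cis (of_int (m p 0 1) * 0)) * cnj (U $$ (b,p))) = \<i> * T a b"
      unfolding T_def sum_distrib_left by (intro sum.cong refl) (simp add: mult_ac)
    ultimately show "((\<lambda>t. \<rho> (emb d 0 1 (cis t) 0) $$ (a,b)) has_vector_derivative \<i> * T a b) (at 0)"
      unfolding spec[OF 01] spectral_mat_index[OF ab] by simp
    show "\<rho> (emb d 0 1 (cis 0) 0) $$ (a,b) = (if a = b then 1 else 0)"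
      unfolding spec[OF 01] spectral_mat_index[OF ab] using unitary_rows[OF U ab] by simp
  next
    fix a b show "cnj (T a b) = T b a" unfolding T_def by (simp add: mult_ac)
  next
    fix u v :: "nat \<Rightarrow> complex"
    let ?u = "\<lambda>p. \<Sum>a<k. cnj (U $$ (a,p)) * u a" and ?v = "\<lambda>p. \<Sum>a<k. cnj (U $$ (a,p)) * v a"
    have "(\<Sum>a<k. \<Sum>b<k. cnj (u a) * T a b * v b)
       = (\<Sum>a<k. \<Sum>b<k. cnj (u a) * spectral_mat k U (\<lambda>p. of_int (m p 0 1)) $$ (a,b) * v b)"
      by (intro sum.cong refl) (simp add: spectral_mat_index T_def)
    also have "\<dots> = (\<Sum>p<k. of_int (m p 0 1) * (cnj (?u p) * ?v p))" by (rule spectral_mat_form)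
    finally have "cmod (\<Sum>a<k. \<Sum>b<k. cnj (u a) * T a b * v b) = cmod (\<Sum>p<k. of_int (m p 0 1) * (cnj (?u p) * ?v p))" by simp
    also have "\<dots> \<le> (\<Sum>p<k. real J * (\<bar>cmod (?u p)\<bar> * \<bar>cmod (?v p)\<bar>))"
    proof (intro order_trans[OF norm_sum] sum_mono)
      fix p assume "p \<in> {..<k}"
      then have "\<bar>real_of_int (m p 0 1)\<bar> \<le> real J" using le[of p] by (metis lessThan_iff of_int_abs of_int_le_iff of_int_of_nat_eq)
      from mult_right_mono[OF this, of "cmod (?u p) * cmod (?v p)"]
      show "cmod (of_int (m p 0 1) * (cnj (?u p) * ?v p)) \<le> real J * (\<bar>cmod (?u p)\<bar> * \<bar>cmod (?v p)\<bar>)"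
        by (simp only: norm_mult norm_of_int complex_mod_cnj abs_norm_cancel) simp
    qed
    also have "\<dots> \<le> real J * (L2_set (\<lambda>p. cmod (?u p)) {..<k} * L2_set (\<lambda>p. cmod (?v p)) {..<k})"
      unfolding sum_distrib_left[symmetric] by (intro mult_left_mono L2_set_mult_ineq) simp
    finally show "cmod (\<Sum>a<k. \<Sum>b<k. cnj (u a) * T a b * v b)
       \<le> real J * (L2_set (\<lambda>a. cmod (u a)) {..<k} * L2_set (\<lambda>a. cmod (v a)) {..<k})"
      unfolding unitary_L2_set[OF U] .
  next
    show "(d - 1 + J) choose (d - 1) \<le> k"
    proof (cases "m p0 0 1 \<ge> 0")
      case True
      then show ?thesis using dimension_ge_binomial[OF d 01 p0(1), of J] J by simp
    next
      \<comment> \<open>A negative extreme pairing becomes positive when the two coordinates are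
        exchanged.\<close>
      case False
      then show ?thesis using dimension_ge_binomial[OF d 01(2,1) 01(3)[symmetric] p0(1), of J] J weight_neg[OF 01 p0(1)] by simp
    qed
  qed
qed

section \<open>Mixed-radix digits and tensor products\<close>

locale radix =
  fixes n :: nat and d :: "nat \<Rightarrow> nat"
  assumes pos: "\<And>i. i < n \<Longrightarrow> 1 \<le> d i"
begin

abbreviation "D \<equiv> total_dim n d"
abbreviation "w \<equiv> wgt n d"
abbreviation "dig \<equiv> digit n d"
abbreviation "setd \<equiv> set_digit n d"

text \<open>Dimension of the tensor factors from \<open>i\<close> on. Inductions over the tensor
  product peel off the most significant factor.\<close>

definition suffix_dim :: "nat \<Rightarrow> nat" where
  "suffix_dim i = (\<Prod>k\<in>{i..<n}. d k)"

lemma w_suffix: "w i = suffix_dim (Suc i)"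
  unfolding wgt_def suffix_dim_def by (rule prod.cong) auto

lemma suffix_dim_step: "i < n \<Longrightarrow> suffix_dim i = d i * w i"
  unfolding w_suffix suffix_dim_def by (rule prod.atLeast_Suc_lessThan)

lemma D_suffix: "D = suffix_dim 0"
  unfolding total_dim_def suffix_dim_def by (simp add: atLeast0LessThan)

lemma w_pos: "0 < w i"
  unfolding wgt_def using pos by (auto simp: prod_pos Suc_le_eq)

lemma d_pos: "i < n \<Longrightarrow> 0 < d i"
  using pos[of i] by simp

lemma D_pos: "0 < D"
  unfolding total_dim_def using pos by (auto simp: prod_pos Suc_le_eq)

lemma suffix_dim_split: "i \<le> j \<Longrightarrow> j \<le> n \<Longrightarrow> suffix_dim i = (\<Prod>k\<in>{i..<j}. d k) * suffix_dim j"
  unfolding suffix_dim_def by (rule prod.atLeastLessThan_concat[symmetric])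

lemma w_multiple:
  assumes "i < j" "j < n"
  obtains M where "w i = M * (d j * w j)"
proof -
  have "w i = (\<Prod>k\<in>{Suc i..<j}. d k) * (d j * w j)"
    unfolding suffix_dim_step[OF assms(2), symmetric] w_suffix[of i]
    by (rule suffix_dim_split) (use assms in auto)
  then show ?thesis using that by blast
qed

lemma digit_mod:
  assumes "i < j" "j < n"
  shows "dig j (x mod w i) = dig j x"
proof -
  obtain M where M: "w i = M * (d j * w j)" using w_multiple[OF assms] .
  have "x mod (w j * (d j * M)) = w j * (x div w j mod (d j * M)) + x mod w j" by (rule mod_mult2_eq)
  then have "x mod w i div w j = (w j * (x div w j mod (d j * M)) + x mod w j) div w j"
    unfolding M by (simp only: mult_ac)
  also have "\<dots> = x div w j mod (d j * M)" using w_pos[of j] by simp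
  finally show ?thesis unfolding digit_def by (simp add: mod_mod_cancel)
qed

lemma digit_div:
  assumes "j < i" "i < n"
  shows "dig j x = dig j (x div (d i * w i) * (d i * w i))"
proof -
  obtain M where M: "w j = M * (d i * w i)" using w_multiple[OF assms] .
  have p: "0 < d i * w i" using w_pos[of i] d_pos[OF assms(2)] by simp
  have "x div w j = x div (d i * w i) div M" for x unfolding M by (metis div_mult2_eq mult.commute)
  then show ?thesis unfolding digit_def using p by simp
qed

lemma digit_less: "i < n \<Longrightarrow> dig i x < d i"
  unfolding digit_def using d_pos by simp

lemma set_digit_eq:
  assumes i: "i < n"
  shows "setd i x \<kappa> = w i * (d i * (x div (d i * w i)) + \<kappa>) + x mod w i"
proof -
  have "x = w i * (x div w i) + x mod w i" by simp
  also have "x div w i = d i * (x div w i div d i) + dig i x" unfolding digit_def by simp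
  also have "x div w i div d i = x div (d i * w i)" by (metis div_mult2_eq mult.commute)
  finally have "x = w i * (d i * (x div (d i * w i))) + dig i x * w i + x mod w i"
    by (simp add: algebra_simps)
  then have "x - dig i x * w i = w i * (d i * (x div (d i * w i))) + x mod w i" by linarith
  then show ?thesis unfolding set_digit_def by (simp add: algebra_simps)
qed

lemma set_digit_div_mod:
  assumes i: "i < n" and k: "\<kappa> < d i"
  shows "setd i x \<kappa> div w i = d i * (x div (d i * w i)) + \<kappa>" "setd i x \<kappa> mod w i = x mod w i"
    "setd i x \<kappa> div (d i * w i) = x div (d i * w i)"
proof -
  show 1: "setd i x \<kappa> div w i = d i * (x div (d i * w i)) + \<kappa>" "setd i x \<kappa> mod w i = x mod w i"
    unfolding set_digit_eq[OF i] using w_pos[of i] by simp_all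
  have "setd i x \<kappa> div (d i * w i) = setd i x \<kappa> div w i div d i" by (metis div_mult2_eq mult.commute)
  then show "setd i x \<kappa> div (d i * w i) = x div (d i * w i)" unfolding 1 using k by simp
qed

lemma digit_set_same: "i < n \<Longrightarrow> \<kappa> < d i \<Longrightarrow> dig i (setd i x \<kappa>) = \<kappa>"
  unfolding digit_def by (simp add: set_digit_div_mod)

lemma digit_set_other:
  assumes "i < n" "j < n" "j \<noteq> i" "\<kappa> < d i"
  shows "dig j (setd i x \<kappa>) = dig j x"
proof (cases "i < j")
  case True
  then show ?thesis using digit_mod[OF True assms(2), of "setd i x \<kappa>"] digit_mod[OF True assms(2), of x]
      set_digit_div_mod(2)[OF assms(1,4)] by simp
next
  case False
  then have "j < i" using assms by simp
  then show ?thesis using digit_div[of j i "setd i x \<kappa>"] digit_div[of j i x] assms(1)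
      set_digit_div_mod(3)[OF assms(1,4)] by simp
qed

lemma set_digit_less:
  assumes i: "i < n" and k: "\<kappa> < d i" and x: "x < D"
  shows "setd i x \<kappa> < D"
proof -
  define M where "M = (\<Prod>k\<in>{0..<i}. d k)"
  have D: "D = M * (d i * w i)"
    unfolding D_suffix M_def suffix_dim_step[OF i, symmetric] by (rule suffix_dim_split) (use i in auto)
  have "x div (d i * w i) < M" using x unfolding D by (rule less_mult_imp_div_less)
  then have "setd i x \<kappa> div (d i * w i) < M" using set_digit_div_mod(3)[OF i k] by simp
  moreover have "0 < d i * w i" using w_pos[of i] d_pos[OF i] by simp
  ultimately show ?thesis unfolding D by (simp add: div_less_iff_less_mult)
qed

lemma set_digit_self:
  assumes "i < n"
  shows "setd i x (dig i x) = x"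
proof -
  have "dig i x * w i \<le> x div w i * w i" unfolding digit_def by (intro mult_le_mono1 mod_less_eq_dividend)
  also have "\<dots> \<le> x" by (rule div_times_less_eq_dividend)
  finally show ?thesis by (simp add: set_digit_def)
qed

lemma set_digit_twice: "i < n \<Longrightarrow> \<kappa> < d i \<Longrightarrow> setd i (setd i x \<kappa>) \<kappa>' = setd i x \<kappa>'"
  by (simp add: set_digit_eq[of i "setd i x \<kappa>"] set_digit_eq[of i x \<kappa>'] set_digit_div_mod)

lemma digits_inject_suffix:
  assumes "i \<le> n" "x < suffix_dim i" "y < suffix_dim i" "\<And>j. i \<le> j \<Longrightarrow> j < n \<Longrightarrow> dig j x = dig j y"
  shows "x = y"
  using assms
proof (induction i arbitrary: x y rule: inc_induct)
  case base
  then show ?case by (simp add: suffix_dim_def)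
next
  case (step i)
  have i: "i < n" using step by simp
  have "x mod w i = y mod w i"
  proof (rule step.IH)
    show "x mod w i < suffix_dim (Suc i)" "y mod w i < suffix_dim (Suc i)"
      unfolding w_suffix[symmetric] using w_pos by simp_all
    fix j assume j: "Suc i \<le> j" "j < n"
    then show "dig j (x mod w i) = dig j (y mod w i)"
      using digit_mod[of i j] step.prems(3)[of j] by simp
  qed
  moreover have "x div w i = y div w i"
  proof -
    have "x div w i < d i" "y div w i < d i" using step.prems(1,2) unfolding suffix_dim_step[OF i]
      by (simp_all add: less_mult_imp_div_less)
    then show ?thesis using step.prems(3)[of i] i unfolding digit_def by simp
  qed
  ultimately show ?case by (metis div_mult_mod_eq)
qed

lemma digits_inject:
  assumes "x < D" "y < D" "\<And>j. j < n \<Longrightarrow> dig j x = dig j y"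
  shows "x = y"
  by (rule digits_inject_suffix[of 0]) (use assms in \<open>auto simp: D_suffix\<close>)

text \<open>Backward induction along \<open>foldr\<close>: the head factor carries the most
  significant digit, and quotient and remainder by \<open>w i\<close> separate it from the
  rest.\<close>

lemma kron_list_suffix:
  assumes A: "\<And>j. j < n \<Longrightarrow> A j \<in> carrier_mat (d j) (d j)" and i: "i \<le> n"
  shows "kron_list (map A [i..<n]) \<in> carrier_mat (suffix_dim i) (suffix_dim i) \<and>
    (\<forall>x<suffix_dim i. \<forall>y<suffix_dim i. kron_list (map A [i..<n]) $$ (x,y) = (\<Prod>j\<in>{i..<n}. A j $$ (dig j x, dig j y)))"
  using i
proof (induction i rule: inc_induct)
  case base
  then show ?case by (simp add: kron_list_def suffix_dim_def)
next
  case (step i)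
  have i: "i < n" using step by simp
  let ?K = "kron_list (map A [Suc i..<n])"
  have K: "?K \<in> carrier_mat (w i) (w i)" and
    Kxy: "\<And>x y. x < w i \<Longrightarrow> y < w i \<Longrightarrow> ?K $$ (x,y) = (\<Prod>j\<in>{Suc i..<n}. A j $$ (dig j x, dig j y))"
    using step.IH unfolding w_suffix[symmetric] by auto
  have eq: "kron_list (map A [i..<n]) = kron (A i) ?K"
    using i by (simp add: kron_list_def upt_conv_Cons)
  have Ai: "A i \<in> carrier_mat (d i) (d i)" by (rule A[OF i])
  have entry: "kron (A i) ?K $$ (x,y) = (\<Prod>j\<in>{i..<n}. A j $$ (dig j x, dig j y))"
    if xy: "x < d i * w i" "y < d i * w i" for x y
  proof -
    have div: "x div w i < d i" "y div w i < d i" using xy by (simp_all add: less_mult_imp_div_less)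
    have "kron (A i) ?K $$ (x,y) = A i $$ (x div w i, y div w i) * ?K $$ (x mod w i, y mod w i)"
      unfolding kron_def using xy Ai K by auto
    also have "?K $$ (x mod w i, y mod w i) = (\<Prod>j\<in>{Suc i..<n}. A j $$ (dig j (x mod w i), dig j (y mod w i)))"
      by (rule Kxy) (use w_pos in auto)
    also have "\<dots> = (\<Prod>j\<in>{Suc i..<n}. A j $$ (dig j x, dig j y))"
      by (intro prod.cong refl) (simp add: digit_mod)
    also have "A i $$ (x div w i, y div w i) = A i $$ (dig i x, dig i y)" using div unfolding digit_def by simp
    finally show ?thesis using i by (simp add: prod.atLeast_Suc_lessThan)
  qed
  show ?case unfolding eq suffix_dim_step[OF i] using entry Ai K by (auto simp: kron_def)
qed

lemma kron_list_index:
  assumes "\<And>j. j < n \<Longrightarrow> A j \<in> carrier_mat (d j) (d j)"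
  shows "kron_list (map A [0..<n]) \<in> carrier_mat D D"
    "x < D \<Longrightarrow> y < D \<Longrightarrow> kron_list (map A [0..<n]) $$ (x,y) = (\<Prod>j<n. A j $$ (dig j x, dig j y))"
  using kron_list_suffix[of A 0, OF assms] by (auto simp: D_suffix atLeast0LessThan)

text \<open>Indices whose \<open>i\<close>-th digit is 0 serve as labels for the configurations of
  all other factors.\<close>

lemma sum_digit_split:
  fixes f :: "nat \<Rightarrow> complex"
  assumes i: "i < n"
  shows "(\<Sum>x<D. f x) = (\<Sum>x\<in>{x. x < D \<and> dig i x = 0}. \<Sum>\<kappa><d i. f (setd i x \<kappa>))"
proof -
  have "(\<Sum>x\<in>{x. x < D \<and> dig i x = 0}. \<Sum>\<kappa><d i. f (setd i x \<kappa>))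
      = (\<Sum>(x,\<kappa>)\<in>{x. x < D \<and> dig i x = 0} \<times> {..<d i}. f (setd i x \<kappa>))"
    by (rule sum.cartesian_product)
  also have "\<dots> = (\<Sum>x<D. f x)"
    by (rule sum.reindex_bij_witness[where i = "\<lambda>x. (setd i x 0, dig i x)" and j = "\<lambda>(x,\<kappa>). setd i x \<kappa>"])
      (use i d_pos[OF i] set_digit_self[OF i] in
        \<open>auto simp: digit_set_same set_digit_less digit_less set_digit_twice\<close>, metis set_digit_self)
  finally show ?thesis ..
qed

text \<open>The product is the entry of the identity on all factors but the \<open>i\<close>-th, so
  only indices that agree with \<open>x\<close> there survive.\<close>

lemma sum_other_digits_fixed:
  fixes f :: "nat \<Rightarrow> complex"
  assumes i: "i < n" and x: "x < D"
  shows "(\<Sum>y<D. (\<Prod>j\<in>{..<n} - {i}. if dig j x = dig j y then 1 else 0) * f y) = (\<Sum>\<kappa><d i. f (setd i x \<kappa>))"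
proof -
  let ?Y = "{y. y < D \<and> (\<forall>j<n. j \<noteq> i \<longrightarrow> dig j x = dig j y)}"
  have prod: "(\<Prod>j\<in>{..<n} - {i}. if dig j x = dig j y then 1 else 0) = (if \<forall>j<n. j \<noteq> i \<longrightarrow> dig j x = dig j y then 1 else (0 :: complex))" for y
    by (auto intro!: prod.neutral prod_zero)
  have "(\<Sum>y<D. (\<Prod>j\<in>{..<n} - {i}. if dig j x = dig j y then 1 else 0) * f y) = (\<Sum>y\<in>?Y. f y)"
    unfolding prod by (rule sum.mono_neutral_cong_right) auto
  also have "\<dots> = (\<Sum>\<kappa><d i. f (setd i x \<kappa>))"
  proof (rule sum.reindex_bij_witness[where i = "setd i x" and j = "dig i"])
    fix y assume y: "y \<in> ?Y"
    show "setd i x (dig i y) = y"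
    proof (rule digits_inject)
      show "setd i x (dig i y) < D" using set_digit_less[OF i digit_less[OF i] x] .
      show "y < D" using y by simp
      fix j assume j: "j < n"
      show "dig j (setd i x (dig i y)) = dig j y"
        using y j digit_set_same[OF i digit_less[OF i]] digit_set_other[OF i j _ digit_less[OF i]]
        by (cases "j = i") auto
    qed
    then show "f (setd i x (dig i y)) = f y" by simp
    show "dig i y \<in> {..<d i}" using digit_less[OF i] by simp
  next
    fix \<kappa> assume "\<kappa> \<in> {..<d i}"
    then have k: "\<kappa> < d i" by simp
    show "dig i (setd i x \<kappa>) = \<kappa>" by (rule digit_set_same[OF i k])
    show "setd i x \<kappa> \<in> ?Y" using set_digit_less[OF i k x] digit_set_other[OF i _ _ k] by auto
  qed
  finally show ?thesis .
qed

text \<open>The product rule at the identity: a tensor product of curves through the identity has as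
  derivative the sum of the one-site generators.\<close>

lemma kron_list_form_deriv:
  fixes A :: "real \<Rightarrow> nat \<Rightarrow> complex mat" and f g :: "nat \<Rightarrow> complex"
  assumes A: "\<And>t j. j < n \<Longrightarrow> A t j \<in> carrier_mat (d j) (d j)"
    and one: "\<And>j a b. j < n \<Longrightarrow> a < d j \<Longrightarrow> b < d j \<Longrightarrow> A 0 j $$ (a,b) = (if a = b then 1 else 0)"
    and der: "\<And>j a b. j < n \<Longrightarrow> a < d j \<Longrightarrow> b < d j \<Longrightarrow> ((\<lambda>t. A t j $$ (a,b)) has_vector_derivative \<i> * T j a b) (at 0)"
  shows "((\<lambda>t. \<Sum>x<D. \<Sum>y<D. f x * kron_list (map (A t) [0..<n]) $$ (x,y) * g y) has_vector_derivative
      \<i> * (\<Sum>i<n. \<Sum>x\<in>{x. x < D \<and> dig i x = 0}. \<Sum>\<kappa><d i. \<Sum>\<kappa>'<d i. f (setd i x \<kappa>) * T i \<kappa> \<kappa>' * g (setd i x \<kappa>'))) (at 0)"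
    and "(\<Sum>x<D. \<Sum>y<D. f x * kron_list (map (A 0) [0..<n]) $$ (x,y) * g y) = (\<Sum>x<D. f x * g x)"
proof -
  have index: "kron_list (map (A t) [0..<n]) $$ (x,y) = (\<Prod>j<n. A t j $$ (dig j x, dig j y))" if "x < D" "y < D" for t x y
    by (rule kron_list_index(2)) (use A that in auto)
  have entry: "((\<lambda>t. kron_list (map (A t) [0..<n]) $$ (x,y)) has_vector_derivative
      (\<Sum>i<n. \<i> * T i (dig i x) (dig i y) * (\<Prod>j\<in>{..<n} - {i}. if dig j x = dig j y then 1 else 0))) (at 0)"
    if xy: "x < D" "y < D" for x y
  proof -
    have "((\<lambda>t. \<Prod>j<n. A t j $$ (dig j x, dig j y)) has_derivative
        (\<lambda>h. \<Sum>i<n. h *\<^sub>R (\<i> * T i (dig i x) (dig i y)) * (\<Prod>j\<in>{..<n} - {i}. A 0 j $$ (dig j x, dig j y)))) (at 0)"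
      by (rule has_derivative_prod) (use der digit_less in \<open>auto simp: has_vector_derivative_def\<close>)
    moreover have "(\<Prod>j\<in>{..<n} - {i}. A 0 j $$ (dig j x, dig j y)) = (\<Prod>j\<in>{..<n} - {i}. if dig j x = dig j y then 1 else 0)" for i
      by (intro prod.cong refl) (use one digit_less in auto)
    ultimately show ?thesis unfolding has_vector_derivative_def index[OF xy]
      by (simp add: scaleR_sum_right)
  qed
  have "((\<lambda>t. \<Sum>x<D. \<Sum>y<D. f x * kron_list (map (A t) [0..<n]) $$ (x,y) * g y) has_vector_derivative
      (\<Sum>x<D. \<Sum>y<D. f x * (\<Sum>i<n. \<i> * T i (dig i x) (dig i y) * (\<Prod>j\<in>{..<n} - {i}. if dig j x = dig j y then 1 else 0)) * g y)) (at 0)"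
    by (intro has_vector_derivative_sum has_vector_derivative_mult_left has_vector_derivative_mult_right entry) auto
  moreover have "(\<Sum>x<D. \<Sum>y<D. f x * (\<Sum>i<n. \<i> * T i (dig i x) (dig i y) * (\<Prod>j\<in>{..<n} - {i}. if dig j x = dig j y then 1 else 0)) * g y)
     = \<i> * (\<Sum>i<n. \<Sum>x\<in>{x. x < D \<and> dig i x = 0}. \<Sum>\<kappa><d i. \<Sum>\<kappa>'<d i. f (setd i x \<kappa>) * T i \<kappa> \<kappa>' * g (setd i x \<kappa>'))"
  proof -
    have "(\<Sum>x<D. \<Sum>y<D. f x * (\<Sum>i<n. \<i> * T i (dig i x) (dig i y) * (\<Prod>j\<in>{..<n} - {i}. if dig j x = dig j y then 1 else 0)) * g y)
      = (\<Sum>x<D. \<Sum>y<D. \<Sum>i<n. \<i> * ((\<Prod>j\<in>{..<n} - {i}. if dig j x = dig j y then 1 else 0) * (f x * T i (dig i x) (dig i y) * g y)))"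
      unfolding sum_distrib_left sum_distrib_right by (intro sum.cong refl) (simp only: mult_ac)
    also have "\<dots> = (\<Sum>x<D. \<Sum>i<n. \<Sum>y<D. \<i> * ((\<Prod>j\<in>{..<n} - {i}. if dig j x = dig j y then 1 else 0) * (f x * T i (dig i x) (dig i y) * g y)))"
      by (rule sum.cong[OF refl], rule sum.swap)
    also have "\<dots> = (\<Sum>i<n. \<Sum>x<D. \<Sum>y<D. \<i> * ((\<Prod>j\<in>{..<n} - {i}. if dig j x = dig j y then 1 else 0) * (f x * T i (dig i x) (dig i y) * g y)))"
      by (rule sum.swap)
    also have "\<dots> = (\<Sum>i<n. \<i> * (\<Sum>x\<in>{x. x < D \<and> dig i x = 0}. \<Sum>\<kappa><d i. \<Sum>\<kappa>'<d i. f (setd i x \<kappa>) * T i \<kappa> \<kappa>' * g (setd i x \<kappa>')))"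
    proof (rule sum.cong[OF refl])
      fix i assume "i \<in> {..<n}"
      then have i: "i < n" by simp
      have "(\<Sum>x<D. \<Sum>y<D. \<i> * ((\<Prod>j\<in>{..<n} - {i}. if dig j x = dig j y then 1 else 0) * (f x * T i (dig i x) (dig i y) * g y)))
        = \<i> * (\<Sum>x<D. \<Sum>\<kappa>'<d i. f x * T i (dig i x) (dig i (setd i x \<kappa>')) * g (setd i x \<kappa>'))"
        unfolding sum_distrib_left[symmetric] using sum_other_digits_fixed[OF i] by simp
      also have "(\<Sum>x<D. \<Sum>\<kappa>'<d i. f x * T i (dig i x) (dig i (setd i x \<kappa>')) * g (setd i x \<kappa>'))
        = (\<Sum>x\<in>{x. x < D \<and> dig i x = 0}. \<Sum>\<kappa><d i. \<Sum>\<kappa>'<d i. f (setd i x \<kappa>) * T i \<kappa> \<kappa>' * g (setd i x \<kappa>'))"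
        unfolding sum_digit_split[OF i]
        by (intro sum.cong refl) (simp add: digit_set_same[OF i] set_digit_twice[OF i])
      finally show "(\<Sum>x<D. \<Sum>y<D. \<i> * ((\<Prod>j\<in>{..<n} - {i}. if dig j x = dig j y then 1 else 0) * (f x * T i (dig i x) (dig i y) * g y)))
        = \<i> * (\<Sum>x\<in>{x. x < D \<and> dig i x = 0}. \<Sum>\<kappa><d i. \<Sum>\<kappa>'<d i. f (setd i x \<kappa>) * T i \<kappa> \<kappa>' * g (setd i x \<kappa>'))" .
    qed
    finally show ?thesis unfolding sum_distrib_left .
  qed
  ultimately show "((\<lambda>t. \<Sum>x<D. \<Sum>y<D. f x * kron_list (map (A t) [0..<n]) $$ (x,y) * g y) has_vector_derivative
      \<i> * (\<Sum>i<n. \<Sum>x\<in>{x. x < D \<and> dig i x = 0}. \<Sum>\<kappa><d i. \<Sum>\<kappa>'<d i. f (setd i x \<kappa>) * T i \<kappa> \<kappa>' * g (setd i x \<kappa>'))) (at 0)"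
    by simp
  have "kron_list (map (A 0) [0..<n]) $$ (x,y) = (if y = x then 1 else 0)" if xy: "x < D" "y < D" for x y
  proof -
    have "kron_list (map (A 0) [0..<n]) $$ (x,y) = (\<Prod>j<n. if dig j x = dig j y then 1 else 0)"
      unfolding index[OF xy] using one digit_less by (intro prod.cong refl) auto
    also have "\<dots> = (if y = x then 1 else 0)"
      using digits_inject[OF xy] by (auto intro!: prod.neutral prod_zero)
    finally show ?thesis .
  qed
  then have "(\<Sum>x<D. \<Sum>y<D. f x * kron_list (map (A 0) [0..<n]) $$ (x,y) * g y) = (\<Sum>x<D. \<Sum>y<D. if y = x then f x * g x else 0)"
    by (intro sum.cong refl) auto
  then show "(\<Sum>x<D. \<Sum>y<D. f x * kron_list (map (A 0) [0..<n]) $$ (x,y) * g y) = (\<Sum>x<D. f x * g x)"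
    by simp
qed

end

section \<open>Kraus families and the fidelity of a channel with the identity\<close>

text \<open>The index set plays the role of an environment basis. It may have any type, so that in a
  composition the labels of noise and recovery stay visible as separate components.\<close>

definition kraus_rep :: "nat \<Rightarrow> nat \<Rightarrow> 'a set \<Rightarrow> ('a \<Rightarrow> nat \<Rightarrow> nat \<Rightarrow> complex) \<Rightarrow> (complex mat \<Rightarrow> complex mat) \<Rightarrow> bool" where
  "kraus_rep din dout A K \<Phi> \<longleftrightarrow> finite A \<and> (\<forall>\<rho> \<in> carrier_mat din din. \<Phi> \<rho> \<in> carrier_mat dout dout \<and>
     (\<forall>l<dout. \<forall>l'<dout. \<Phi> \<rho> $$ (l,l') = (\<Sum>a\<in>A. \<Sum>k<din. \<Sum>k'<din. K a l k * \<rho> $$ (k,k') * cnj (K a l' k'))))"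

definition kraus_tp :: "nat \<Rightarrow> nat \<Rightarrow> 'a set \<Rightarrow> ('a \<Rightarrow> nat \<Rightarrow> nat \<Rightarrow> complex) \<Rightarrow> bool" where
  "kraus_tp din dout A K \<longleftrightarrow> (\<forall>k<din. \<forall>k'<din.
     (\<Sum>a\<in>A. \<Sum>l<dout. cnj (K a l k) * K a l k') = (if k = k' then 1 else 0))"

definition kraus_comp :: "nat \<Rightarrow> ('b \<Rightarrow> nat \<Rightarrow> nat \<Rightarrow> complex) \<Rightarrow> ('a \<Rightarrow> nat \<Rightarrow> nat \<Rightarrow> complex) \<Rightarrow> 'b \<times> 'a \<Rightarrow> nat \<Rightarrow> nat \<Rightarrow> complex" where
  "kraus_comp d2 L K z l k = (\<Sum>m<d2. L (fst z) l m * K (snd z) m k)"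

lemma sum_Times:
  fixes f :: "'a \<times> 'b \<Rightarrow> 'c :: comm_monoid_add"
  shows "(\<Sum>z\<in>A \<times> B. f z) = (\<Sum>a\<in>A. \<Sum>b\<in>B. f (a,b))"
  by (simp add: sum.cartesian_product case_prod_unfold)

lemma sum_swap_pairs:
  "(\<Sum>m\<in>M. \<Sum>m'\<in>M'. \<Sum>k\<in>K. \<Sum>k'\<in>K'. f m m' k k') = (\<Sum>k\<in>K. \<Sum>k'\<in>K'. \<Sum>m\<in>M. \<Sum>m'\<in>M'. f m m' k k' :: complex)"
proof -
  have "(\<Sum>m\<in>M. \<Sum>m'\<in>M'. \<Sum>k\<in>K. \<Sum>k'\<in>K'. f m m' k k') = (\<Sum>m\<in>M. \<Sum>k\<in>K. \<Sum>k'\<in>K'. \<Sum>m'\<in>M'. f m m' k k')"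
    by (rule sum.cong[OF refl], subst sum.swap, rule sum.cong[OF refl], rule sum.swap)
  also have "\<dots> = (\<Sum>k\<in>K. \<Sum>k'\<in>K'. \<Sum>m\<in>M. \<Sum>m'\<in>M'. f m m' k k')"
    by (subst sum.swap, rule sum.cong[OF refl], rule sum.swap)
  finally show ?thesis .
qed

lemma kraus_rep_comp:
  assumes K: "kraus_rep d1 d2 A K \<Phi>" and L: "kraus_rep d2 d3 B L \<Psi>"
  shows "kraus_rep d1 d3 (B \<times> A) (kraus_comp d2 L K) (\<Psi> \<circ> \<Phi>)"
  unfolding kraus_rep_def
proof (intro conjI ballI allI impI)
  show "finite (B \<times> A)" using K L by (auto simp: kraus_rep_def)
  fix \<rho> :: "complex mat" assume rho: "\<rho> \<in> carrier_mat d1 d1"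
  have P: "\<Phi> \<rho> \<in> carrier_mat d2 d2"
    and Pe: "\<And>l l'. l < d2 \<Longrightarrow> l' < d2 \<Longrightarrow> \<Phi> \<rho> $$ (l,l') = (\<Sum>a\<in>A. \<Sum>k<d1. \<Sum>k'<d1. K a l k * \<rho> $$ (k,k') * cnj (K a l' k'))"
    using K rho by (auto simp: kraus_rep_def)
  have Q: "\<Psi> (\<Phi> \<rho>) \<in> carrier_mat d3 d3"
    and Qe: "\<And>l l'. l < d3 \<Longrightarrow> l' < d3 \<Longrightarrow> \<Psi> (\<Phi> \<rho>) $$ (l,l') = (\<Sum>b\<in>B. \<Sum>m<d2. \<Sum>m'<d2. L b l m * \<Phi> \<rho> $$ (m,m') * cnj (L b l' m'))"
    using L P by (auto simp: kraus_rep_def)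
  show "(\<Psi> \<circ> \<Phi>) \<rho> \<in> carrier_mat d3 d3" using Q by simp
  fix l l' assume l: "l < d3" "l' < d3"
  have "(\<Psi> \<circ> \<Phi>) \<rho> $$ (l,l') = (\<Sum>b\<in>B. \<Sum>m<d2. \<Sum>m'<d2. L b l m * \<Phi> \<rho> $$ (m,m') * cnj (L b l' m'))"
    using Qe[OF l] by simp
  also have "\<dots> = (\<Sum>b\<in>B. \<Sum>a\<in>A. \<Sum>k<d1. \<Sum>k'<d1. kraus_comp d2 L K (b,a) l k * \<rho> $$ (k,k') * cnj (kraus_comp d2 L K (b,a) l' k'))"
  proof (rule sum.cong[OF refl])
    fix b
    have "(\<Sum>m<d2. \<Sum>m'<d2. L b l m * \<Phi> \<rho> $$ (m,m') * cnj (L b l' m'))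
      = (\<Sum>m<d2. \<Sum>m'<d2. \<Sum>a\<in>A. \<Sum>k<d1. \<Sum>k'<d1. (L b l m * K a m k) * \<rho> $$ (k,k') * cnj (L b l' m' * K a m' k'))"
      by (intro sum.cong refl) (simp add: Pe sum_distrib_left sum_distrib_right mult_ac)
    also have "\<dots> = (\<Sum>m<d2. \<Sum>a\<in>A. \<Sum>m'<d2. \<Sum>k<d1. \<Sum>k'<d1. (L b l m * K a m k) * \<rho> $$ (k,k') * cnj (L b l' m' * K a m' k'))"
      by (rule sum.cong[OF refl], rule sum.swap)
    also have "\<dots> = (\<Sum>a\<in>A. \<Sum>m<d2. \<Sum>m'<d2. \<Sum>k<d1. \<Sum>k'<d1. (L b l m * K a m k) * \<rho> $$ (k,k') * cnj (L b l' m' * K a m' k'))"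
      by (rule sum.swap)
    also have "\<dots> = (\<Sum>a\<in>A. \<Sum>k<d1. \<Sum>k'<d1. \<Sum>m<d2. \<Sum>m'<d2. (L b l m * K a m k) * \<rho> $$ (k,k') * cnj (L b l' m' * K a m' k'))"
      by (rule sum.cong[OF refl], rule sum_swap_pairs)
    also have "\<dots> = (\<Sum>a\<in>A. \<Sum>k<d1. \<Sum>k'<d1. kraus_comp d2 L K (b,a) l k * \<rho> $$ (k,k') * cnj (kraus_comp d2 L K (b,a) l' k'))"
      unfolding kraus_comp_def fst_conv snd_conv cnj_sum sum_distrib_left sum_distrib_right
      by (rule sum.cong[OF refl], rule sum.cong[OF refl], rule sum.cong[OF refl], rule sum.swap)
    finally show "(\<Sum>m<d2. \<Sum>m'<d2. L b l m * \<Phi> \<rho> $$ (m,m') * cnj (L b l' m'))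
      = (\<Sum>a\<in>A. \<Sum>k<d1. \<Sum>k'<d1. kraus_comp d2 L K (b,a) l k * \<rho> $$ (k,k') * cnj (kraus_comp d2 L K (b,a) l' k'))" .
  qed
  also have "\<dots> = (\<Sum>z\<in>B \<times> A. \<Sum>k<d1. \<Sum>k'<d1. kraus_comp d2 L K z l k * \<rho> $$ (k,k') * cnj (kraus_comp d2 L K z l' k'))"
    by (simp only: sum_Times)
  finally show "(\<Psi> \<circ> \<Phi>) \<rho> $$ (l,l') = (\<Sum>z\<in>B \<times> A. \<Sum>k<d1. \<Sum>k'<d1. kraus_comp d2 L K z l k * \<rho> $$ (k,k') * cnj (kraus_comp d2 L K z l' k'))" .
qed

text \<open>Trace preservation read as preservation of inner products by the Stinespring isometry.
  It later removes the recovery from the environment correlations.\<close>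

lemma kraus_tp_inner:
  assumes "kraus_tp din dout B L"
  shows "(\<Sum>b\<in>B. \<Sum>l<dout. cnj (\<Sum>m<din. L b l m * u m) * (\<Sum>m<din. L b l m * v m)) = (\<Sum>m<din. cnj (u m) * v m)"
proof -
  have "(\<Sum>b\<in>B. \<Sum>l<dout. cnj (\<Sum>m<din. L b l m * u m) * (\<Sum>m<din. L b l m * v m))
    = (\<Sum>b\<in>B. \<Sum>l<dout. \<Sum>m<din. \<Sum>m'<din. cnj (u m) * v m' * (cnj (L b l m) * L b l m'))"
    unfolding cnj_sum sum_product by (intro sum.cong refl) (simp add: mult_ac)
  also have "\<dots> = (\<Sum>m<din. \<Sum>m'<din. cnj (u m) * v m' * (\<Sum>b\<in>B. \<Sum>l<dout. cnj (L b l m) * L b l m'))"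
    unfolding sum_distrib_left by (rule sum_swap_pairs)
  also have "\<dots> = (\<Sum>m<din. \<Sum>m'<din. if m' = m then cnj (u m) * v m else 0)"
    using assms unfolding kraus_tp_def by (intro sum.cong refl) auto
  finally show ?thesis by simp
qed

lemma kraus_tp_comp:
  assumes K: "kraus_tp d1 d2 A K" and L: "kraus_tp d2 d3 B L"
  shows "kraus_tp d1 d3 (B \<times> A) (kraus_comp d2 L K)"
  unfolding kraus_tp_def
proof (intro allI impI)
  fix k k' assume k: "k < d1" "k' < d1"
  have "(\<Sum>z\<in>B \<times> A. \<Sum>l<d3. cnj (kraus_comp d2 L K z l k) * kraus_comp d2 L K z l k')
    = (\<Sum>b\<in>B. \<Sum>a\<in>A. \<Sum>l<d3. cnj (kraus_comp d2 L K (b,a) l k) * kraus_comp d2 L K (b,a) l k')"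
    by (rule sum_Times)
  also have "\<dots> = (\<Sum>a\<in>A. \<Sum>b\<in>B. \<Sum>l<d3. cnj (kraus_comp d2 L K (b,a) l k) * kraus_comp d2 L K (b,a) l k')"
    by (rule sum.swap)
  also have "\<dots> = (\<Sum>a\<in>A. \<Sum>m<d2. cnj (K a m k) * K a m k')"
    unfolding kraus_comp_def fst_conv snd_conv by (rule sum.cong[OF refl], rule kraus_tp_inner[OF L])
  finally show "(\<Sum>z\<in>B \<times> A. \<Sum>l<d3. cnj (kraus_comp d2 L K z l k) * kraus_comp d2 L K z l k') = (if k = k' then 1 else 0)"
    using K k by (simp add: kraus_tp_def)
qed

lemma conjugation_index:
  assumes K: "K \<in> carrier_mat dout din" and rho: "\<rho> \<in> carrier_mat din din" and l: "l < dout" "l' < dout"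
  shows "(K * \<rho> * mat_adjoint K) $$ (l,l') = (\<Sum>k<din. \<Sum>k'<din. K $$ (l,k) * \<rho> $$ (k,k') * cnj (K $$ (l',k')))"
proof -
  have "(K * \<rho> * mat_adjoint K) $$ (l,l') = (\<Sum>k'<din. (\<Sum>k<din. K $$ (l,k) * \<rho> $$ (k,k')) * cnj (K $$ (l',k')))"
    unfolding mult_mat_index_sum[OF mult_carrier_mat[OF K rho] mat_adjoint_carrier[OF K] l]
    using K l by (intro sum.cong refl) (simp add: mult_mat_index_sum[OF K rho l(1)] del: index_mult_mat)
  then show ?thesis unfolding sum_distrib_right by (subst sum.swap) simp
qed

lemma channel_kraus:
  assumes "is_channel din dout \<Phi>"
  obtains N K where "kraus_rep din dout {..<N :: nat} K \<Phi>" "kraus_tp din dout {..<N} K"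
proof -
  obtain Ks :: "complex mat list" where Ks: "set Ks \<subseteq> carrier_mat dout din"
    and tp: "mat din din (\<lambda>(a,b). \<Sum>k<length Ks. (mat_adjoint (Ks!k) * (Ks!k)) $$ (a,b)) = 1\<^sub>m din"
    and \<Phi>: "\<And>\<rho>. \<rho> \<in> carrier_mat din din \<Longrightarrow>
      \<Phi> \<rho> = mat dout dout (\<lambda>(a,b). \<Sum>k<length Ks. ((Ks!k) * \<rho> * mat_adjoint (Ks!k)) $$ (a,b))"
    using assms unfolding is_channel_def by blast
  define K where "K a l k = (Ks!a) $$ (l,k)" for a l k
  have c: "Ks!a \<in> carrier_mat dout din" if "a < length Ks" for a using Ks that nth_mem by blast
  have "kraus_rep din dout {..<length Ks} K \<Phi>"
    unfolding kraus_rep_def K_def using conjugation_index[OF c] by (auto simp: \<Phi> intro!: sum.cong)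
  moreover have "kraus_tp din dout {..<length Ks} K"
    unfolding kraus_tp_def
  proof (intro allI impI)
    fix k k' assume k: "k < din" "k' < din"
    have "(\<Sum>a<length Ks. \<Sum>l<dout. cnj (K a l k) * K a l k') = (\<Sum>a<length Ks. (mat_adjoint (Ks!a) * (Ks!a)) $$ (k,k'))"
      unfolding K_def using gram_index[OF c c k] by (intro sum.cong refl) auto
    also have "\<dots> = mat din din (\<lambda>(a,b). \<Sum>k<length Ks. (mat_adjoint (Ks!k) * (Ks!k)) $$ (a,b)) $$ (k,k')"
      using k by simp
    finally show "(\<Sum>a<length Ks. \<Sum>l<dout. cnj (K a l k) * K a l k') = (if k = k' then 1 else 0)"
      unfolding tp using k by simp
  qed
  ultimately show ?thesis using that by blast
qed

text \<open>The channel that discards its input and prepares the first basis state, with one Kraus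
  operator per input basis state. It keeps the suprema over recoveries from ranging over the empty
  set.\<close>

lemma channel_exists:
  assumes "0 < dout"
  shows "\<exists>\<Phi>. is_channel din dout \<Phi>"
proof -
  define Ks :: "complex mat list" where "Ks = map (\<lambda>j. mat dout din (\<lambda>(l,k). if l = 0 \<and> k = j then 1 else 0)) [0..<din]"
  define \<Phi> where "\<Phi> \<rho> = mat dout dout (\<lambda>(a,b). \<Sum>k<length Ks. ((Ks!k) * \<rho> * mat_adjoint (Ks!k)) $$ (a,b))" for \<rho>
  have "mat din din (\<lambda>(a,b). \<Sum>k<length Ks. (mat_adjoint (Ks!k) * (Ks!k)) $$ (a,b)) = 1\<^sub>m din"
  proof (rule eq_matI)
    fix a b assume "a < dim_row (1\<^sub>m din :: complex mat)" "b < dim_col (1\<^sub>m din :: complex mat)"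
    then have ab: "a < din" "b < din" by auto
    have "(\<Sum>k<length Ks. (mat_adjoint (Ks!k) * (Ks!k)) $$ (a,b)) = (\<Sum>k<din. if k = a then (if a = b then 1 else 0) else 0)"
    proof (rule sum.cong)
      show "{..<length Ks} = {..<din}" by (simp add: Ks_def)
      fix k assume "k \<in> {..<din}"
      then have k: "k < din" by simp
      have Kk: "Ks!k = mat dout din (\<lambda>(l,m). if l = 0 \<and> m = k then 1 else 0)" using k by (simp add: Ks_def)
      have c: "Ks!k \<in> carrier_mat dout din" unfolding Kk by simp
      have "(mat_adjoint (Ks!k) * (Ks!k)) $$ (a,b) = (\<Sum>t<dout. if t = 0 then (if a = k \<and> b = k then 1 else 0) else 0)"
        unfolding gram_index[OF c c ab] unfolding Kk using ab by (intro sum.cong refl) auto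
      then show "(mat_adjoint (Ks!k) * (Ks!k)) $$ (a,b) = (if k = a then (if a = b then 1 else 0) else 0)"
        using assms by auto
    qed
    then show "mat din din (\<lambda>(a,b). \<Sum>k<length Ks. (mat_adjoint (Ks!k) * (Ks!k)) $$ (a,b)) $$ (a,b) = 1\<^sub>m din $$ (a,b)"
      using ab by simp
  qed auto
  then have "is_channel din dout \<Phi>"
    unfolding is_channel_def by (intro exI[of _ Ks]) (auto simp: \<Phi>_def Ks_def)
  then show ?thesis by blast
qed

section \<open>The fidelity of a channel with the identity in Kraus form\<close>

lemma div_less_of_mult: "p < a * b \<Longrightarrow> p div b < (a :: nat)"
  by (simp add: less_mult_imp_div_less)

text \<open>The ideal output is pure, so \<open>fidelity_pure\<close> reduces the fidelity to an
  overlap, to which each Kraus operator contributes the squared modulus of its expectation in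
  \<open>\<phi>\<close>.\<close>

lemma fid_state_kraus:
  assumes K: "kraus_rep dL dL A K \<Phi>" and phi: "unit_vec_c (dL * dR) \<phi>"
  shows "fid_state dL dL dR \<phi> \<Phi> id = sqrt (\<Sum>a\<in>A. (cmod (\<Sum>p<dL * dR. cnj (\<phi> $ p) *
    (\<Sum>l<dL. K a (p div dR) l * \<phi> $ (l * dR + p mod dR))))\<^sup>2)"
proof -
  define y where "y a p = (\<Sum>l<dL. K a (p div dR) l * \<phi> $ (l * dR + p mod dR))" for a p
  define N where "N = dL * dR"
  note u = unit_vec_c_sum[OF phi]
  have dim: "dim_vec \<phi> = N" using u(1) by (simp add: N_def)
  have idx: "l * dR + p mod dR < N" "p div dR < dL" if "l < dL" "p < N" for l p
  proof -
    have "0 < dR" using that by (cases dR) (auto simp: N_def)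
    then have "l * dR + p mod dR < l * dR + dR" by simp
    also have "\<dots> = Suc l * dR" by simp
    also have "\<dots> \<le> N" unfolding N_def using that by (intro mult_le_mono1) simp
    finally show "l * dR + p mod dR < N" .
    show "p div dR < dL" using that unfolding N_def by (intro div_less_of_mult)
  qed
  let ?X = "tensor_id \<Phi> dL dL dR (ket_bra \<phi>)"
  have X: "?X \<in> carrier_mat N N" unfolding tensor_id_def N_def by simp
  have entry: "?X $$ (p,q) = (\<Sum>a\<in>A. y a p * cnj (y a q))" if pq: "p < N" "q < N" for p q
  proof -
    let ?M = "mat dL dL (\<lambda>(l,l'). ket_bra \<phi> $$ (l * dR + p mod dR, l' * dR + q mod dR))"
    have M: "?M \<in> carrier_mat dL dL" by simp
    have dv: "p div dR < dL" "q div dR < dL" using pq unfolding N_def by (auto intro: div_less_of_mult)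
    have "?X $$ (p,q) = \<Phi> ?M $$ (p div dR, q div dR)" unfolding tensor_id_def using pq by (simp add: N_def)
    also have "\<dots> = (\<Sum>a\<in>A. \<Sum>k<dL. \<Sum>k'<dL. K a (p div dR) k * ?M $$ (k,k') * cnj (K a (q div dR) k'))"
      using K M dv unfolding kraus_rep_def by blast
    also have "\<dots> = (\<Sum>a\<in>A. \<Sum>k<dL. \<Sum>k'<dL. (K a (p div dR) k * \<phi> $ (k * dR + p mod dR)) * cnj (K a (q div dR) k' * \<phi> $ (k' * dR + q mod dR)))"
      using idx pq dim by (intro sum.cong refl) (simp add: ket_bra_def mult_ac)
    also have "\<dots> = (\<Sum>a\<in>A. y a p * cnj (y a q))"
      unfolding y_def cnj_sum sum_product ..
    finally show ?thesis .
  qed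
  have form: "(\<Sum>p<N. \<Sum>q<N. cnj (v p) * ?X $$ (p,q) * v q) = of_real (\<Sum>a\<in>A. (cmod (\<Sum>p<N. cnj (v p) * y a p))\<^sup>2)" for v
  proof -
    have "(\<Sum>p<N. \<Sum>q<N. cnj (v p) * ?X $$ (p,q) * v q) = (\<Sum>p<N. \<Sum>q<N. \<Sum>a\<in>A. (cnj (v p) * y a p) * cnj (cnj (v q) * y a q))"
      by (intro sum.cong refl) (simp add: entry sum_distrib_left sum_distrib_right mult_ac)
    also have "\<dots> = (\<Sum>a\<in>A. \<Sum>p<N. \<Sum>q<N. (cnj (v p) * y a p) * cnj (cnj (v q) * y a q))"
      by (subst sum.swap[of _ A], subst sum.swap[of _ A]) (rule refl)
    also have "\<dots> = (\<Sum>a\<in>A. (\<Sum>p<N. cnj (v p) * y a p) * cnj (\<Sum>q<N. cnj (v q) * y a q))"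
      unfolding cnj_sum sum_product ..
    finally show ?thesis unfolding of_real_sum complex_norm_square .
  qed
  have herm: "mat_adjoint ?X = ?X"
  proof (rule eq_matI)
    fix p q assume "p < dim_row ?X" "q < dim_col ?X"
    then have pq: "p < N" "q < N" using X by auto
    have "mat_adjoint ?X $$ (p,q) = cnj (?X $$ (q,p))" using X pq by (intro mat_adjoint_index) auto
    then show "mat_adjoint ?X $$ (p,q) = ?X $$ (p,q)" unfolding entry[OF pq] entry[OF pq(2,1)] by (simp add: mult.commute)
  qed (use X in auto)
  have psd: "psd ?X" unfolding psd_iff_form[OF X] form using herm by (auto intro!: sum_nonneg)
  have id: "tensor_id id dL dL dR (ket_bra \<phi>) = ket_bra \<phi>"
  proof (rule eq_matI)
    fix p q assume "p < dim_row (ket_bra \<phi>)" "q < dim_col (ket_bra \<phi>)"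
    then have pq: "p < N" "q < N" using dim by (auto simp: ket_bra_def)
    have dv: "p div dR < dL" "q div dR < dL" using pq unfolding N_def by (auto intro: div_less_of_mult)
    show "tensor_id id dL dL dR (ket_bra \<phi>) $$ (p,q) = ket_bra \<phi> $$ (p,q)"
      unfolding tensor_id_def using pq dv by (simp add: N_def)
  qed (use dim in \<open>auto simp: tensor_id_def ket_bra_def N_def\<close>)
  show ?thesis unfolding fid_state_def id
    using fidelity_pure[OF X psd phi[folded N_def]] form[of "\<lambda>p. \<phi> $ p"] unfolding y_def N_def by simp
qed

section \<open>The quadratic form estimate\<close>

lemma L2_set_sqrt_sum:
  "finite Z \<Longrightarrow> L2_set (\<lambda>z. L2_set (f z) (B z)) Z = sqrt (\<Sum>z\<in>Z. \<Sum>b\<in>B z. (f z b)\<^sup>2)"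
  unfolding L2_set_def by (simp add: sum_nonneg)

text \<open>The cross terms are conjugate, so the difference of expectations is the real part of the
  form between x - x0 and x + x0. Their squared norms are at most 2 - 2 F and 2 + 2 F, with product
  4 (1 - F^2). The index \<open>z\<close> carries the spectators, in which the form is
  diagonal.\<close>

lemma hermitian_form_gap:
  fixes T :: "'z \<Rightarrow> nat \<Rightarrow> nat \<Rightarrow> complex" and x x0 :: "'z \<Rightarrow> nat \<Rightarrow> complex"
  assumes Z: "finite Z" and c: "0 \<le> c"
    and herm: "\<And>z a b. cnj (T z a b) = T z b a"
    and bound: "\<And>z u v. z \<in> Z \<Longrightarrow> cmod (\<Sum>a<m z. \<Sum>b<m z. cnj (u a) * T z a b * v b)
       \<le> c * (L2_set (\<lambda>a. cmod (u a)) {..<m z} * L2_set (\<lambda>a. cmod (v a)) {..<m z})"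
    and x: "(\<Sum>z\<in>Z. \<Sum>a<m z. (cmod (x z a))\<^sup>2) \<le> 1" and x0: "(\<Sum>z\<in>Z. \<Sum>a<m z. (cmod (x0 z a))\<^sup>2) \<le> 1"
    and F: "Re (\<Sum>z\<in>Z. \<Sum>a<m z. cnj (x0 z a) * x z a) = F"
  shows "Re (\<Sum>z\<in>Z. \<Sum>a<m z. \<Sum>b<m z. cnj (x z a) * T z a b * x z b)
       - Re (\<Sum>z\<in>Z. \<Sum>a<m z. \<Sum>b<m z. cnj (x0 z a) * T z a b * x0 z b) \<le> 2 * c * sqrt (1 - F\<^sup>2)"
proof -
  define B where "B u v = (\<Sum>z\<in>Z. \<Sum>a<m z. \<Sum>b<m z. cnj (u z a) * T z a b * v z b)" for u v :: "'z \<Rightarrow> nat \<Rightarrow> complex"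
  define P where "P u = (\<Sum>z\<in>Z. \<Sum>a<m z. (cmod (u z a))\<^sup>2)" for u :: "'z \<Rightarrow> nat \<Rightarrow> complex"
  have P0: "P u \<ge> 0" for u unfolding P_def by (intro sum_nonneg) auto
  have Bbound: "cmod (B u v) \<le> c * (sqrt (P u) * sqrt (P v))" for u v
  proof -
    have "cmod (B u v) \<le> (\<Sum>z\<in>Z. c * (\<bar>L2_set (\<lambda>a. cmod (u z a)) {..<m z}\<bar> * \<bar>L2_set (\<lambda>a. cmod (v z a)) {..<m z}\<bar>))"
      unfolding B_def by (rule order_trans[OF norm_sum], rule sum_mono) (use bound in \<open>simp add: L2_set_nonneg\<close>)
    also have "\<dots> \<le> c * (L2_set (\<lambda>z. L2_set (\<lambda>a. cmod (u z a)) {..<m z}) Z * L2_set (\<lambda>z. L2_set (\<lambda>a. cmod (v z a)) {..<m z}) Z)"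
      unfolding sum_distrib_left[symmetric] by (intro mult_left_mono L2_set_mult_ineq c)
    finally show ?thesis unfolding L2_set_sqrt_sum[OF Z] P_def .
  qed
  have Bswap: "B v u = cnj (B u v)" for u v
    unfolding B_def cnj_sum by (rule sum.cong[OF refl], subst sum.swap) (simp add: herm mult_ac)
  have "B (\<lambda>z a. x z a - x0 z a) (\<lambda>z a. x z a + x0 z a) = B x x + B x x0 - B x0 x - B x0 x0"
    unfolding B_def sum.distrib[symmetric] sum_subtractf[symmetric] by (intro sum.cong refl) (simp add: algebra_simps)
  then have gap: "Re (B x x) - Re (B x0 x0) = Re (B (\<lambda>z a. x z a - x0 z a) (\<lambda>z a. x z a + x0 z a))"
    using Bswap[of x0 x] by simp
  have sq: "(cmod (p - q))\<^sup>2 = (cmod p)\<^sup>2 + (cmod q)\<^sup>2 - 2 * Re (cnj q * p)"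
    "(cmod (p + q))\<^sup>2 = (cmod p)\<^sup>2 + (cmod q)\<^sup>2 + 2 * Re (cnj q * p)" for p q :: complex
    unfolding cmod_power2 by (simp_all add: power2_eq_square algebra_simps)
  have "P (\<lambda>z a. x z a - x0 z a) = P x + P x0 - 2 * F" "P (\<lambda>z a. x z a + x0 z a) = P x + P x0 + 2 * F"
    unfolding P_def F[symmetric] Re_sum sum_distrib_left sum.distrib[symmetric] sum_subtractf[symmetric] sq
    by (intro sum.cong refl)+
  then have P1: "P (\<lambda>z a. x z a - x0 z a) \<le> 2 - 2 * F" "P (\<lambda>z a. x z a + x0 z a) \<le> 2 + 2 * F"
    using x x0 unfolding P_def by auto
  have "Re (B x x) - Re (B x0 x0) \<le> c * (sqrt (P (\<lambda>z a. x z a - x0 z a)) * sqrt (P (\<lambda>z a. x z a + x0 z a)))"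
    unfolding gap by (rule order_trans[OF complex_Re_le_cmod Bbound])
  also have "\<dots> \<le> c * (sqrt (2 - 2 * F) * sqrt (2 + 2 * F))"
  proof (intro mult_left_mono mult_mono real_sqrt_le_mono P1 c)
    show "0 \<le> sqrt (2 - 2 * F)" using order_trans[OF P0 P1(1)] by simp
    show "0 \<le> sqrt (P (\<lambda>z a. x z a + x0 z a))" using P0 by simp
  qed
  also have "sqrt (2 - 2 * F) * sqrt (2 + 2 * F) = sqrt (2\<^sup>2 * (1 - F\<^sup>2))"
    unfolding real_sqrt_mult[symmetric] by (simp add: power2_eq_square algebra_simps)
  also have "\<dots> = 2 * sqrt (1 - F\<^sup>2)" by (simp only: real_sqrt_mult real_sqrt_abs abs_numeral)
  finally show ?thesis unfolding B_def by simp
qed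

section \<open>Erasure of one subsystem at a random position\<close>

lemma sum_div_mod:
  fixes f :: "nat \<Rightarrow> 'a :: comm_monoid_add"
  shows "(\<Sum>p<a * b. f p) = (\<Sum>i<a. \<Sum>j<b. f (i * b + j))"
proof -
  have "(\<Sum>i<a. \<Sum>j<b. f (i * b + j)) = (\<Sum>(i,j)\<in>{..<a} \<times> {..<b}. f (i * b + j))"
    by (rule sum.cartesian_product)
  also have "\<dots> = (\<Sum>p<a * b. f p)"
  proof (rule sum.reindex_bij_witness[where i = "\<lambda>p. (p div b, p mod b)" and j = "\<lambda>(i,j). i * b + j"])
    fix z assume "z \<in> {..<a} \<times> {..<b}"
    then obtain i j where z: "z = (i,j)" "i < a" "j < b" by auto
    have "i * b + j < Suc i * b" using z by simp
    also have "\<dots> \<le> a * b" using z by (intro mult_le_mono1) simp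
    finally show "(case z of (i, j) \<Rightarrow> i * b + j) \<in> {..<a * b}" using z by simp
    show "((case z of (i, j) \<Rightarrow> i * b + j) div b, (case z of (i, j) \<Rightarrow> i * b + j) mod b) = z" using z by simp
    show "f (case z of (i, j) \<Rightarrow> i * b + j) = (case z of (i, j) \<Rightarrow> f (i * b + j))" using z by simp
  next
    fix p assume "p \<in> {..<a * b}"
    then have p: "p < a * b" by simp
    then have "0 < b" by (cases b) auto
    then show "(p div b, p mod b) \<in> {..<a} \<times> {..<b}" using div_less_of_mult[OF p] by simp
    show "(case (p div b, p mod b) of (i, j) \<Rightarrow> i * b + j) = p" by simp
  qed
  finally show ?thesis ..
qed

lemma sum_product_quad:
  fixes f :: "'a \<times> 'b \<times> 'c \<times> 'd \<Rightarrow> 'e :: comm_monoid_add"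
  shows "(\<Sum>z\<in>A \<times> B \<times> C \<times> E. f z) = (\<Sum>a\<in>A. \<Sum>b\<in>B. \<Sum>c\<in>C. \<Sum>e\<in>E. f (a,b,c,e))"
  by (simp add: sum_Times)

lemma sum_reorder:
  fixes f :: "'a \<Rightarrow> 'b \<Rightarrow> 'c \<Rightarrow> 'd \<Rightarrow> 'e \<Rightarrow> 'f :: comm_monoid_add"
  shows "(\<Sum>b\<in>A. \<Sum>i\<in>B. \<Sum>l\<in>C. \<Sum>k\<in>E. \<Sum>\<kappa>\<in>G i. f b i l k \<kappa>)
    = (\<Sum>k\<in>E. \<Sum>b\<in>A. \<Sum>i\<in>B. \<Sum>\<kappa>\<in>G i. \<Sum>l\<in>C. f b i l k \<kappa>)"
proof -
  have "(\<Sum>b\<in>A. \<Sum>i\<in>B. \<Sum>l\<in>C. \<Sum>k\<in>E. \<Sum>\<kappa>\<in>G i. f b i l k \<kappa>)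
      = (\<Sum>b\<in>A. \<Sum>i\<in>B. \<Sum>k\<in>E. \<Sum>\<kappa>\<in>G i. \<Sum>l\<in>C. f b i l k \<kappa>)"
    by (rule sum.cong[OF refl], rule sum.cong[OF refl], subst sum.swap, rule sum.cong[OF refl], rule sum.swap)
  also have "\<dots> = (\<Sum>b\<in>A. \<Sum>k\<in>E. \<Sum>i\<in>B. \<Sum>\<kappa>\<in>G i. \<Sum>l\<in>C. f b i l k \<kappa>)"
    by (rule sum.cong[OF refl], rule sum.swap)
  also have "\<dots> = (\<Sum>k\<in>E. \<Sum>b\<in>A. \<Sum>i\<in>B. \<Sum>\<kappa>\<in>G i. \<Sum>l\<in>C. f b i l k \<kappa>)"
    by (rule sum.swap)
  finally show ?thesis .
qed

text \<open>The encoder has a single Kraus operator, and composing with it leaves a trivial index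
  component.\<close>

lemma kraus_drop_unit:
  assumes "kraus_rep a b (A \<times> {()}) K \<Phi>"
  shows "kraus_rep a b A (\<lambda>z. K (z, ())) \<Phi>"
proof -
  have s: "(\<Sum>z\<in>A \<times> {()}. f z) = (\<Sum>z\<in>A. f (z, ()))" for f :: "_ \<Rightarrow> complex"
    by (rule sum.reindex_bij_witness[of _ "\<lambda>z. (z, ())" fst]) auto
  have "finite A" using assms unfolding kraus_rep_def by (auto dest: finite_cartesian_productD1)
  then show ?thesis using assms unfolding kraus_rep_def s by blast
qed

lemma kraus_tp_drop_unit:
  assumes "kraus_tp a b (A \<times> {()}) K"
  shows "kraus_tp a b A (\<lambda>z. K (z, ()))"
proof -
  have s: "(\<Sum>z\<in>A \<times> {()}. f z) = (\<Sum>z\<in>A. f (z, ()))" for f :: "_ \<Rightarrow> complex"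
    by (rule sum.reindex_bij_witness[of _ "\<lambda>z. (z, ())" fst]) auto
  show ?thesis using assms unfolding kraus_tp_def s by blast
qed

section \<open>The code, the environment of the erasure and the fidelity estimate\<close>

locale noisy_code = radix +
  fixes dL :: nat and V :: "complex mat" and \<phi>s :: "nat \<Rightarrow> complex vec"
    and T :: "nat \<Rightarrow> nat \<Rightarrow> nat \<Rightarrow> complex" and J :: nat
  assumes n_pos: "1 \<le> n" and dL: "2 \<le> dL"
    and V: "V \<in> carrier_mat D dL" "mat_adjoint V * V = 1\<^sub>m dL"
    and phis: "\<And>i. i < n \<Longrightarrow> unit_vec_c (d i) (\<phi>s i)"
    and T_herm: "\<And>i a b. cnj (T i a b) = T i b a"
    and T_bound: "\<And>i u v. i < n \<Longrightarrow> cmod (\<Sum>a<d i. \<Sum>b<d i. cnj (u a) * T i a b * v b)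
       \<le> real J * (L2_set (\<lambda>a. cmod (u a)) {..<d i} * L2_set (\<lambda>a. cmod (v a)) {..<d i})"
    and charge: "Re (\<Sum>i<n. \<Sum>x\<in>{x. x < D \<and> dig i x = 0}. \<Sum>\<kappa><d i. \<Sum>\<kappa>'<d i. cnj (V $$ (setd i x \<kappa>, 0)) * T i \<kappa> \<kappa>' * V $$ (setd i x \<kappa>', 0))
       - Re (\<Sum>i<n. \<Sum>x\<in>{x. x < D \<and> dig i x = 0}. \<Sum>\<kappa><d i. \<Sum>\<kappa>'<d i. cnj (V $$ (setd i x \<kappa>, 1)) * T i \<kappa> \<kappa>' * V $$ (setd i x \<kappa>', 1)) = 2"
begin

abbreviation "NI \<equiv> Sigma {..<n} (\<lambda>i. {..<d i})"
abbreviation "enc \<equiv> (\<lambda>\<rho>. V * \<rho> * mat_adjoint V)"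
abbreviation "noisy \<equiv> noiseN n d \<phi>s \<circ> enc"

text \<open>The operator that writes i into C and replaces basis state \<kappa> of the
  \<open>i\<close>-th factor by the fixed state, divided by the root of n. Its index (i, \<kappa>)
  records the position and the content of the lost factor.\<close>

definition noise_kraus :: "nat \<times> nat \<Rightarrow> nat \<Rightarrow> nat \<Rightarrow> complex" where
  "noise_kraus z p x = (if p div D = fst z \<and> x = setd (fst z) (p mod D) (snd z)
     then \<phi>s (fst z) $ dig (fst z) (p mod D) / of_real (sqrt (real n)) else 0)"

lemma sum_NI: "(\<Sum>z\<in>NI. f z) = (\<Sum>i<n. \<Sum>\<kappa><d i. f (i,\<kappa>))" for f :: "nat \<times> nat \<Rightarrow> 'a :: comm_monoid_add"
  by (subst sum.Sigma) (auto simp: case_prod_unfold)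

lemma sqrt_n: "complex_of_real (sqrt (real n)) * of_real (sqrt (real n)) = of_nat n"
proof -
  have "complex_of_real (sqrt (real n)) * of_real (sqrt (real n)) = of_real (sqrt (real n) * sqrt (real n))"
    by (rule of_real_mult[symmetric])
  also have "sqrt (real n) * sqrt (real n) = real n" by simp
  finally show ?thesis by simp
qed

lemma noise_kraus_apply:
  assumes "i < n" "\<kappa> < d i"
  shows "(\<Sum>x<D. noise_kraus (i,\<kappa>) p x * v x) = (if p div D = i
    then \<phi>s i $ dig i (p mod D) / of_real (sqrt (real n)) * v (setd i (p mod D) \<kappa>) else 0)"
proof -
  have less: "setd i (p mod D) \<kappa> < D" by (rule set_digit_less[OF assms]) (use D_pos in simp)
  have "(\<Sum>x<D. noise_kraus (i,\<kappa>) p x * v x) = (\<Sum>x<D. if x = setd i (p mod D) \<kappa> then (if p div D = i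
    then \<phi>s i $ dig i (p mod D) / of_real (sqrt (real n)) * v (setd i (p mod D) \<kappa>) else 0) else 0)"
    by (intro sum.cong refl) (auto simp: noise_kraus_def)
  then show ?thesis using less by simp
qed

lemma noise_kraus_rep: "kraus_rep D (n * D) NI noise_kraus (noiseN n d \<phi>s)"
  unfolding kraus_rep_def
proof (intro conjI ballI allI impI)
  show "finite NI" by simp
  fix \<rho> :: "complex mat" assume rho: "\<rho> \<in> carrier_mat D D"
  show "noiseN n d \<phi>s \<rho> \<in> carrier_mat (n * D) (n * D)" by (simp add: noiseN_def)
  fix p q assume pq: "p < n * D" "q < n * D"
  define i where "i = p div D"
  define a where "a = \<phi>s i $ dig i (p mod D)"
  define b where "b = cnj (\<phi>s i $ dig i (q mod D))"
  have i: "i < n" unfolding i_def using pq(1) by (rule div_less_of_mult)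
  have pm: "p mod D < D" "q mod D < D" using D_pos by simp_all
  have summand: "(\<Sum>k<D. \<Sum>k'<D. noise_kraus (i',\<kappa>) p k * \<rho> $$ (k,k') * cnj (noise_kraus (i',\<kappa>) q k'))
    = (if i' = i then (if q div D = i then a * b * \<rho> $$ (setd i (p mod D) \<kappa>, setd i (q mod D) \<kappa>) / of_nat n else 0) else 0)"
    if k: "i' < n" "\<kappa> < d i'" for i' \<kappa>
  proof -
    have in2: "(\<Sum>k'<D. c k' * cnj (noise_kraus (i',\<kappa>) q k')) = cnj (\<Sum>k'<D. noise_kraus (i',\<kappa>) q k' * cnj (c k'))" for c :: "nat \<Rightarrow> complex"
      by (simp add: mult.commute)
    have "(\<Sum>k<D. \<Sum>k'<D. noise_kraus (i',\<kappa>) p k * \<rho> $$ (k,k') * cnj (noise_kraus (i',\<kappa>) q k'))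
      = (\<Sum>k<D. noise_kraus (i',\<kappa>) p k * (\<Sum>k'<D. \<rho> $$ (k,k') * cnj (noise_kraus (i',\<kappa>) q k')))"
      by (simp add: sum_distrib_left mult.assoc)
    also have "\<dots> = (if p div D = i' then \<phi>s i' $ dig i' (p mod D) / of_real (sqrt (real n))
        * cnj (if q div D = i' then \<phi>s i' $ dig i' (q mod D) / of_real (sqrt (real n)) * cnj (\<rho> $$ (setd i' (p mod D) \<kappa>, setd i' (q mod D) \<kappa>)) else 0) else 0)"
      unfolding in2 noise_kraus_apply[OF k] ..
    also have "\<dots> = (if i' = i then (if q div D = i then a * b * \<rho> $$ (setd i (p mod D) \<kappa>, setd i (q mod D) \<kappa>) / of_nat n else 0) else 0)"
      unfolding i_def[symmetric] sqrt_n[symmetric] by (auto simp: a_def b_def)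
    finally show ?thesis .
  qed
  have "(\<Sum>z\<in>NI. \<Sum>k<D. \<Sum>k'<D. noise_kraus z p k * \<rho> $$ (k,k') * cnj (noise_kraus z q k'))
    = (\<Sum>i'<n. \<Sum>\<kappa><d i'. if i' = i then (if q div D = i then a * b * \<rho> $$ (setd i (p mod D) \<kappa>, setd i (q mod D) \<kappa>) / of_nat n else 0) else 0)"
    unfolding sum_NI using summand by (intro sum.cong refl) auto
  also have "\<dots> = (\<Sum>i'<n. if i' = i then (\<Sum>\<kappa><d i. if q div D = i then a * b * \<rho> $$ (setd i (p mod D) \<kappa>, setd i (q mod D) \<kappa>) / of_nat n else 0) else 0)"
    by (intro sum.cong refl) auto
  also have "\<dots> = (\<Sum>\<kappa><d i. if q div D = i then a * b * \<rho> $$ (setd i (p mod D) \<kappa>, setd i (q mod D) \<kappa>) / of_nat n else 0)"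
    using i by simp
  also have "\<dots> = noiseN n d \<phi>s \<rho> $$ (p,q)"
    using pq pm unfolding noiseN_def replace_factor_def a_def b_def
    by (auto simp: i_def[symmetric] sum_distrib_left sum_divide_distrib)
  finally show "noiseN n d \<phi>s \<rho> $$ (p,q) = (\<Sum>z\<in>NI. \<Sum>k<D. \<Sum>k'<D. noise_kraus z p k * \<rho> $$ (k,k') * cnj (noise_kraus z q k'))" ..
qed

text \<open>The state of the environment: with probability 1/n at position \<open>i\<close>, it is
  the reduced operator of the lost factor. The fixed state drops out by normalisation.\<close>

lemma noise_inner:
  assumes i: "i < n" and k: "\<kappa> < d i" "\<kappa>' < d i"
  shows "(\<Sum>p<n * D. cnj (\<Sum>x<D. noise_kraus (i,\<kappa>) p x * u x) * (\<Sum>x<D. noise_kraus (i,\<kappa>') p x * v x))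
    = (\<Sum>x\<in>{x. x < D \<and> dig i x = 0}. cnj (u (setd i x \<kappa>)) * v (setd i x \<kappa>')) / of_nat n"
proof -
  define h where "h x = cnj (\<phi>s i $ dig i x) * (\<phi>s i $ dig i x) * (cnj (u (setd i x \<kappa>)) * v (setd i x \<kappa>'))" for x
  have "(\<Sum>p<n * D. cnj (\<Sum>x<D. noise_kraus (i,\<kappa>) p x * u x) * (\<Sum>x<D. noise_kraus (i,\<kappa>') p x * v x))
    = (\<Sum>p<n * D. if p div D = i then h (p mod D) / of_nat n else 0)"
    unfolding noise_kraus_apply[OF i k(1)] noise_kraus_apply[OF i k(2)] sqrt_n[symmetric]
    by (intro sum.cong refl) (auto simp: h_def mult_ac)
  also have "\<dots> = (\<Sum>i'<n. \<Sum>x<D. if i' = i then h x / of_nat n else 0)"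
    unfolding sum_div_mod by (intro sum.cong refl) auto
  also have "\<dots> = (\<Sum>i'<n. if i' = i then (\<Sum>x<D. h x / of_nat n) else 0)"
    by (intro sum.cong refl) auto
  also have "\<dots> = (\<Sum>x<D. h x) / of_nat n" using i by (simp add: sum_divide_distrib)
  also have "(\<Sum>x<D. h x) = (\<Sum>x\<in>{x. x < D \<and> dig i x = 0}. \<Sum>l<d i. (cnj (\<phi>s i $ l) * \<phi>s i $ l) * (cnj (u (setd i x \<kappa>)) * v (setd i x \<kappa>')))"
    unfolding sum_digit_split[OF i] h_def
    by (intro sum.cong refl) (simp add: digit_set_same[OF i] set_digit_twice[OF i])
  also have "\<dots> = (\<Sum>x\<in>{x. x < D \<and> dig i x = 0}. cnj (u (setd i x \<kappa>)) * v (setd i x \<kappa>'))"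
    unfolding sum_distrib_right[symmetric] unit_vec_c_sum(2)[OF phis[OF i]] by simp
  finally show ?thesis .
qed

lemma noise_kraus_tp: "kraus_tp D (n * D) NI noise_kraus"
  unfolding kraus_tp_def
proof (intro allI impI)
  fix k k' assume k: "k < D" "k' < D"
  define \<delta> where "\<delta> y x = (if x = y then 1 else 0 :: complex)" for x y :: nat
  have ap: "noise_kraus z p y = (\<Sum>x<D. noise_kraus z p x * \<delta> y x)" if "y < D" for z p y
  proof -
    have "(\<Sum>x<D. noise_kraus z p x * \<delta> y x) = (\<Sum>x<D. if x = y then noise_kraus z p y else 0)"
      by (intro sum.cong refl) (auto simp: \<delta>_def)
    then show ?thesis using that by simp
  qed
  have "(\<Sum>z\<in>NI. \<Sum>p<n * D. cnj (noise_kraus z p k) * noise_kraus z p k')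
    = (\<Sum>i<n. \<Sum>\<kappa><d i. (\<Sum>x\<in>{x. x < D \<and> dig i x = 0}. cnj (\<delta> k (setd i x \<kappa>)) * \<delta> k' (setd i x \<kappa>)) / of_nat n)"
    unfolding sum_NI ap[OF k(1)] ap[OF k(2)] by (intro sum.cong refl noise_inner) auto
  also have "\<dots> = (\<Sum>i<n. (\<Sum>x<D. cnj (\<delta> k x) * \<delta> k' x) / of_nat n)"
  proof (rule sum.cong[OF refl])
    fix i assume "i \<in> {..<n}"
    then have i: "i < n" by simp
    show "(\<Sum>\<kappa><d i. (\<Sum>x\<in>{x. x < D \<and> dig i x = 0}. cnj (\<delta> k (setd i x \<kappa>)) * \<delta> k' (setd i x \<kappa>)) / of_nat n)
      = (\<Sum>x<D. cnj (\<delta> k x) * \<delta> k' x) / of_nat n"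
      unfolding sum_divide_distrib[symmetric] sum_digit_split[OF i] by (subst sum.swap) (rule refl)
  qed
  also have "(\<Sum>x<D. cnj (\<delta> k x) * \<delta> k' x) = (\<Sum>x<D. if x = k then (if k = k' then 1 else 0) else 0)"
    by (intro sum.cong refl) (auto simp: \<delta>_def)
  finally show "(\<Sum>z\<in>NI. \<Sum>p<n * D. cnj (noise_kraus z p k) * noise_kraus z p k') = (if k = k' then 1 else 0)"
    using k n_pos by simp
qed

definition enc_kraus :: "nat \<times> nat \<Rightarrow> nat \<Rightarrow> nat \<Rightarrow> complex" where
  "enc_kraus z p k = (\<Sum>x<D. noise_kraus z p x * V $$ (x,k))"

lemma V_kraus: "kraus_rep dL D {()} (\<lambda>_ x k. V $$ (x,k)) enc" "kraus_tp dL D {()} (\<lambda>_ x k. V $$ (x,k))"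
proof -
  have "V * \<rho> * mat_adjoint V \<in> carrier_mat D D" if "\<rho> \<in> carrier_mat dL dL" for \<rho>
    by (rule mult_carrier_mat[OF mult_carrier_mat[OF V(1) that] mat_adjoint_carrier[OF V(1)]])
  then show "kraus_rep dL D {()} (\<lambda>_ x k. V $$ (x,k)) enc"
    unfolding kraus_rep_def using conjugation_index[OF V(1)] by simp
  show "kraus_tp dL D {()} (\<lambda>_ x k. V $$ (x,k))"
    unfolding kraus_tp_def using gram_index[OF V(1) V(1)] V(2) by simp
qed

lemma enc_kraus_rep: "kraus_rep dL (n * D) NI enc_kraus noisy" "kraus_tp dL (n * D) NI enc_kraus"
proof -
  have eq: "(\<lambda>z. kraus_comp D noise_kraus (\<lambda>_ x k. V $$ (x,k)) (z, ())) = enc_kraus"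
    by (simp add: fun_eq_iff kraus_comp_def enc_kraus_def)
  show "kraus_rep dL (n * D) NI enc_kraus noisy"
    using kraus_drop_unit[OF kraus_rep_comp[OF V_kraus(1) noise_kraus_rep]] unfolding eq .
  show "kraus_tp dL (n * D) NI enc_kraus"
    using kraus_tp_drop_unit[OF kraus_tp_comp[OF V_kraus(2) noise_kraus_tp]] unfolding eq .
qed

text \<open>The expectation of the total charge in the encoded basis state \<open>k\<close>,
  arranged so that the reduced operators of \<open>noise_inner\<close> stand inside.\<close>

definition tau :: "nat \<Rightarrow> complex" where
  "tau k = (\<Sum>i<n. \<Sum>\<kappa><d i. \<Sum>\<kappa>'<d i. T i \<kappa> \<kappa>' *
     (\<Sum>x\<in>{x. x < D \<and> dig i x = 0}. cnj (V $$ (setd i x \<kappa>, k)) * V $$ (setd i x \<kappa>', k)))"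

lemma tau_diff: "Re (tau 0) - Re (tau 1) = 2"
proof -
  have "tau k = (\<Sum>i<n. \<Sum>x\<in>{x. x < D \<and> dig i x = 0}. \<Sum>\<kappa><d i. \<Sum>\<kappa>'<d i. cnj (V $$ (setd i x \<kappa>, k)) * T i \<kappa> \<kappa>' * V $$ (setd i x \<kappa>', k))" for k
  proof -
    have "(\<Sum>x\<in>{x. x < D \<and> dig i x = 0}. \<Sum>\<kappa><d i. \<Sum>\<kappa>'<d i. cnj (V $$ (setd i x \<kappa>, k)) * T i \<kappa> \<kappa>' * V $$ (setd i x \<kappa>', k))
      = (\<Sum>\<kappa><d i. \<Sum>\<kappa>'<d i. \<Sum>x\<in>{x. x < D \<and> dig i x = 0}. cnj (V $$ (setd i x \<kappa>, k)) * T i \<kappa> \<kappa>' * V $$ (setd i x \<kappa>', k))" for i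
      by (subst sum.swap, rule sum.cong[OF refl], rule sum.swap)
    then show ?thesis unfolding tau_def sum_distrib_left by (simp add: mult_ac)
  qed
  then show ?thesis using charge by simp
qed

text \<open>Schmidt vectors in the logical basis; a constant \<open>s\<close> with unit square sum
  gives \<open>max_ent\<close>.\<close>

definition diag_vec :: "(nat \<Rightarrow> real) \<Rightarrow> complex vec" where
  "diag_vec s = vec (dL * dL) (\<lambda>p. if p div dL = p mod dL then of_real (s (p div dL)) else 0)"

lemma diag_vec_index: "i < dL \<Longrightarrow> j < dL \<Longrightarrow> diag_vec s $ (i * dL + j) = (if i = j then of_real (s i) else 0)"
proof -
  assume ij: "i < dL" "j < dL"
  have "i * dL + j < Suc i * dL" using ij by simp
  also have "\<dots> \<le> dL * dL" using ij by (intro mult_le_mono1) simp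
  finally show ?thesis using ij by (simp add: diag_vec_def)
qed

lemma diag_vec_unit:
  assumes "(\<Sum>k<dL. (s k)\<^sup>2) = 1"
  shows "unit_vec_c (dL * dL) (diag_vec s)"
proof -
  have c: "diag_vec s \<in> carrier_vec (dL * dL)" by (simp add: diag_vec_def)
  have "diag_vec s \<bullet>c diag_vec s = (\<Sum>i<dL. \<Sum>j<dL. if j = i then of_real ((s i)\<^sup>2) else 0)"
    unfolding cscalar_prod_sum[OF c] sum_div_mod
    by (intro sum.cong refl) (simp add: diag_vec_index power2_eq_square)
  also have "\<dots> = of_real (\<Sum>i<dL. (s i)\<^sup>2)" unfolding of_real_sum by simp
  finally show ?thesis using assms c by (simp add: unit_vec_c_def)
qed

lemma fid_state_diag_vec:
  assumes K: "kraus_rep dL dL A K \<Phi>" and s: "(\<Sum>k<dL. (s k)\<^sup>2) = 1"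
  shows "fid_state dL dL dL (diag_vec s) \<Phi> id = sqrt (\<Sum>a\<in>A. (cmod (\<Sum>k<dL. of_real ((s k)\<^sup>2) * K a k k))\<^sup>2)"
proof -
  have "(\<Sum>p<dL * dL. cnj (diag_vec s $ p) * (\<Sum>l<dL. K a (p div dL) l * diag_vec s $ (l * dL + p mod dL)))
    = (\<Sum>k<dL. of_real ((s k)\<^sup>2) * K a k k)" for a
  proof -
    have inner: "(\<Sum>l<dL. K a i l * diag_vec s $ (l * dL + j)) = K a i j * of_real (s j)" if "i < dL" "j < dL" for i j
    proof -
      have "(\<Sum>l<dL. K a i l * diag_vec s $ (l * dL + j)) = (\<Sum>l<dL. if l = j then K a i j * of_real (s j) else 0)"
        using that by (intro sum.cong refl) (auto simp: diag_vec_index)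
      then show ?thesis using that by simp
    qed
    have "(\<Sum>p<dL * dL. cnj (diag_vec s $ p) * (\<Sum>l<dL. K a (p div dL) l * diag_vec s $ (l * dL + p mod dL)))
      = (\<Sum>i<dL. \<Sum>j<dL. if j = i then of_real (s i) * (K a i i * of_real (s i)) else 0)"
      unfolding sum_div_mod
    proof (rule sum.cong[OF refl], rule sum.cong[OF refl])
      fix i j assume "i \<in> {..<dL}" "j \<in> {..<dL}"
      then have ij: "i < dL" "j < dL" by auto
      show "cnj (diag_vec s $ (i * dL + j)) * (\<Sum>l<dL. K a ((i * dL + j) div dL) l * diag_vec s $ (l * dL + (i * dL + j) mod dL))
        = (if j = i then of_real (s i) * (K a i i * of_real (s i)) else 0)"
        using ij inner[OF ij] diag_vec_index[OF ij, of s] by simp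
    qed
    also have "\<dots> = (\<Sum>k<dL. of_real ((s k)\<^sup>2) * K a k k)" by (intro sum.cong refl) (simp add: power2_eq_square)
    finally show ?thesis .
  qed
  then show ?thesis using fid_state_kraus[OF K diag_vec_unit[OF s]] by simp
qed

text \<open>The reference observable that tells basis state 0 from 1. Its mean is zero on Schmidt
  states with equal coefficients there.\<close>

definition sg :: "nat \<Rightarrow> real" where "sg k = (if k = 0 then 1 else if k = 1 then - 1 else 0)"

lemma sum_sg: "(\<Sum>k<dL. of_real (sg k) * f k) = f 0 - (f 1 :: complex)"
proof -
  have "(\<Sum>k<dL. of_real (sg k) * f k) = (\<Sum>k\<in>{0,1}. of_real (sg k) * f k)"
    using dL by (intro sum.mono_neutral_right) (auto simp: sg_def)
  then show ?thesis by (simp add: sg_def)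
qed

text \<open>The charge difference of the two logical basis states is visible in the correlation of the
  reference with the environment, whereas that correlation vanishes for a perfectly decoupled state.\<close>

theorem fidelity_estimate:
  assumes R: "is_channel (n * D) dL R" and s: "(\<Sum>k<dL. (s k)\<^sup>2) = 1" "s 0 = \<sigma>" "s 1 = \<sigma>"
  shows "\<sigma>\<^sup>2 \<le> real n * real J * sqrt (1 - (fid_state dL dL dL (diag_vec s) (R \<circ> noisy) id)\<^sup>2)"
proof -
  obtain N L where Lrep: "kraus_rep (n * D) dL {..<N :: nat} L R" and Ltp: "kraus_tp (n * D) dL {..<N} L"
    by (rule channel_kraus[OF R])
  define K where "K = kraus_comp (n * D) L enc_kraus"
  have Krep: "kraus_rep dL dL ({..<N} \<times> NI) K (R \<circ> noisy)" and Ktp: "kraus_tp dL dL ({..<N} \<times> NI) K"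
    unfolding K_def by (rule kraus_rep_comp[OF enc_kraus_rep(1) Lrep], rule kraus_tp_comp[OF enc_kraus_rep(2) Ltp])
  \<comment> \<open>The projection of the purified output onto the initial Schmidt state: an
    environment vector of norm \<open>F\<close>.\<close>
  define \<eta> where "\<eta> b i \<kappa> = (\<Sum>k<dL. of_real ((s k)\<^sup>2) * K (b,i,\<kappa>) k k)" for b i \<kappa>
  define F where "F = fid_state dL dL dL (diag_vec s) (R \<circ> noisy) id"
  have sumA: "(\<Sum>a\<in>{..<N} \<times> NI. f a) = (\<Sum>b<N. \<Sum>i<n. \<Sum>\<kappa><d i. f (b,i,\<kappa>))" for f :: "nat \<times> nat \<times> nat \<Rightarrow> 'a :: comm_monoid_add"
  proof -
    have "(\<Sum>a\<in>{..<N} \<times> NI. f a) = (\<Sum>b<N. \<Sum>z\<in>NI. f (b,z))" by (rule sum_Times)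
    then show ?thesis unfolding sum_NI .
  qed
  have Fsq: "F\<^sup>2 = (\<Sum>b<N. \<Sum>i<n. \<Sum>\<kappa><d i. (cmod (\<eta> b i \<kappa>))\<^sup>2)"
    unfolding F_def fid_state_diag_vec[OF Krep s(1)] sumA \<eta>_def by (simp add: sum_nonneg)
  \<comment> \<open>Labels b for the recovery, i for the position, l for the logical output and k
    for the reference. The content of the lost factor is kept apart as the index on which
    \<open>T\<close> acts.\<close>
  define Z where "Z = {..<N} \<times> {..<n} \<times> {..<dL} \<times> {..<dL}"
  \<comment> \<open>The factor \<open>real n\<close> compensates the probability 1/n of each
    position; in return the norm bound becomes n J.\<close>
  define T' where "T' z = (case z of (b,i,l,k) \<Rightarrow> \<lambda>\<kappa> \<kappa>'. of_real (real n * sg k) * T i \<kappa> \<kappa>')" for z :: "nat \<times> nat \<times> nat \<times> nat"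
  define m where "m z = (case z of (b,i,l,k) \<Rightarrow> d i)" for z :: "nat \<times> nat \<times> nat \<times> nat"
  define x where "x z = (case z of (b,i,l,k) \<Rightarrow> \<lambda>\<kappa>. of_real (s k) * K (b,i,\<kappa>) l k)" for z :: "nat \<times> nat \<times> nat \<times> nat"
  \<comment> \<open>The initial state times the normalised environment vector. For F = 0 division by
    zero makes it the zero vector, hence the inequality in \<open>normx0\<close>;
    \<open>overlap\<close> holds in this case too.\<close>
  define x0 where "x0 z = (case z of (b,i,l,k) \<Rightarrow> \<lambda>\<kappa>. if l = k then of_real (s k) * \<eta> b i \<kappa> / of_real F else 0)" for z :: "nat \<times> nat \<times> nat \<times> nat"
  have Zsum: "(\<Sum>z\<in>Z. \<Sum>\<kappa><m z. f z \<kappa>) = (\<Sum>k<dL. \<Sum>b<N. \<Sum>i<n. \<Sum>\<kappa><d i. \<Sum>l<dL. f (b,i,l,k) \<kappa>)"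
    for f :: "nat \<times> nat \<times> nat \<times> nat \<Rightarrow> nat \<Rightarrow> 'a :: comm_monoid_add"
    unfolding Z_def sum_product_quad m_def by (simp, rule sum_reorder)
  have normx: "(\<Sum>z\<in>Z. \<Sum>\<kappa><m z. (cmod (x z \<kappa>))\<^sup>2) = 1"
  proof -
    have col: "(\<Sum>b<N. \<Sum>i<n. \<Sum>\<kappa><d i. \<Sum>l<dL. (cmod (K (b,i,\<kappa>) l k))\<^sup>2) = 1" if k: "k < dL" for k
    proof -
      have "complex_of_real (\<Sum>b<N. \<Sum>i<n. \<Sum>\<kappa><d i. \<Sum>l<dL. (cmod (K (b,i,\<kappa>) l k))\<^sup>2)
        = (\<Sum>a\<in>{..<N} \<times> NI. \<Sum>l<dL. cnj (K a l k) * K a l k)"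
        unfolding sumA of_real_sum complex_norm_square by (simp only: mult.commute)
      also have "\<dots> = 1" using Ktp k by (simp add: kraus_tp_def)
      finally show ?thesis using of_real_eq_1_iff by blast
    qed
    have "(\<Sum>z\<in>Z. \<Sum>\<kappa><m z. (cmod (x z \<kappa>))\<^sup>2) = (\<Sum>k<dL. (s k)\<^sup>2 * (\<Sum>b<N. \<Sum>i<n. \<Sum>\<kappa><d i. \<Sum>l<dL. (cmod (K (b,i,\<kappa>) l k))\<^sup>2))"
      unfolding Zsum by (simp add: x_def norm_mult power_mult_distrib sum_distrib_left)
    also have "\<dots> = (\<Sum>k<dL. (s k)\<^sup>2)" using col by (intro sum.cong refl) simp
    finally show ?thesis using s(1) by simp
  qed
  have normx0: "(\<Sum>z\<in>Z. \<Sum>\<kappa><m z. (cmod (x0 z \<kappa>))\<^sup>2) \<le> 1"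
  proof -
    have "(\<Sum>z\<in>Z. \<Sum>\<kappa><m z. (cmod (x0 z \<kappa>))\<^sup>2)
      = (\<Sum>k<dL. \<Sum>b<N. \<Sum>i<n. \<Sum>\<kappa><d i. \<Sum>l<dL. if l = k then (s k)\<^sup>2 * ((cmod (\<eta> b i \<kappa>))\<^sup>2 / F\<^sup>2) else 0)"
      unfolding Zsum by (intro sum.cong refl) (simp add: x0_def norm_mult norm_divide power_mult_distrib power_divide)
    also have "\<dots> = (\<Sum>k<dL. (s k)\<^sup>2 * (\<Sum>b<N. \<Sum>i<n. \<Sum>\<kappa><d i. (cmod (\<eta> b i \<kappa>))\<^sup>2 / F\<^sup>2))"
      by (intro sum.cong refl) (simp add: sum_distrib_left)
    also have "\<dots> = (\<Sum>b<N. \<Sum>i<n. \<Sum>\<kappa><d i. (cmod (\<eta> b i \<kappa>))\<^sup>2 / F\<^sup>2)"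
      unfolding sum_distrib_right[symmetric] s(1) by simp
    also have "\<dots> = F\<^sup>2 / F\<^sup>2" by (simp only: Fsq sum_divide_distrib[symmetric])
    finally show ?thesis by simp
  qed
  have overlap: "(\<Sum>z\<in>Z. \<Sum>\<kappa><m z. cnj (x0 z \<kappa>) * x z \<kappa>) = of_real F"
  proof -
    have "(\<Sum>z\<in>Z. \<Sum>\<kappa><m z. cnj (x0 z \<kappa>) * x z \<kappa>)
      = (\<Sum>k<dL. \<Sum>b<N. \<Sum>i<n. \<Sum>\<kappa><d i. \<Sum>l<dL. if l = k then cnj (\<eta> b i \<kappa>) / of_real F * (of_real ((s k)\<^sup>2) * K (b,i,\<kappa>) k k) else 0)"
      unfolding Zsum by (intro sum.cong refl) (auto simp: x0_def x_def power2_eq_square)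
    also have "\<dots> = (\<Sum>k<dL. \<Sum>b<N. \<Sum>i<n. \<Sum>\<kappa><d i. cnj (\<eta> b i \<kappa>) / of_real F * (of_real ((s k)\<^sup>2) * K (b,i,\<kappa>) k k))"
      by (intro sum.cong refl) simp
    also have "\<dots> = (\<Sum>b<N. \<Sum>i<n. \<Sum>\<kappa><d i. \<Sum>k<dL. cnj (\<eta> b i \<kappa>) / of_real F * (of_real ((s k)\<^sup>2) * K (b,i,\<kappa>) k k))"
      by (subst sum.swap, rule sum.cong[OF refl], subst sum.swap, rule sum.cong[OF refl], rule sum.swap)
    also have "\<dots> = (\<Sum>b<N. \<Sum>i<n. \<Sum>\<kappa><d i. of_real ((cmod (\<eta> b i \<kappa>))\<^sup>2 / F))"
      unfolding sum_distrib_left[symmetric] \<eta>_def[symmetric] of_real_divide complex_norm_square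
      by (intro sum.cong refl) (simp add: mult.commute)
    also have "\<dots> = of_real (F\<^sup>2 / F)" unfolding Fsq by (simp add: sum_divide_distrib)
    finally show ?thesis by (simp add: power2_eq_square)
  qed
  \<comment> \<open>Reference and environment factorise in \<open>x0\<close>, and the mean of
    \<open>sg\<close> vanishes because \<open>s\<close> agrees at 0 and 1.\<close>
  have qx0: "(\<Sum>z\<in>Z. \<Sum>\<kappa><m z. \<Sum>\<kappa>'<m z. cnj (x0 z \<kappa>) * T' z \<kappa> \<kappa>' * x0 z \<kappa>') = 0"
  proof -
    define C where "C = (\<Sum>b<N. \<Sum>i<n. \<Sum>\<kappa><d i. \<Sum>\<kappa>'<d i. of_nat n * (cnj (\<eta> b i \<kappa> / of_real F) * T i \<kappa> \<kappa>' * (\<eta> b i \<kappa>' / of_real F)))"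
    have "(\<Sum>z\<in>Z. \<Sum>\<kappa><m z. \<Sum>\<kappa>'<m z. cnj (x0 z \<kappa>) * T' z \<kappa> \<kappa>' * x0 z \<kappa>')
      = (\<Sum>k<dL. \<Sum>b<N. \<Sum>i<n. \<Sum>\<kappa><d i. \<Sum>l<dL. if l = k then of_real (sg k) * (of_real ((s k)\<^sup>2) * (\<Sum>\<kappa>'<d i. of_nat n * (cnj (\<eta> b i \<kappa> / of_real F) * T i \<kappa> \<kappa>' * (\<eta> b i \<kappa>' / of_real F)))) else 0)"
      unfolding Zsum sum_distrib_left by (intro sum.cong refl) (auto simp: x0_def T'_def m_def power2_eq_square mult_ac intro!: sum.cong)
    also have "\<dots> = (\<Sum>k<dL. of_real (sg k) * (of_real ((s k)\<^sup>2) * C))"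
      unfolding C_def by (rule sum.cong[OF refl]) (simp add: sum_distrib_left)
    also have "\<dots> = 0" unfolding sum_sg s(2,3) by simp
    finally show ?thesis .
  qed
  \<comment> \<open>Summation over the recovery and output labels undoes the recovery, so the
    environment sees the charges of the two encoded basis states.\<close>
  have qx: "(\<Sum>z\<in>Z. \<Sum>\<kappa><m z. \<Sum>\<kappa>'<m z. cnj (x z \<kappa>) * T' z \<kappa> \<kappa>' * x z \<kappa>') = of_real (\<sigma>\<^sup>2) * (tau 0 - tau 1)"
  proof -
    have inner: "(\<Sum>b<N. \<Sum>l<dL. cnj (K (b,i,\<kappa>) l k) * K (b,i,\<kappa>') l k)
      = (\<Sum>x\<in>{x. x < D \<and> dig i x = 0}. cnj (V $$ (setd i x \<kappa>, k)) * V $$ (setd i x \<kappa>', k)) / of_nat n"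
      if "i < n" "\<kappa> < d i" "\<kappa>' < d i" for i \<kappa> \<kappa>' k
    proof -
      have "(\<Sum>b<N. \<Sum>l<dL. cnj (K (b,i,\<kappa>) l k) * K (b,i,\<kappa>') l k)
        = (\<Sum>p<n * D. cnj (enc_kraus (i,\<kappa>) p k) * enc_kraus (i,\<kappa>') p k)"
        unfolding K_def kraus_comp_def fst_conv snd_conv by (rule kraus_tp_inner[OF Ltp])
      then show ?thesis unfolding enc_kraus_def noise_inner[OF that] .
    qed
    have inner': "(\<Sum>b<N. \<Sum>i<n. \<Sum>\<kappa><d i. \<Sum>l<dL. \<Sum>\<kappa>'<d i. T i \<kappa> \<kappa>' * (of_nat n * (cnj (K (b,i,\<kappa>) l k) * K (b,i,\<kappa>') l k))) = tau k" for k
    proof -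
      have "(\<Sum>b<N. \<Sum>i<n. \<Sum>\<kappa><d i. \<Sum>l<dL. \<Sum>\<kappa>'<d i. T i \<kappa> \<kappa>' * (of_nat n * (cnj (K (b,i,\<kappa>) l k) * K (b,i,\<kappa>') l k)))
        = (\<Sum>i<n. \<Sum>b<N. \<Sum>\<kappa><d i. \<Sum>\<kappa>'<d i. \<Sum>l<dL. T i \<kappa> \<kappa>' * (of_nat n * (cnj (K (b,i,\<kappa>) l k) * K (b,i,\<kappa>') l k)))"
        by (subst sum.swap, rule sum.cong[OF refl], rule sum.cong[OF refl], rule sum.cong[OF refl], rule sum.swap)
      also have "\<dots> = (\<Sum>i<n. \<Sum>\<kappa><d i. \<Sum>\<kappa>'<d i. \<Sum>b<N. \<Sum>l<dL. T i \<kappa> \<kappa>' * (of_nat n * (cnj (K (b,i,\<kappa>) l k) * K (b,i,\<kappa>') l k)))"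
        by (rule sum.cong[OF refl], subst sum.swap, rule sum.cong[OF refl], rule sum.swap)
      also have "\<dots> = tau k"
        unfolding sum_distrib_left[symmetric] tau_def using inner n_pos by (intro sum.cong refl) simp
      finally show ?thesis .
    qed
    have "(\<Sum>z\<in>Z. \<Sum>\<kappa><m z. \<Sum>\<kappa>'<m z. cnj (x z \<kappa>) * T' z \<kappa> \<kappa>' * x z \<kappa>')
      = (\<Sum>k<dL. of_real (sg k) * (of_real ((s k)\<^sup>2) * (\<Sum>b<N. \<Sum>i<n. \<Sum>\<kappa><d i. \<Sum>l<dL. \<Sum>\<kappa>'<d i. T i \<kappa> \<kappa>' * (of_nat n * (cnj (K (b,i,\<kappa>) l k) * K (b,i,\<kappa>') l k)))))"
      unfolding Zsum sum_distrib_left by (intro sum.cong refl) (auto simp: x_def T'_def m_def power2_eq_square mult_ac intro!: sum.cong)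
    also have "\<dots> = of_real (\<sigma>\<^sup>2) * (tau 0 - tau 1)"
      unfolding inner' sum_sg s(2,3) by (simp add: algebra_simps)
    finally show ?thesis .
  qed
  have "Re (\<Sum>z\<in>Z. \<Sum>\<kappa><m z. \<Sum>\<kappa>'<m z. cnj (x z \<kappa>) * T' z \<kappa> \<kappa>' * x z \<kappa>')
      - Re (\<Sum>z\<in>Z. \<Sum>\<kappa><m z. \<Sum>\<kappa>'<m z. cnj (x0 z \<kappa>) * T' z \<kappa> \<kappa>' * x0 z \<kappa>') \<le> 2 * (real n * real J) * sqrt (1 - F\<^sup>2)"
  proof (rule hermitian_form_gap)
    show "finite Z" by (simp add: Z_def)
    show "0 \<le> real n * real J" by simp
    show "cnj (T' z a b) = T' z b a" for z a b by (cases z) (simp add: T'_def T_herm)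
    show "cmod (\<Sum>a<m z. \<Sum>b<m z. cnj (u a) * T' z a b * v b)
       \<le> real n * real J * (L2_set (\<lambda>a. cmod (u a)) {..<m z} * L2_set (\<lambda>a. cmod (v a)) {..<m z})" if z: "z \<in> Z" for z u v
    proof -
      obtain b i l k where z': "z = (b,i,l,k)" "i < n" using z by (auto simp: Z_def)
      let ?S = "\<Sum>a<d i. \<Sum>b<d i. cnj (u a) * T i a b * v b"
      let ?L = "real J * (L2_set (\<lambda>a. cmod (u a)) {..<d i} * L2_set (\<lambda>a. cmod (v a)) {..<d i})"
      have "(\<Sum>a<m z. \<Sum>b<m z. cnj (u a) * T' z a b * v b) = of_real (real n * sg k) * ?S"
        by (simp add: z'(1) m_def T'_def sum_distrib_left mult_ac)
      then have "cmod (\<Sum>a<m z. \<Sum>b<m z. cnj (u a) * T' z a b * v b) = (real n * \<bar>sg k\<bar>) * cmod ?S"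
        by (simp only: norm_mult norm_of_real abs_mult abs_of_nat)
      also have "\<dots> \<le> (real n * 1) * ?L"
        by (intro mult_mono mult_left_mono T_bound z') (auto simp: sg_def L2_set_nonneg)
      finally show ?thesis by (simp add: z'(1) m_def mult.assoc)
    qed
  qed (use normx normx0 overlap in auto)
  then have "2 * \<sigma>\<^sup>2 \<le> 2 * (real n * real J) * sqrt (1 - F\<^sup>2)"
    unfolding qx qx0 using tau_diff by (simp add: mult.commute right_diff_distrib[symmetric])
  then show ?thesis unfolding F_def by simp
qed

end

section \<open>Covariant codes\<close>

text \<open>The torus element multiplies the matrix unit between basis states 0 and 1 by cis (2 t).
  Sandwiching the covariance identity for this unit between the two code words gives
  \<open>B 0 t * cnj (B 1 t) = cis (2 * t)\<close>, whose derivative at 0 is the charge difference.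
  A common phase of the two amplitudes cancels in this product.\<close>

lemma (in radix) covariant_charge:
  assumes dL: "2 \<le> dL" and V: "V \<in> carrier_mat D dL" "mat_adjoint V * V = 1\<^sub>m dL"
    and A: "\<And>U j. U \<in> SU dL \<Longrightarrow> j < n \<Longrightarrow> Urep j U \<in> carrier_mat (d j) (d j)"
    and one: "\<And>j a b. j < n \<Longrightarrow> a < d j \<Longrightarrow> b < d j \<Longrightarrow> Urep j (emb dL 0 1 (cis 0) 0) $$ (a,b) = (if a = b then 1 else 0)"
    and der: "\<And>j a b. j < n \<Longrightarrow> a < d j \<Longrightarrow> b < d j \<Longrightarrow>
      ((\<lambda>t. Urep j (emb dL 0 1 (cis t) 0) $$ (a,b)) has_vector_derivative \<i> * T j a b) (at 0)"
    and cov: "\<And>U \<rho>. U \<in> SU dL \<Longrightarrow> \<rho> \<in> carrier_mat dL dL \<Longrightarrow>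
        V * (U * \<rho> * mat_adjoint U) * mat_adjoint V =
        kron_list (map (\<lambda>i. Urep i U) [0..<n]) * (V * \<rho> * mat_adjoint V)
          * mat_adjoint (kron_list (map (\<lambda>i. Urep i U) [0..<n]))"
  shows "Re (\<Sum>i<n. \<Sum>x\<in>{x. x < D \<and> dig i x = 0}. \<Sum>\<kappa><d i. \<Sum>\<kappa>'<d i. cnj (V $$ (setd i x \<kappa>, 0)) * T i \<kappa> \<kappa>' * V $$ (setd i x \<kappa>', 0))
       - Re (\<Sum>i<n. \<Sum>x\<in>{x. x < D \<and> dig i x = 0}. \<Sum>\<kappa><d i. \<Sum>\<kappa>'<d i. cnj (V $$ (setd i x \<kappa>, 1)) * T i \<kappa> \<kappa>' * V $$ (setd i x \<kappa>', 1)) = 2"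
    (is "Re (?\<tau> 0) - Re (?\<tau> 1) = 2")
proof -
  have 01: "0 < dL" "1 < dL" "(0::nat) \<noteq> 1" using dL by auto
  define h where "h t = emb dL 0 1 (cis t) 0" for t
  have h: "h t \<in> SU dL" "h t \<in> carrier_mat dL dL" for t
    unfolding h_def by (rule emb_SU[OF 01]) (simp_all add: cis_cnj cis_mult)
  define W where "W t = kron_list (map (\<lambda>i. Urep i (h t)) [0..<n])" for t
  have Wc: "W t \<in> carrier_mat D D" for t unfolding W_def by (rule kron_list_index(1)) (rule A[OF h(1)])
  define E :: "complex mat" where "E = mat dL dL (\<lambda>(a,b). if a = 0 \<and> b = 1 then 1 else 0)"
  have E: "E \<in> carrier_mat dL dL" by (simp add: E_def)
  have Esum: "(\<Sum>k<dL. \<Sum>k'<dL. f k * E $$ (k,k') * g k') = f 0 * g 1" for f g :: "nat \<Rightarrow> complex"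
  proof -
    have "(\<Sum>k<dL. \<Sum>k'<dL. f k * E $$ (k,k') * g k') = (\<Sum>k<dL. \<Sum>k'<dL. if k' = 1 then (if k = 0 then f 0 * g 1 else 0) else 0)"
      by (intro sum.cong refl) (auto simp: E_def)
    then show ?thesis using 01 by simp
  qed
  have hEh: "h t * E * mat_adjoint (h t) \<in> carrier_mat dL dL" for t
    by (rule mult_carrier_mat[OF mult_carrier_mat[OF h(2) E] mat_adjoint_carrier[OF h(2)]])
  have VEV: "V * E * mat_adjoint V \<in> carrier_mat D D"
    by (rule mult_carrier_mat[OF mult_carrier_mat[OF V(1) E] mat_adjoint_carrier[OF V(1)]])
  have hEh_index: "(h t * E * mat_adjoint (h t)) $$ (k,k') = cis (2 * t) * E $$ (k,k')" if k: "k < dL" "k' < dL" for t k k'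
    unfolding conjugation_index[OF h(2) E k] Esum
    using k 01 cis_mult[of t t] by (auto simp: h_def emb_eq_tor tor_index torf_def E_def cis_cnj)
  \<comment> \<open>The amplitude of the transformed code word \<open>k\<close> along the original
    one.\<close>
  define B where "B k t = (\<Sum>x<D. \<Sum>y<D. cnj (V $$ (x,k)) * W t $$ (x,y) * V $$ (y,k))" for k t
  have norm: "(\<Sum>x<D. cnj (V $$ (x,k)) * V $$ (x,k)) = 1" if "k < dL" for k
    using gram_index[OF V(1) V(1) that that] V(2) that by simp
  have key: "B 0 t * cnj (B 1 t) = cis (2 * t)" for t
  proof -
    have entry: "(\<Sum>x'<D. \<Sum>y'<D. W t $$ (x,x') * (V $$ (x',0) * cnj (V $$ (y',1))) * cnj (W t $$ (y,y')))
      = cis (2 * t) * (V $$ (x,0) * cnj (V $$ (y,1)))" if xy: "x < D" "y < D" for x y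
    proof -
      have "(\<Sum>x'<D. \<Sum>y'<D. W t $$ (x,x') * (V $$ (x',0) * cnj (V $$ (y',1))) * cnj (W t $$ (y,y')))
        = (W t * (V * E * mat_adjoint V) * mat_adjoint (W t)) $$ (x,y)"
        unfolding conjugation_index[OF Wc VEV xy]
        by (intro sum.cong refl) (simp add: conjugation_index[OF V(1) E] Esum del: index_mult_mat)
      also have "\<dots> = (V * (h t * E * mat_adjoint (h t)) * mat_adjoint V) $$ (x,y)"
        unfolding W_def cov[OF h(1) E] ..
      also have "\<dots> = (\<Sum>k<dL. \<Sum>k'<dL. V $$ (x,k) * (h t * E * mat_adjoint (h t)) $$ (k,k') * cnj (V $$ (y,k')))"
        by (rule conjugation_index[OF V(1) hEh xy])
      also have "\<dots> = (\<Sum>k<dL. \<Sum>k'<dL. (cis (2 * t) * V $$ (x,k)) * E $$ (k,k') * cnj (V $$ (y,k')))"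
        by (intro sum.cong refl) (simp add: hEh_index mult_ac del: index_mult_mat)
      also have "\<dots> = cis (2 * t) * (V $$ (x,0) * cnj (V $$ (y,1)))" unfolding Esum by (simp only: mult.assoc)
      finally show ?thesis .
    qed
    have "B 0 t * cnj (B 1 t) = (\<Sum>x<D. \<Sum>y<D. \<Sum>x'<D. \<Sum>y'<D.
        cnj (V $$ (x,0)) * V $$ (y,1) * (W t $$ (x,x') * (V $$ (x',0) * cnj (V $$ (y',1))) * cnj (W t $$ (y,y'))))"
      unfolding B_def cnj_sum sum_product by (intro sum.cong refl) (simp add: mult_ac)
    also have "\<dots> = (\<Sum>x<D. \<Sum>y<D. cnj (V $$ (x,0)) * V $$ (y,1) * (cis (2 * t) * (V $$ (x,0) * cnj (V $$ (y,1)))))"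
      unfolding sum_distrib_left[symmetric] using entry by (intro sum.cong refl) auto
    also have "\<dots> = cis (2 * t) * ((\<Sum>x<D. cnj (V $$ (x,0)) * V $$ (x,0)) * (\<Sum>y<D. cnj (V $$ (y,1)) * V $$ (y,1)))"
    proof -
      have "(\<Sum>x<D. \<Sum>y<D. cnj (V $$ (x,0)) * V $$ (y,1) * (cis (2 * t) * (V $$ (x,0) * cnj (V $$ (y,1)))))
        = (\<Sum>x<D. \<Sum>y<D. cis (2 * t) * ((cnj (V $$ (x,0)) * V $$ (x,0)) * (cnj (V $$ (y,1)) * V $$ (y,1))))"
        by (intro sum.cong refl) (simp only: mult_ac)
      then show ?thesis by (simp only: sum_product) (simp only: sum_distrib_left)
    qed
    finally show ?thesis using norm 01 by simp
  qed
  have B0: "B k 0 = 1" if "k < dL" for k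
    unfolding B_def W_def h_def using norm[OF that]
    by (subst kron_list_form_deriv(2)[where T = T]) (use A[OF h(1)] one der in \<open>auto simp: h_def\<close>)
  have dB: "(B k has_vector_derivative \<i> * ?\<tau> k) (at 0)" for k
    unfolding B_def W_def h_def
    by (rule kron_list_form_deriv(1)) (use A[OF h(1)] one der in \<open>auto simp: h_def\<close>)
  define \<tau> where "\<tau> k = ?\<tau> k" for k
  note dB' = dB[folded \<tau>_def]
  have "((\<lambda>t. B 0 t * cnj (B 1 t)) has_vector_derivative B 0 0 * cnj (\<i> * \<tau> 1) + \<i> * \<tau> 0 * cnj (B 1 0)) (at 0)"
    by (rule has_vector_derivative_mult[OF dB' bounded_linear.has_vector_derivative[OF bounded_linear_cnj dB']])
  moreover have "((\<lambda>t. B 0 t * cnj (B 1 t)) has_vector_derivative \<i> * of_real 2 * cis (2 * 0)) (at 0)"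
    unfolding key by (rule has_vector_derivative_cis)
  ultimately have "B 0 0 * cnj (\<i> * \<tau> 1) + \<i> * \<tau> 0 * cnj (B 1 0) = \<i> * of_real 2 * cis (2 * 0)"
    by (rule vector_derivative_unique_at)
  then have "\<i> * (\<tau> 0 - cnj (\<tau> 1)) = \<i> * 2" unfolding B0[OF 01(1)] B0[OF 01(2)]
    by (simp add: algebra_simps)
  then have "\<tau> 0 - cnj (\<tau> 1) = 2" by simp
  from arg_cong[OF this, of Re] have "Re (\<tau> 0) - Re (\<tau> 1) = 2" by simp
  then show ?thesis unfolding \<tau>_def .
qed

text \<open>Rewritten as an upper bound 1 - (c / K)^2 for F^2, the estimate is uniform over the set
  and passes to the supremum.\<close>

lemma Sup_fidelity_bound:
  fixes S :: "real set"
  assumes ne: "S \<noteq> {}" and S: "\<And>F. F \<in> S \<Longrightarrow> 0 \<le> F" "\<And>F. F \<in> S \<Longrightarrow> c \<le> K * sqrt (1 - F\<^sup>2)"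
    and c: "0 < c" and K: "0 \<le> K"
  shows "c \<le> K * sqrt (1 - (Sup S)\<^sup>2)"
proof -
  obtain F0 where F0: "F0 \<in> S" using ne by blast
  have K0: "K > 0" using S(2)[OF F0] c K by (cases "K = 0") auto
  define B where "B = sqrt (1 - (c / K)\<^sup>2)"
  have sq: "F\<^sup>2 \<le> 1 - (c / K)\<^sup>2" if F: "F \<in> S" for F
  proof -
    have 1: "c / K \<le> sqrt (1 - F\<^sup>2)" using S(2)[OF F] K0 by (simp add: field_simps)
    moreover have "0 < c / K" using c K0 by simp
    \<comment> \<open>The real \<open>sqrt\<close> is negative on negative numbers, so its
      positivity already yields F^2 < 1.\<close>
    ultimately have pos: "0 < 1 - F\<^sup>2" by (metis less_le_trans real_sqrt_gt_0_iff)
    have "(c / K)\<^sup>2 \<le> (sqrt (1 - F\<^sup>2))\<^sup>2" using 1 \<open>0 < c / K\<close> by (intro power_mono) auto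
    then show ?thesis using pos by simp
  qed
  have le: "F \<le> B" if F: "F \<in> S" for F
    unfolding B_def by (rule real_le_rsqrt[OF sq[OF F]])
  have bdd: "bdd_above S" using le by (auto simp: bdd_above_def)
  have "0 \<le> Sup S" by (rule order_trans[OF S(1)[OF F0] cSup_upper[OF F0 bdd]])
  moreover have "Sup S \<le> B" by (rule cSup_least[OF ne le])
  ultimately have "(Sup S)\<^sup>2 \<le> B\<^sup>2" by (intro power_mono) auto
  also have "B\<^sup>2 = 1 - (c / K)\<^sup>2" unfolding B_def using order_trans[OF zero_le_power2 sq[OF F0]] by simp
  finally have "(c / K)\<^sup>2 \<le> 1 - (Sup S)\<^sup>2" by simp
  then have "c / K \<le> sqrt (1 - (Sup S)\<^sup>2)" by (rule real_le_rsqrt)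
  then show ?thesis using K0 by (simp add: field_simps)
qed

section \<open>Bounds on the two error measures\<close>

context noisy_code
begin

lemma fid_state_nonneg:
  assumes "is_channel (n * D) dL R" "unit_vec_c (dL * dR) \<phi>"
  shows "0 \<le> fid_state dL dL dR \<phi> (R \<circ> noisy) id"
proof -
  obtain N L where "kraus_rep (n * D) dL {..<N :: nat} L R" by (rule channel_kraus[OF assms(1)])
  from fid_state_kraus[OF kraus_rep_comp[OF enc_kraus_rep(1) this] assms(2)]
  show ?thesis by (simp add: sum_nonneg)
qed

lemma channel_R: "\<exists>R. is_channel (n * D) dL R"
  by (rule channel_exists) (use dL in simp)

lemma eps_e_bound: "1 / real dL \<le> real n * real J * eps_e dL (n * D) noisy"
proof -
  define s where "s k = 1 / sqrt (real dL)" for k :: nat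
  have s2: "(s k)\<^sup>2 = 1 / real dL" for k by (simp add: s_def power_divide)
  have s: "(\<Sum>k<dL. (s k)\<^sup>2) = 1" using dL by (simp add: s2)
  have s01: "s 0 = 1 / sqrt (real dL)" "s 1 = 1 / sqrt (real dL)" by (simp_all add: s_def)
  have me: "max_ent dL = diag_vec s"
    unfolding max_ent_def diag_vec_def s_def by (rule eq_vecI) auto
  have "1 / real dL \<le> real n * real J * sqrt (1 - (Sup {fid_state dL dL dL (max_ent dL) (R \<circ> noisy) id | R. is_channel (n * D) dL R})\<^sup>2)"
  proof (rule Sup_fidelity_bound)
    show "{fid_state dL dL dL (max_ent dL) (R \<circ> noisy) id | R. is_channel (n * D) dL R} \<noteq> {}" using channel_R by auto
    show "0 < 1 / real dL" using dL by simp
    fix F assume "F \<in> {fid_state dL dL dL (max_ent dL) (R \<circ> noisy) id | R. is_channel (n * D) dL R}"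
    then obtain R where R: "is_channel (n * D) dL R" and F: "F = fid_state dL dL dL (diag_vec s) (R \<circ> noisy) id"
      unfolding me by blast
    show "0 \<le> F" unfolding F by (rule fid_state_nonneg[OF R diag_vec_unit[OF s]])
    show "1 / real dL \<le> real n * real J * sqrt (1 - F\<^sup>2)"
      using fidelity_estimate[OF R s s01] unfolding F by (simp add: power_divide)
  qed simp
  then show ?thesis unfolding eps_e_def f_e_def .
qed

lemma eps_worst_bound: "1 / 2 \<le> real n * real J * eps_worst dL (n * D) noisy"
proof -
  define s where "s k = (if k < 2 then 1 / sqrt 2 else 0)" for k :: nat
  have "(\<Sum>k<dL. (s k)\<^sup>2) = (\<Sum>k\<in>{0,1}. (s k)\<^sup>2)"
    using dL by (intro sum.mono_neutral_right) (auto simp: s_def)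
  then have s: "(\<Sum>k<dL. (s k)\<^sup>2) = 1" by (simp add: s_def power_divide)
  have s01: "s 0 = 1 / sqrt 2" "s 1 = 1 / sqrt 2" by (simp_all add: s_def)
  let ?I = "\<lambda>R. {fid_state dL dL dR \<phi> (R \<circ> noisy) id | dR \<phi>. 1 \<le> dR \<and> unit_vec_c (dL * dR) \<phi>}"
  have "1 / 2 \<le> real n * real J * sqrt (1 - (Sup {Inf (?I R) | R. is_channel (n * D) dL R})\<^sup>2)"
  proof (rule Sup_fidelity_bound)
    show "{Inf (?I R) | R. is_channel (n * D) dL R} \<noteq> {}" using channel_R by auto
    fix F assume "F \<in> {Inf (?I R) | R. is_channel (n * D) dL R}"
    then obtain R where R: "is_channel (n * D) dL R" and F: "F = Inf (?I R)" by blast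
    define G where "G = fid_state dL dL dL (diag_vec s) (R \<circ> noisy) id"
    \<comment> \<open>A single test state bounds the infimum from above; its reference is a copy of
      the logical system.\<close>
    have mem: "G \<in> ?I R" unfolding G_def using diag_vec_unit[OF s] dL by (intro CollectI exI[of _ dL] exI[of _ "diag_vec s"]) auto
    have nn: "0 \<le> y" if "y \<in> ?I R" for y using that fid_state_nonneg[OF R] by blast
    show F0: "0 \<le> F" unfolding F by (rule cInf_greatest) (use mem nn in auto)
    have "F \<le> G" unfolding F by (rule cInf_lower[OF mem]) (use nn in \<open>auto simp: bdd_below_def\<close>)
    then have "F\<^sup>2 \<le> G\<^sup>2" using F0 by (intro power_mono) auto
    then have le: "real n * real J * sqrt (1 - G\<^sup>2) \<le> real n * real J * sqrt (1 - F\<^sup>2)"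
      by (intro mult_left_mono real_sqrt_le_mono) auto
    have "1 / 2 \<le> real n * real J * sqrt (1 - G\<^sup>2)"
      using fidelity_estimate[OF R s s01] unfolding G_def by (simp add: power_divide)
    then show "1 / 2 \<le> real n * real J * sqrt (1 - F\<^sup>2)" using le by linarith
  qed simp_all
  then show ?thesis unfolding eps_worst_def f_worst_def .
qed

end

text \<open>Here \<open>c\<close> is a squared Schmidt coefficient and a = n / c is the prefactor
  under the ceiling: 2 n for c = 1 / 2, and n times the logical dimension for its reciprocal. As
  \<open>J\<close> is an integer, 1 / (a e) \<le> J survives rounding up.\<close>

lemma binomial_of_eps:
  fixes e :: real
  assumes le: "c \<le> real n * real J * e" and c: "0 < c" and a: "a * c = real n" "0 < a"
  shows "0 < e" "(m + nat \<lceil>1 / (a * e)\<rceil>) choose m \<le> (m + J) choose m"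
proof -
  have pos: "0 < (real n * real J) * e" using le c by linarith
  show e: "0 < e"
  proof (rule ccontr)
    assume "\<not> 0 < e"
    then have "(real n * real J) * e \<le> 0" by (intro mult_nonneg_nonpos) auto
    with pos show False by simp
  qed
  have "c * 1 \<le> c * (a * e * real J)" using le unfolding a(1)[symmetric] by (simp add: mult_ac)
  then have "1 \<le> a * e * real J" using c by (simp only: mult_le_cancel_left_pos)
  then have "1 / (a * e) \<le> real J" using e a(2) by (simp add: divide_le_eq mult.commute)
  then have "\<lceil>1 / (a * e)\<rceil> \<le> int J" by (simp only: ceiling_le_iff of_int_of_nat_eq)
  then have "nat \<lceil>1 / (a * e)\<rceil> \<le> J" by (simp only: nat_le_iff)
  then show "(m + nat \<lceil>1 / (a * e)\<rceil>) choose m \<le> (m + J) choose m" by (intro binomial_right_mono) simp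
qed

theorem theorem7:
  fixes n dL :: nat and d :: "nat \<Rightarrow> nat" and V :: "complex mat"
    and Urep :: "nat \<Rightarrow> complex mat \<Rightarrow> complex mat" and \<phi>s :: "nat \<Rightarrow> complex vec"
  assumes n_pos: "1 \<le> n" and dL_pos: "1 \<le> dL" and d_pos: "\<forall>i<n. 1 \<le> d i"
    and V_iso: "V \<in> carrier_mat (total_dim n d) dL" "mat_adjoint V * V = 1\<^sub>m dL"
    and reps: "\<forall>i<n. cont_unitary_rep dL (d i) (Urep i)"
    and covariant: "\<forall>U \<in> SU dL. \<forall>\<rho> \<in> carrier_mat dL dL.
        V * (U * \<rho> * mat_adjoint U) * mat_adjoint V =
        kron_list (map (\<lambda>i. Urep i U) [0..<n]) * (V * \<rho> * mat_adjoint V)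
          * mat_adjoint (kron_list (map (\<lambda>i. Urep i U) [0..<n]))"
    and phis: "\<forall>i<n. unit_vec_c (d i) (\<phi>s i)"
  shows "(2 \<le> dL \<longrightarrow>
            0 < eps_worst dL (n * total_dim n d) (noiseN n d \<phi>s \<circ> (\<lambda>\<rho>. V * \<rho> * mat_adjoint V)) \<and>
            0 < eps_e dL (n * total_dim n d) (noiseN n d \<phi>s \<circ> (\<lambda>\<rho>. V * \<rho> * mat_adjoint V)))
       \<and> Max (d ` {..<n}) \<ge>
           (dL - 1 + nat \<lceil>1 / (2 * real n *
              eps_worst dL (n * total_dim n d) (noiseN n d \<phi>s \<circ> (\<lambda>\<rho>. V * \<rho> * mat_adjoint V)))\<rceil>)
           choose (dL - 1)
       \<and> Max (d ` {..<n}) \<ge>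
           (dL - 1 + nat \<lceil>1 / (real n * real dL *
              eps_e dL (n * total_dim n d) (noiseN n d \<phi>s \<circ> (\<lambda>\<rho>. V * \<rho> * mat_adjoint V)))\<rceil>)
           choose (dL - 1)"
proof (cases "2 \<le> dL")
  \<comment> \<open>For dL = 1 the lower index of both binomials is 0, so their value is 1.\<close>
  case False
  have "d 0 \<le> Max (d ` {..<n})" using n_pos by (intro Max_ge) auto
  moreover have "1 \<le> d 0" using d_pos n_pos by simp
  ultimately show ?thesis using False dL_pos by (simp add: le_Suc_eq)
next
  case dL: True
  interpret radix n d by unfold_locales (use d_pos in blast)
  \<comment> \<open>The properties are bundled so that the generators and integers of all factors
    can be chosen at once.\<close>
  define good where "good i T J \<longleftrightarrow>
      (\<forall>a b. a < d i \<longrightarrow> b < d i \<longrightarrow> ((\<lambda>t. Urep i (emb dL 0 1 (cis t) 0) $$ (a,b)) has_vector_derivative \<i> * T a b) (at 0)) \<and>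
      (\<forall>a b. a < d i \<longrightarrow> b < d i \<longrightarrow> Urep i (emb dL 0 1 (cis 0) 0) $$ (a,b) = (if a = b then 1 else 0)) \<and>
      (\<forall>a b. cnj (T a b) = T b a) \<and>
      (\<forall>u v. cmod (\<Sum>a<d i. \<Sum>b<d i. cnj (u a) * T a b * v b)
         \<le> real J * (L2_set (\<lambda>a. cmod (u a)) {..<d i} * L2_set (\<lambda>a. cmod (v a)) {..<d i})) \<and>
      (dL - 1 + J) choose (dL - 1) \<le> d i" for i T J
  have "\<exists>TJ. good i (fst TJ) (snd TJ)" if i: "i < n" for i
  proof -
    have r: "cont_unitary_rep dL (d i) (Urep i)" "1 \<le> d i" using reps pos[OF i] i by auto
    show ?thesis
    proof (rule rep_generator[OF r(1) dL r(2)])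
      fix T :: "nat \<Rightarrow> nat \<Rightarrow> complex" and J :: nat
      assume "\<And>a b. a < d i \<Longrightarrow> b < d i \<Longrightarrow> ((\<lambda>t. Urep i (emb dL 0 1 (cis t) 0) $$ (a,b)) has_vector_derivative \<i> * T a b) (at 0)"
        "\<And>t a b. a < d i \<Longrightarrow> b < d i \<Longrightarrow> Urep i (emb dL 0 1 (cis 0) 0) $$ (a,b) = (if a = b then 1 else 0)"
        "\<And>a b. cnj (T a b) = T b a"
        "\<And>u v. cmod (\<Sum>a<d i. \<Sum>b<d i. cnj (u a) * T a b * v b)
         \<le> real J * (L2_set (\<lambda>a. cmod (u a)) {..<d i} * L2_set (\<lambda>a. cmod (v a)) {..<d i})"
        "(dL - 1 + J) choose (dL - 1) \<le> d i"
      then have "good i (fst (T,J)) (snd (T,J))" unfolding good_def by simp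
      then show ?thesis by blast
    qed
  qed
  then obtain TJ where TJ: "\<And>i. i < n \<Longrightarrow> good i (fst (TJ i)) (snd (TJ i))" by metis
  \<comment> \<open>Extended by zero beyond the factors because the hermiticity clause of
    \<open>noisy_code\<close> ranges over all \<open>i\<close>.\<close>
  define T where "T i a b = (if i < n then fst (TJ i) a b else 0)" for i a b
  define J where "J i = snd (TJ i)" for i
  \<comment> \<open>The largest J is a norm bound for every factor, and it is attained at one
    factor, whose dimension bounds the maximum from below.\<close>
  define Jm where "Jm = Max (J ` {..<n})"
  have J_le: "J i \<le> Jm" if "i < n" for i unfolding Jm_def using that by (intro Max_ge) auto
  have "Jm \<in> J ` {..<n}" unfolding Jm_def by (rule Max_in) (use n_pos in \<open>auto simp: lessThan_empty_iff\<close>)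
  then obtain i0 where i0: "i0 < n" "Jm = J i0" by auto
  have "(dL - 1 + Jm) choose (dL - 1) \<le> d i0" using TJ[OF i0(1)] unfolding i0(2) good_def J_def by blast
  also have "d i0 \<le> Max (d ` {..<n})" using i0 by (intro Max_ge) auto
  finally have dim: "(dL - 1 + Jm) choose (dL - 1) \<le> Max (d ` {..<n})" .
  have V1: "V \<in> carrier_mat (total_dim n d) dL" by (rule V_iso(1))
  interpret noisy_code n d dL V \<phi>s T Jm
  proof unfold_locales
    show "cnj (T i a b) = T i b a" for i a b
      using TJ[of i] by (cases "i < n") (simp_all add: T_def good_def)
    show "cmod (\<Sum>a<d i. \<Sum>b<d i. cnj (u a) * T i a b * v b)
       \<le> real Jm * (L2_set (\<lambda>a. cmod (u a)) {..<d i} * L2_set (\<lambda>a. cmod (v a)) {..<d i})" if i: "i < n" for i u v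
    proof -
      have "cmod (\<Sum>a<d i. \<Sum>b<d i. cnj (u a) * T i a b * v b)
         \<le> real (J i) * (L2_set (\<lambda>a. cmod (u a)) {..<d i} * L2_set (\<lambda>a. cmod (v a)) {..<d i})"
        using TJ[OF i] i unfolding good_def T_def J_def by simp
      also have "\<dots> \<le> real Jm * (L2_set (\<lambda>a. cmod (u a)) {..<d i} * L2_set (\<lambda>a. cmod (v a)) {..<d i})"
        using J_le[OF i] by (intro mult_right_mono) (auto simp: L2_set_nonneg)
      finally show ?thesis .
    qed
    show "Re (\<Sum>i<n. \<Sum>x\<in>{x. x < D \<and> dig i x = 0}. \<Sum>\<kappa><d i. \<Sum>\<kappa>'<d i. cnj (V $$ (setd i x \<kappa>, 0)) * T i \<kappa> \<kappa>' * V $$ (setd i x \<kappa>', 0))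
       - Re (\<Sum>i<n. \<Sum>x\<in>{x. x < D \<and> dig i x = 0}. \<Sum>\<kappa><d i. \<Sum>\<kappa>'<d i. cnj (V $$ (setd i x \<kappa>, 1)) * T i \<kappa> \<kappa>' * V $$ (setd i x \<kappa>', 1)) = 2"
    proof (rule covariant_charge[OF dL V_iso])
      show "Urep j U \<in> carrier_mat (d j) (d j)" if "U \<in> SU dL" "j < n" for U j
        using reps that by (simp add: cont_unitary_rep_def unitary_mat_def)
      show "Urep j (emb dL 0 1 (cis 0) 0) $$ (a,b) = (if a = b then 1 else 0)" if "j < n" "a < d j" "b < d j" for j a b
        using TJ[OF that(1)] that unfolding good_def by blast
      show "((\<lambda>t. Urep j (emb dL 0 1 (cis t) 0) $$ (a,b)) has_vector_derivative \<i> * T j a b) (at 0)"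
        if "j < n" "a < d j" "b < d j" for j a b
        using TJ[OF that(1)] that unfolding good_def T_def by simp
      show "V * (U * \<rho> * mat_adjoint U) * mat_adjoint V =
        kron_list (map (\<lambda>i. Urep i U) [0..<n]) * (V * \<rho> * mat_adjoint V)
          * mat_adjoint (kron_list (map (\<lambda>i. Urep i U) [0..<n]))" if "U \<in> SU dL" "\<rho> \<in> carrier_mat dL dL" for U \<rho>
        using covariant that by blast
    qed
  qed (use n_pos dL V_iso phis in auto)
  have "1 \<le> real n" "1 \<le> real dL" using n_pos dL_pos by auto
  then have a: "2 * real n * (1 / 2) = real n" "0 < 2 * real n" "real n * real dL * (1 / real dL) = real n" "0 < real n * real dL" "0 < 1 / real dL"
    by auto
  note w = binomial_of_eps(1)[OF eps_worst_bound _ a(1,2)] binomial_of_eps(2)[OF eps_worst_bound _ a(1,2), where m = "dL - 1"]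
  note e = binomial_of_eps(1)[OF eps_e_bound a(5) a(3,4)] binomial_of_eps(2)[OF eps_e_bound a(5) a(3,4), where m = "dL - 1"]
  show ?thesis using w e dim by (auto intro: order_trans)
qed

end
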